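(* Let $d\ge2$ and let $A$ be a signed adjacency matrix of a finite $d$-regular graph $G$ such that $r_A\le\sqrt{2(d-1)}$. (i) If $G$ is triangle-free, then $$\rho(A)^2\le\frac{5d-6+\sqrt{49d^2-92d+36}}{2}<6(d-1).$$ (ii) If $G$ has girth at least five, then $$\rho(A)^2\le\frac{5d-6+\sqrt{45d^2-88d+36}}{2}<\frac{5+3\sqrt5}{2}(d-1).$$ Moreover, every finite $d$-regular triangle-free graph (respectively, every finite $d$-regular graph of girth at least five) admits an edge signing whose signed adjacency matrix satisfies the bound in (i) (respectively, in (ii)).
   Context: All graphs are finite, simple and undirected, with vertex set $[n]$, $n\ge1$. An edge signing of $G=(V,E)$ is a map $\sigma:E\to\{-1,+1\}$; its signed adjacency matrix is the real symmetric $n\times n$ matrix whose $(i,j)$ entry is $\sigma(\{i,j\})$ if $\{i,j\}\in E$ and $0$ otherwise. $\rho(A)=\|A\|_{\mathrm{op}}$ denotes the spectral radius of a symmetric matrix. For $S\subseteq[n]$, $A[S]$ is the principal submatrix indexed by $S$ (the characteristic polynomial of the empty submatrix is $1$). For Hermitian $n\times n$ matrices $A_1,\dots,A_k$ the normalized mixed determinantal polynomial is $$\chi[A_1,\dots,A_k](x)=k^{-n}\sum_{S_1\sqcup\cdots\sqcup S_k=[n]}\ \prod_{j=1}^k\det(xI-A_j[S_j]),$$ the sum being over ordered partitions of $[n]$ into $k$ possibly empty parts; it is monic of degree $n$ and real-rooted. For a real symmetric zero-diagonal matrix $A$, $r_A$ denotes the largest root of $\chi[A,-A]$. *)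

theory Defs
  imports
    Complex_Main
    "HOL-Library.Extended_Nat"
    "Jordan_Normal_Form.Char_Poly"
    "Jordan_Normal_Form.DL_Submatrix"
    "Jordan_Normal_Form.Spectral_Radius"
begin

text \<open>Graphs have vertex set \<open>{0..<n}\<close> (playing the role of \<open>[n]\<close>, in agreement with the
  indexing of matrices) and are given by their set of edges.\<close>

definition simple_graph :: "nat \<Rightarrow> nat set set \<Rightarrow> bool" where
  "simple_graph n E \<longleftrightarrow> E \<subseteq> {e. e \<subseteq> {0..<n} \<and> card e = 2}"

definition regular_graph :: "nat \<Rightarrow> nat set set \<Rightarrow> nat \<Rightarrow> bool" where
  "regular_graph n E d \<longleftrightarrow> (\<forall>v\<in>{0..<n}. card {u \<in> {0..<n}. {u, v} \<in> E} = d)"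

text \<open>The three vertices are automatically distinct, since edges of a simple graph have two elements.\<close>

definition triangle_free :: "nat set set \<Rightarrow> bool" where
  "triangle_free E \<longleftrightarrow> \<not> (\<exists>x y z. {x, y} \<in> E \<and> {y, z} \<in> E \<and> {x, z} \<in> E)"

text \<open>A cycle is represented by the list of its vertices, without repeating the first one at the end.\<close>

definition cycles :: "nat set set \<Rightarrow> nat list set" where
  "cycles E = {c. length c \<ge> 3 \<and> distinct c \<and>
     (\<forall>i. Suc i < length c \<longrightarrow> {c ! i, c ! Suc i} \<in> E) \<and> {last c, hd c} \<in> E}"

text \<open>The girth of an acyclic graph is \<open>\<infinity>\<close>.\<close>

definition girth :: "nat set set \<Rightarrow> enat" where
  "girth E = (INF c\<in>cycles E. enat (length c))"

definition edge_signing :: "nat set set \<Rightarrow> (nat set \<Rightarrow> real) \<Rightarrow> bool" where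
  "edge_signing E \<sigma> \<longleftrightarrow> (\<forall>e\<in>E. \<sigma> e \<in> {-1, 1})"

definition signed_adj_mat :: "nat \<Rightarrow> nat set set \<Rightarrow> (nat set \<Rightarrow> real) \<Rightarrow> real mat" where
  "signed_adj_mat n E \<sigma> = mat n n (\<lambda>(i, j). if {i, j} \<in> E then \<sigma> {i, j} else 0)"

text \<open>The library defines the spectral radius for complex matrices only.\<close>

definition rho :: "real mat \<Rightarrow> real" where
  "rho A = spectral_radius (map_mat complex_of_real A)"

definition ordered_partitions :: "nat \<Rightarrow> nat \<Rightarrow> nat set list set" where
  "ordered_partitions n k = {Ss. length Ss = k \<and> \<Union> (set Ss) = {0..<n} \<and>
     (\<forall>i<k. \<forall>j<k. i \<noteq> j \<longrightarrow> Ss ! i \<inter> Ss ! j = {})}"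

lemma finite_ordered_partitions: "finite (ordered_partitions n k)"
proof (rule finite_subset)
  show "ordered_partitions n k \<subseteq> {Ss. set Ss \<subseteq> Pow {0..<n} \<and> length Ss = k}"
    unfolding ordered_partitions_def by auto
  show "finite {Ss. set Ss \<subseteq> Pow {0..<n} \<and> length Ss = k}"
    by (rule finite_lists_length_eq) simp
qed

text \<open>The matrices in the list are meant to be Hermitian and of size \<open>n\<close>. The characteristic
  polynomial \<open>char_poly\<close> is \<open>det (x I - A)\<close>, which is \<open>1\<close> for the empty matrix.\<close>

definition mixed_det_poly :: "nat \<Rightarrow> 'a::field mat list \<Rightarrow> 'a poly" where
  "mixed_det_poly n As = smult (1 / of_nat (length As) ^ n)
     (\<Sum>Ss\<in>ordered_partitions n (length As).
        \<Prod>j<length As. char_poly (submatrix (As ! j) (Ss ! j) (Ss ! j)))"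

text \<open>For a real symmetric \<open>A\<close> all complex roots of the polynomial below are real, so the largest
  root may be taken over the reals.\<close>

definition largest_root :: "real mat \<Rightarrow> real" where
  "largest_root A = Max {x. poly (mixed_det_poly (dim_row A) [A, - A]) x = 0}"

definition bound_triangle_free :: "nat \<Rightarrow> real" where
  "bound_triangle_free d = (5 * real d - 6 + sqrt (49 * real d ^ 2 - 92 * real d + 36)) / 2"

definition bound_girth_five :: "nat \<Rightarrow> real" where
  "bound_girth_five d = (5 * real d - 6 + sqrt (45 * real d ^ 2 - 88 * real d + 36)) / 2"

end

theory Submission
  imports
    Defs
    "HOL-Analysis.Elementary_Topology"
    "HOL-Computational_Algebra.Polynomial_FPS"
begin

text \<open>
  For symmetric \<open>A\<close> let \<open>h(z) = \<Sum>S. det((Z - A)[S]) det(A[V - S])\<close> with \<open>Z = diag z\<close>; then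
  \<open>2^n\<close> times \<open>\<chi>[A, -A](x)\<close> is \<open>h\<close> at \<open>z = (2x, \<dots>, 2x)\<close>, since
  \<open>\<Sum>S. det((X + M)[S]) det((Y + N)[V - S])\<close> depends only on \<open>X + Y\<close>. This \<open>h\<close> is real
  stable, even if \<open>Z - A\<close> alone is perturbed by a rank-one matrix \<open>w v v\<^sup>T\<close>. Hence for
  every unit vector \<open>v\<close> the derivative in \<open>w\<close>, divided by \<open>h\<close>, is the Cauchy transform of a
  probability measure on the roots of \<open>h(x, \<dots>, x)\<close>, which are symmetric about \<open>0\<close> and thus lie
  in \<open>[-2 r\<^sub>A, 2 r\<^sub>A]\<close>. If \<open>v\<close> is an eigenvector with eigenvalue \<open>\<lambda>\<close> and \<open>G\<close> is
  \<open>d\<close>-regular and triangle-free, the second moment is \<open>m\<^sub>2 = \<lambda>\<^sup>2 + d\<close> and the fourth is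
  \<open>m\<^sub>4 = \<lambda>^4 + (3d - 2) \<lambda>\<^sup>2 + 2 d\<^sup>2 + \<Sum>i. v\<^sub>i\<^sup>2 \<Sum>m\<noteq>i. ((A\<^sup>2)\<^sub>i\<^sub>m)\<^sup>2\<close>, and
  \<open>m\<^sub>4 \<le> 4 r\<^sub>A\<^sup>2 m\<^sub>2 \<le> 8 (d - 1) m\<^sub>2\<close> is a quadratic inequality for \<open>\<lambda>\<^sup>2\<close>. The inner sum is
  nonnegative, and equal to \<open>d (d - 1)\<close> if there are no 4-cycles.

  Averaging \<open>h\<close> over the sign of an edge \<open>ij\<close> amounts to applying \<open>1 - 2 \<partial>\<^sub>i \<partial>\<^sub>j\<close>, which
  preserves stability; averaging over all signs gives a rescaled matching polynomial, whose roots are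
  bounded by the argument of Heilmann and Lieb. The signs are then chosen one at a time without increasing
  the largest root.
\<close>

section \<open>Determinants over finite index sets\<close>

text \<open>The second moment alone gives lam^2 \<le> 7d - 8, because the measure has mass 1 and its
  support satisfies l^2 \<le> 8(d - 1); the fourth moment pushes this below 6(d - 1). Both moments
  must be independent of n, and they are: whatever counts the whole graph (the number of edges, the
  sum of all 4-minors) occurs in numerator and denominator of the Cauchy transform alike and
  cancels. They are read off at infinity: with e = 1/x, numerator and denominator become power
  series whose coefficient of order j only sees minors of size at most j, and zero diagonal and
  absence of triangles kill the sizes 1 and 3. For the signing, the obstacle is that the mean of two
  real-rooted polynomials by itself says little about their roots. Here the two signs are ends of a
  path of real-rooted polynomials, the weight of the edge running through [-1, 1], and following
  this path replaces an interlacing argument. Minors are indexed by sets, not by positions, since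
  every identity compares minors of different subsets under the same names of indices.\<close>

definition pminor :: "nat set \<Rightarrow> (nat \<Rightarrow> nat \<Rightarrow> 'a) \<Rightarrow> 'a::comm_ring_1" where
  "pminor S M = (\<Sum>p | p permutes S. signof p * (\<Prod>i\<in>S. M i (p i)))"

lemma pminor_cong:
  assumes "\<And>i j. i \<in> S \<Longrightarrow> j \<in> S \<Longrightarrow> M i j = N i j"
  shows "pminor S M = pminor S N"
  unfolding pminor_def
  by (intro sum.cong refl arg_cong2[of _ _ _ _ "(*)"] prod.cong)
     (auto intro!: assms simp: permutes_in_image)

lemma pminor_empty [simp]: "pminor {} M = 1"
  unfolding pminor_def by (simp add: sign_def evenperm_id permutes_empty)

text \<open>Conjugation by \<open>f\<close> sends the transposition of \<open>a\<close> and
  \<open>b\<close> to that of \<open>f a\<close> and \<open>f b\<close>, so the sign is carried over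
  by induction along a product of transpositions.\<close>

lemma sign_conjugate:
  assumes f: "bij_betw f A B" and fin: "finite A" and p: "p permutes A"
  shows "sign (\<lambda>x. if x \<in> B then f (p (inv_into A f x)) else x) = sign p"
  using p fin
proof (induct rule: permutes_induct)
  case id
  have "(\<lambda>x. if x \<in> B then f (id (inv_into A f x)) else x) = id"
    using f by (auto simp: fun_eq_iff bij_betw_inv_into_right)
  then show ?case by simp
next
  case (swap a b p)
  let ?c = "\<lambda>p x. if x \<in> B then f (p (inv_into A f x)) else x"
  have finB: "finite B" using f fin bij_betw_finite by blast
  have pa: "permutation p" using \<open>p permutes A\<close> fin permutation_permutes by blast
  have cp: "?c p permutes B"
    using bij_betwE[OF bij_betw_permutations[OF f]] \<open>p permutes A\<close> by blast
  have pb: "permutation (?c p)" using cp finB permutation_permutes by blast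
  have inj: "inj_on f A" using f by (simp add: bij_betw_def)
  have "?c (transpose a b \<circ> p) = transpose (f a) (f b) \<circ> ?c p"
  proof
    fix x
    show "?c (transpose a b \<circ> p) x = (transpose (f a) (f b) \<circ> ?c p) x"
    proof (cases "x \<in> B")
      case True
      have i: "inv_into A f x \<in> A" using True f by (metis bij_betw_def inv_into_into)
      then have pi: "p (inv_into A f x) \<in> A" using \<open>p permutes A\<close> permutes_in_image by metis
      show ?thesis using True pi inj swap(1,2)
        by (auto simp: transpose_def inj_on_eq_iff)
    next
      case False
      then have "x \<noteq> f a" "x \<noteq> f b" using swap(1,2) f by (auto simp: bij_betw_def)
      then show ?thesis using False by (simp add: transpose_def)
    qed
  qed
  moreover have "f a = f b \<longleftrightarrow> a = b" using inj swap(1,2) by (auto simp: inj_on_eq_iff)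
  ultimately show ?case
    using swap sign_compose[OF permutation_swap_id pa, of a b]
      sign_compose[OF permutation_swap_id pb, of "f a" "f b"]
    by (simp add: sign_swap_id comp_def)
qed

lemma pminor_reindex:
  assumes f: "bij_betw f A B" and fin: "finite A"
  shows "pminor B M = pminor A (\<lambda>i j. M (f i) (f j))"
proof -
  let ?c = "\<lambda>p x. if x \<in> B then f (p (inv_into A f x)) else x"
  have "pminor B M = (\<Sum>p | p permutes A. signof (?c p) * (\<Prod>i\<in>B. M i (?c p i)))"
    unfolding pminor_def
    by (rule sum.reindex_bij_betw[OF bij_betw_permutations[OF f], symmetric])
  also have "\<dots> = pminor A (\<lambda>i j. M (f i) (f j))"
    unfolding pminor_def
  proof (intro sum.cong refl arg_cong2[of _ _ _ _ "(*)"])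
    fix p assume p: "p \<in> {p. p permutes A}"
    show "(\<Prod>i\<in>B. M i (?c p i)) = (\<Prod>i\<in>A. M (f i) (f (p i)))"
      by (subst prod.reindex_bij_betw[OF f, symmetric], rule prod.cong)
         (use f in \<open>auto simp: bij_betw_def\<close>)
    show "signof (?c p) = (signof p :: 'a)"
      using sign_conjugate[OF f fin, of p] p by simp
  qed
  finally show ?thesis .
qed

lemma pminor_eq_det:
  assumes f: "bij_betw f {0..<m} S"
  shows "pminor S M = det (mat m m (\<lambda>(i, j). M (f i) (f j)))"
proof -
  have "pminor S M = pminor {0..<m} (\<lambda>i j. M (f i) (f j))" by (rule pminor_reindex[OF f]) simp
  also have "\<dots> = det (mat m m (\<lambda>(i, j). M (f i) (f j)))"
    unfolding pminor_def
    by (subst det_def'[of _ m])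
       (auto intro!: sum.cong prod.cong arg_cong2[of _ _ _ _ "(*)"] simp: permutes_in_image)
  finally show ?thesis .
qed

lemma (in comm_ring_hom) hom_pminor: "hom (pminor S M) = pminor S (\<lambda>i j. hom (M i j))"
  unfolding pminor_def by (simp add: hom_distribs)

lemma pminor_scale:
  "pminor S (\<lambda>i j. r i * M i j * c j) = (\<Prod>i\<in>S. r i) * (\<Prod>i\<in>S. c i) * pminor S M"
proof -
  have "(\<Prod>i\<in>S. r i * M i (p i) * c (p i)) = (\<Prod>i\<in>S. r i) * (\<Prod>i\<in>S. c i) * (\<Prod>i\<in>S. M i (p i))"
    if "p permutes S" for p
    using prod.permute[OF that, of c] by (simp add: prod.distrib o_def mult_ac)
  then show ?thesis
    unfolding pminor_def sum_distrib_left by (intro sum.cong) (auto simp: mult_ac)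
qed

lemma pminor_mult:
  assumes "finite S"
  shows "pminor S (\<lambda>i j. \<Sum>k\<in>S. M i k * N k j) = pminor S M * pminor S N" (is "?L = _")
proof -
  obtain f where f: "bij_betw f {0..<card S} S" using ex_bij_betw_nat_finite[OF assms] by blast
  let ?m = "card S"
  have "?L
      = det (mat ?m ?m (\<lambda>(i, j). M (f i) (f j)) * mat ?m ?m (\<lambda>(i, j). N (f i) (f j)))"
    unfolding pminor_eq_det[OF f]
    by (rule arg_cong[of _ _ det], rule eq_matI)
       (auto simp: scalar_prod_def sum.reindex_bij_betw[OF f, symmetric])
  also have "\<dots> = pminor S M * pminor S N"
    by (subst det_mult[of _ ?m]) (auto simp: pminor_eq_det[OF f])
  finally show ?thesis .
qed

lemma pminor_kernel:
  fixes M :: "nat \<Rightarrow> nat \<Rightarrow> 'a::field"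
  assumes "finite S" "pminor S M = 0"
  obtains u where "\<exists>i\<in>S. u i \<noteq> 0" "\<And>i. i \<in> S \<Longrightarrow> (\<Sum>j\<in>S. M i j * u j) = 0"
proof -
  obtain f where f: "bij_betw f {0..<card S} S" using ex_bij_betw_nat_finite[OF assms(1)] by blast
  let ?m = "card S" let ?g = "inv_into {0..<card S} f"
  let ?A = "mat ?m ?m (\<lambda>(i, j). M (f i) (f j))"
  have "det ?A = 0" using assms(2) pminor_eq_det[OF f] by metis
  then obtain v where v: "v \<in> carrier_vec ?m" "v \<noteq> 0\<^sub>v ?m" "?A *\<^sub>v v = 0\<^sub>v ?m"
    using det_0_iff_vec_prod_zero_field[of ?A ?m] by auto
  define u where "u i = v $ ?g i" for i
  have uf: "u (f a) = v $ a" if "a < ?m" for a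
    using that f by (simp add: u_def bij_betw_inv_into_left)
  have "\<exists>a<?m. v $ a \<noteq> 0" using v(1,2) by auto
  then have 1: "\<exists>i\<in>S. u i \<noteq> 0" using uf f by (metis atLeastLessThan_iff bij_betwE zero_le)
  have 2: "(\<Sum>j\<in>S. M i j * u j) = 0" if i: "i \<in> S" for i
  proof -
    obtain a where a: "a < ?m" "f a = i" using i f by (metis atLeastLessThan_iff bij_betw_iff_bijections)
    have "(\<Sum>j\<in>S. M i j * u j) = (\<Sum>b\<in>{0..<?m}. M i (f b) * u (f b))"
      by (rule sum.reindex_bij_betw[OF f, symmetric])
    also have "\<dots> = (?A *\<^sub>v v) $ a"
      using a v(1) by (auto simp: scalar_prod_def uf intro!: sum.cong)
    finally show ?thesis using v(3) a by simp
  qed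
  show ?thesis using 1 2 by (rule that)
qed

lemma permutes_insert_fix:
  assumes "i \<in> S"
  shows "{p. p permutes S \<and> p i = i} = {p. p permutes (S - {i})}"
proof (rule equalityI; rule subsetI)
  fix p assume "p \<in> {p. p permutes S \<and> p i = i}"
  then have p: "p permutes S" "p i = i" by auto
  have "p permutes (S - {i})"
    by (rule permutes_superset[OF p(1)]) (use p(2) in auto)
  then show "p \<in> {p. p permutes (S - {i})}" by simp
next
  fix p assume "p \<in> {p. p permutes (S - {i})}"
  then have p: "p permutes (S - {i})" by simp
  then show "p \<in> {p. p permutes S \<and> p i = i}"
    using permutes_subset[OF p, of S] permutes_not_in[OF p, of i] by auto
qed

lemma pminor_fix_sum:
  assumes "finite S" "i \<in> S"
  shows "(\<Sum>p | p permutes S \<and> p i = i. signof p * (\<Prod>k\<in>S. M k (p k))) = M i i * pminor (S - {i}) M"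
  unfolding pminor_def permutes_insert_fix[OF assms(2)] sum_distrib_left
  by (intro sum.cong refl)
     (auto simp: prod.remove[OF assms] permutes_not_in mult_ac)

lemma pminor_split:
  assumes "finite S" "i \<in> S"
  shows "pminor S M = M i i * pminor (S - {i}) M
    + (\<Sum>p | p permutes S \<and> p i \<noteq> i. signof p * (\<Prod>k\<in>S. M k (p k)))"
proof -
  have "pminor S M = (\<Sum>p\<in>{p. p permutes S \<and> p i = i} \<union> {p. p permutes S \<and> p i \<noteq> i}.
      signof p * (\<Prod>k\<in>S. M k (p k)))"
    unfolding pminor_def by (rule sum.cong) auto
  also have "\<dots> = (\<Sum>p | p permutes S \<and> p i = i. signof p * (\<Prod>k\<in>S. M k (p k)))
      + (\<Sum>p | p permutes S \<and> p i \<noteq> i. signof p * (\<Prod>k\<in>S. M k (p k)))"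
    using finite_permutations[OF assms(1)] by (intro sum.union_disjoint) auto
  finally show ?thesis unfolding pminor_fix_sum[OF assms] .
qed

lemma pminor_diag_add:
  assumes "finite S" "i \<in> S"
    and N: "\<And>j k. j \<in> S \<Longrightarrow> k \<in> S \<Longrightarrow> N j k = M j k + (if j = i \<and> k = i then t else 0)"
  shows "pminor S N = pminor S M + t * pminor (S - {i}) M"
proof -
  have "pminor (S - {i}) N = pminor (S - {i}) M" by (rule pminor_cong) (auto simp: N)
  moreover have "(\<Sum>p | p permutes S \<and> p i \<noteq> i. signof p * (\<Prod>k\<in>S. N k (p k)))
      = (\<Sum>p | p permutes S \<and> p i \<noteq> i. signof p * (\<Prod>k\<in>S. M k (p k)))"
    by (intro sum.cong prod.cong refl arg_cong2[of _ _ _ _ "(*)"]) (auto simp: N permutes_in_image)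
  ultimately show ?thesis
    using assms(2) by (simp add: pminor_split[OF assms(1,2)] N algebra_simps)
qed

lemma pminor_column:
  assumes "finite S" "i \<in> S" and "\<And>k. k \<in> S \<Longrightarrow> k \<noteq> i \<Longrightarrow> M k i = 0"
  shows "pminor S M = M i i * pminor (S - {i}) M"
proof -
  have "(\<Prod>k\<in>S. M k (p k)) = 0" if p: "p permutes S" "p i \<noteq> i" for p
  proof -
    obtain k where k: "p k = i" using p(1) by (metis permutes_surj surjD)
    have "k \<in> S" using k p(1) assms(2) by (metis permutes_in_image)
    moreover have "k \<noteq> i" using k p(2) by auto
    ultimately have "M k (p k) = 0" using assms(3) k by simp
    then show ?thesis using \<open>k \<in> S\<close> assms(1) by (meson prod_zero)
  qed
  then show ?thesis by (simp add: pminor_split[OF assms(1,2)])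
qed

lemma pminor_row:
  assumes "finite S" "i \<in> S" and "\<And>k. k \<in> S \<Longrightarrow> k \<noteq> i \<Longrightarrow> M i k = 0"
  shows "pminor S M = M i i * pminor (S - {i}) M"
proof -
  have "(\<Prod>k\<in>S. M k (p k)) = 0" if p: "p permutes S" "p i \<noteq> i" for p
  proof -
    have "p i \<in> S" using p(1) assms(2) by (metis permutes_in_image)
    then have "M i (p i) = 0" using assms(3) p by simp
    then show ?thesis using assms(1,2) by (meson prod_zero)
  qed
  then show ?thesis by (simp add: pminor_split[OF assms(1,2)])
qed

lemma pminor_diag: "finite S \<Longrightarrow> pminor S (\<lambda>i j. if i = j then c i else 0) = (\<Prod>i\<in>S. c i)"
proof (induct rule: finite_induct)
  case (insert x F)
  then have "insert x F - {x} = F" by auto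
  then show ?case using insert by (subst pminor_row[of _ x]) auto
qed auto

text \<open>The column operation \<open>E\<close> subtracts the combination \<open>y\<close> of the
  other columns from column \<open>i\<close>; it has determinant 1 and clears that column inside
  \<open>W\<close>. As \<open>y\<close> is a given solution instead of coming from an inverse, the
  lemma also serves power series.\<close>

lemma pminor_schur:
  assumes "finite W" "i \<notin> W"
    and y: "\<And>j. j \<in> W \<Longrightarrow> (\<Sum>k\<in>W. M j k * y k) = M j i"
  shows "pminor (insert i W) M = (M i i - (\<Sum>k\<in>W. M i k * y k)) * pminor W M"
proof -
  let ?S = "insert i W"
  define E where "E k j = (if k = j then 1 else if j = i then - y k else 0)" for k j
  have ne: "k \<noteq> i" if "k \<in> W" for k using that assms(2) by auto
  have S: "?S - {i} = W" using assms(2) by auto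
  have "pminor W E = pminor W (\<lambda>k j. if k = j then 1 else 0)"
    by (rule pminor_cong) (auto simp: E_def ne)
  then have dE: "pminor ?S E = 1"
    using assms(1) by (subst pminor_row[of _ i]) (auto simp: E_def S pminor_diag)
  define N where "N j l = (\<Sum>k\<in>?S. M j k * E k l)" for j l
  have Ni: "N j i = M j i - (\<Sum>k\<in>W. M j k * y k)" for j
    using assms(1,2) ne by (simp add: N_def E_def sum_negf cong: sum.cong)
  have Nl: "N j l = M j l" if "l \<in> W" for j l
    using assms(1,2) that ne by (auto simp: N_def E_def if_distrib[of "\<lambda>x. _ * x"] cong: if_cong sum.cong)
  have "pminor ?S M = pminor ?S N"
    using pminor_mult[of ?S M E] assms(1) dE by (simp add: N_def[abs_def])
  also have "\<dots> = N i i * pminor W N"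
    using assms(1) y by (subst pminor_column[of _ i]) (auto simp: S Ni)
  also have "pminor W N = pminor W M" by (rule pminor_cong) (simp add: Nl)
  finally show ?thesis by (simp add: Ni)
qed

section \<open>Stable families of multi-affine polynomials\<close>

lemma sum_Pow_insert:
  assumes "finite K" "i \<notin> K"
  shows "(\<Sum>S\<in>Pow (insert i K). f S) = (\<Sum>S\<in>Pow K. f S + f (insert i S))"
proof -
  have "inj_on (insert i) (Pow K)" using assms(2) by (auto simp: inj_on_def)
  moreover have "Pow K \<inter> insert i ` Pow K = {}" using assms(2) by auto
  ultimately show ?thesis
    using assms(1) by (simp add: Pow_insert sum.union_disjoint sum.reindex sum.distrib)
qed

lemma sum_Pow_remove:
  assumes "finite V" "i \<in> V"
  shows "(\<Sum>S\<in>Pow V. f S) = (\<Sum>S\<in>Pow (V - {i}). f S + f (insert i S))"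
proof -
  have V: "insert i (V - {i}) = V" using assms(2) by blast
  show ?thesis by (rule sum_Pow_insert[of "V - {i}" i f, unfolded V]) (simp_all add: assms(1))
qed

type_synonym 'a family = "nat set \<Rightarrow> (nat \<Rightarrow> 'a) \<Rightarrow> 'a"

text \<open>A family assigns to each index set \<open>W\<close> a multi-affine polynomial in the variables
  \<open>x\<^sub>i\<close> with \<open>i \<in> W\<close>, such that \<open>\<partial>\<^sub>i\<close> turns the polynomial of \<open>W\<close> into that of \<open>W - {i}\<close>.\<close>

definition affine_family :: "nat set \<Rightarrow> 'a::comm_ring_1 family \<Rightarrow> bool" where
  "affine_family U M \<longleftrightarrow> (\<forall>W x i t. W \<subseteq> U \<longrightarrow> i \<in> U \<longrightarrow>
     M W (x(i := x i + t)) = M W x + (if i \<in> W then t * M (W - {i}) x else 0))"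

text \<open>Nonvanishing is demanded of all \<open>W\<close> at once, that is, also of all partial
  derivatives in distinct variables, so that quotients \<open>P W x / P (W - {i}) x\<close> always
  make sense in the upper half-plane.\<close>

definition stable_family :: "nat set \<Rightarrow> complex family \<Rightarrow> bool" where
  "stable_family U M \<longleftrightarrow> affine_family U M \<and>
     (\<forall>W x. W \<subseteq> U \<longrightarrow> (\<forall>i\<in>U. Im (x i) > 0) \<longrightarrow> M W x \<noteq> 0)"

lemma affine_familyD:
  "affine_family U M \<Longrightarrow> W \<subseteq> U \<Longrightarrow> i \<in> W \<Longrightarrow> M W (x(i := x i + t)) = M W x + t * M (W - {i}) x"
  using subsetD[of W U i] by (simp add: affine_family_def)

lemma affine_familyD':
  "affine_family U M \<Longrightarrow> W \<subseteq> U \<Longrightarrow> i \<in> U \<Longrightarrow> i \<notin> W \<Longrightarrow> M W (x(i := x i + t)) = M W x"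
  unfolding affine_family_def by simp

lemma stable_family_affine: "stable_family U M \<Longrightarrow> affine_family U M"
  by (simp add: stable_family_def)

lemma stable_family_nonzero:
  "stable_family U M \<Longrightarrow> W \<subseteq> U \<Longrightarrow> \<forall>i\<in>U. Im (x i) > 0 \<Longrightarrow> M W x \<noteq> 0"
  by (simp add: stable_family_def)

definition conv :: "'a::comm_ring_1 family \<Rightarrow> 'a family \<Rightarrow> nat set \<Rightarrow> (nat \<Rightarrow> 'a) \<Rightarrow> (nat \<Rightarrow> 'a) \<Rightarrow> 'a" where
  "conv M N V x y = (\<Sum>S\<in>Pow V. M S x * N (V - S) y)"

lemma conv_commute:
  assumes "finite V"
  shows "conv M N V x y = conv N M V y x"
  unfolding conv_def
  by (rule sum.reindex_bij_witness[of _ "\<lambda>S. V - S" "\<lambda>S. V - S"]) (auto simp: double_diff mult.commute)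

lemma conv_affine:
  assumes M: "affine_family U M" and "finite U" "W \<subseteq> U" "i \<in> U"
  shows "conv M N W (x(i := x i + t)) y = conv M N W x y + (if i \<in> W then t * conv M N (W - {i}) x y else 0)"
proof (cases "i \<in> W")
  case True
  have fin: "finite W" by (meson assms finite_subset)
  have *: "M S (x(i := x i + t)) * N (W - S) y + M (insert i S) (x(i := x i + t)) * N (W - insert i S) y
      = (M S x * N (W - S) y + M (insert i S) x * N (W - insert i S) y) + t * (M S x * N (W - {i} - S) y)"
    if "S \<in> Pow (W - {i})" for S
  proof -
    have S: "S \<subseteq> U" "insert i S \<subseteq> U" "i \<notin> S" using that True assms(3) by auto
    have 1: "M S (x(i := x i + t)) = M S x" by (rule affine_familyD'[OF M]) (use S assms in auto)
    have 2: "insert i S - {i} = S" "W - {i} - S = W - insert i S" using S by auto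
    have 3: "M (insert i S) (x(i := x i + t)) = M (insert i S) x + t * M S x"
      using affine_familyD[OF M S(2), of i x t] by (simp add: 2)
    show ?thesis unfolding 1 2 3 by (simp add: algebra_simps)
  qed
  show ?thesis
    using True unfolding conv_def sum_Pow_remove[OF fin True]
    by (simp add: * sum.distrib sum_distrib_left del: Pow_iff cong: sum.cong)
next
  case False
  have "M S (x(i := x i + t)) = M S x" if "S \<in> Pow W" for S
    by (rule affine_familyD'[OF M]) (use that False assms(3,4) in auto)
  then show ?thesis using False by (simp add: conv_def)
qed

lemma conv_affine2:
  assumes N: "affine_family U N" and "finite U" "W \<subseteq> U" "i \<in> U"
  shows "conv M N W x (y(i := y i + t)) = conv M N W x y + (if i \<in> W then t * conv M N (W - {i}) x y else 0)"
proof -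
  have "finite W" by (meson assms finite_subset)
  then show ?thesis
    using conv_affine[OF assms, of M y t x] by (simp add: conv_commute[of _ M N])
qed

text \<open>Adding \<open>t\<close> to \<open>x i\<close> or to \<open>y i\<close> has the same
  effect on \<open>conv\<close>, namely \<open>t * conv M N (W - {i}) x y\<close> for
  \<open>i\<close> in \<open>W\<close>. So only \<open>x i + y i\<close> matters, and
  \<open>y\<close> can be moved into \<open>x\<close> one index at a time.\<close>

lemma conv_shift:
  assumes M: "affine_family U M" and N: "affine_family U N" and "finite U" "W \<subseteq> U" "T \<subseteq> U"
  shows "conv M N W (\<lambda>i. if i \<in> T then x i + y i else x i) (\<lambda>i. if i \<in> T then 0 else y i) = conv M N W x y"
proof -
  have "finite T" by (meson assms finite_subset)
  then show ?thesis using \<open>T \<subseteq> U\<close>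
  proof (induct rule: finite_induct)
    case (insert i T)
    define X where "X T i = (if i \<in> T then x i + y i else x i)" for T i
    define Y where "Y T i = (if i \<in> T then 0 else y i)" for T i
    have i: "i \<in> U" using insert by auto
    have 1: "X (insert i T) = (X T)(i := X T i + y i)" using insert(2) by (auto simp: X_def fun_eq_iff)
    have 2: "Y T = (Y (insert i T))(i := Y (insert i T) i + y i)" using insert(2) by (auto simp: Y_def fun_eq_iff)
    have "conv M N W (X (insert i T)) (Y (insert i T)) = conv M N W (X T) (Y T)"
      by (subst 1, subst 2) (simp only: conv_affine[OF M assms(3,4) i] conv_affine2[OF N assms(3,4) i])
    then have "conv M N W (\<lambda>j. if j \<in> insert i T then x j + y j else x j) (\<lambda>j. if j \<in> insert i T then 0 else y j)
      = conv M N W (\<lambda>j. if j \<in> T then x j + y j else x j) (\<lambda>j. if j \<in> T then 0 else y j)"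
      by (simp add: X_def[abs_def] Y_def[abs_def])
    then show ?case using insert by simp
  qed simp
qed

text \<open>\<open>pconv M N K V\<close> arises from \<open>M V x * N V y\<close> by applying \<open>\<partial>\<close> in \<open>x\<^sub>i\<close> plus \<open>\<partial>\<close> in
  \<open>y\<^sub>i\<close> for all \<open>i \<in> K\<close>. Each step preserves stability: if the linear coefficient in \<open>t\<close> of
  \<open>pconv_step\<close> vanished, \<open>a + c t\<^sup>2\<close> would have a root in the closed upper half-plane.\<close>

definition pconv :: "'a::comm_ring_1 family \<Rightarrow> 'a family \<Rightarrow> nat set \<Rightarrow> nat set \<Rightarrow> (nat \<Rightarrow> 'a) \<Rightarrow> (nat \<Rightarrow> 'a) \<Rightarrow> 'a" where
  "pconv M N K V x y = (\<Sum>S\<in>Pow K. M (V - S) x * N (V - (K - S)) y)"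

lemma pconv_step:
  assumes M: "affine_family U M" and N: "affine_family U N" and "finite U" "V \<subseteq> U" "K \<subseteq> V" "i \<in> V" "i \<notin> K"
  shows "pconv M N K V (x(i := x i + t)) (y(i := y i + t))
    = pconv M N K V x y + t * pconv M N (insert i K) V x y + t\<^sup>2 * pconv M N K (V - {i}) x y"
proof -
  have fin: "finite K" by (meson assms finite_subset)
  have *: "M (V - S) (x(i := x i + t)) * N (V - (K - S)) (y(i := y i + t))
      = M (V - S) x * N (V - (K - S)) y
      + t * (M (V - S) x * N (V - (insert i K - S)) y + M (V - insert i S) x * N (V - (insert i K - insert i S)) y)
      + t\<^sup>2 * (M (V - {i} - S) x * N (V - {i} - (K - S)) y)"
    if "S \<in> Pow K" for S
  proof -
    have S: "i \<in> V - S" "i \<in> V - (K - S)" "V - S \<subseteq> U" "V - (K - S) \<subseteq> U" using that assms by auto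
    have 1: "V - insert i S = V - S - {i}" "V - {i} - S = V - S - {i}"
      "V - (insert i K - S) = V - (K - S) - {i}" "V - {i} - (K - S) = V - (K - S) - {i}"
      "insert i K - insert i S = K - S"
      using that assms by auto
    show ?thesis
      unfolding 1 affine_familyD[OF M S(3,1)] affine_familyD[OF N S(4,2)]
      by (simp add: algebra_simps power2_eq_square)
  qed
  show ?thesis
    unfolding pconv_def sum_Pow_insert[OF fin assms(7)]
    by (simp only: * sum.distrib sum_distrib_left distrib_left cong: sum.cong)
qed

lemma upper_half_root:
  fixes a c :: complex
  assumes "c \<noteq> 0"
  obtains t where "a + t\<^sup>2 * c = 0" "Im t \<ge> 0"
proof -
  define s where "s = csqrt (- a / c)"
  have s: "a + s\<^sup>2 * c = 0" using assms by (simp add: s_def)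
  show ?thesis using that[of s] that[of "- s"] s by (cases "Im s \<ge> 0") auto
qed

lemma pconv_nonzero:
  assumes M: "stable_family U M" and N: "stable_family U N" and "finite U"
    and "V \<subseteq> U" "K \<subseteq> V" "\<forall>i\<in>U. Im (x i) > 0" "\<forall>i\<in>U. Im (y i) > 0"
  shows "pconv M N K V x y \<noteq> 0"
proof -
  have "finite K" by (meson assms finite_subset)
  then show ?thesis using assms(4-)
  proof (induct arbitrary: V x y rule: finite_induct)
    case empty
    then show ?case using M N by (simp add: pconv_def stable_family_def)
  next
    case (insert i K)
    have aff: "affine_family U M" "affine_family U N" using M N by (auto simp: stable_family_def)
    \<comment> \<open>This is the coefficient of \<open>t\<^sup>2\<close>; it belongs to a smaller
      vertex set, which is why \<open>V\<close> is generalized in the induction.\<close>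
    have c: "pconv M N K (V - {i}) x y \<noteq> 0" using insert by (intro insert(3)) auto
    show ?case
    proof
      assume b: "pconv M N (insert i K) V x y = 0"
      obtain t where t: "pconv M N K V x y + t\<^sup>2 * pconv M N K (V - {i}) x y = 0" "Im t \<ge> 0"
        using upper_half_root[OF c] by blast
      have "pconv M N K V (x(i := x i + t)) (y(i := y i + t)) = 0"
        using pconv_step[OF aff assms(3) insert(4), of K i x t y] insert b t by simp
      moreover have "pconv M N K V (x(i := x i + t)) (y(i := y i + t)) \<noteq> 0"
        using insert t(2) by (intro insert(3)) (auto intro: add_pos_nonneg)
      ultimately show False by simp
    qed
  qed
qed

lemma conv_nonzero:
  assumes "stable_family U M" "stable_family U N" "finite U"
    and "V \<subseteq> U" "\<forall>i\<in>U. Im (x i) > 0" "\<forall>i\<in>U. Im (y i) > 0"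
  shows "conv M N V x y \<noteq> 0"
proof -
  have "conv M N V x y = pconv M N V V x y"
    unfolding conv_def pconv_def
    by (rule sum.reindex_bij_witness[of _ "\<lambda>S. V - S" "\<lambda>S. V - S"]) (auto simp: double_diff)
  then show ?thesis using pconv_nonzero[OF assms(1-4) subset_refl assms(5,6)] by simp
qed

lemma stable_family_conv:
  assumes M: "stable_family U M" and N: "stable_family U N" and fin: "finite U"
  shows "stable_family U (\<lambda>W z. conv M N W z (\<lambda>_. 0))"
proof -
  have aff: "affine_family U M" "affine_family U N" using M N by (auto simp: stable_family_def)
  have "conv M N W z (\<lambda>_. 0) \<noteq> 0" if W: "W \<subseteq> U" and z: "\<forall>i\<in>U. Im (z i) > 0" for W z
  proof -
    \<comment> \<open>Halving \<open>z\<close> leaves both arguments in the open upper half-plane,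
      where \<open>conv_nonzero\<close> applies; the shift then returns everything to the first
      argument.\<close>
    let ?y = "\<lambda>i. if i \<in> U then z i / 2 else 0" and ?x = "\<lambda>i. if i \<in> U then z i / 2 else z i"
    have "conv M N W (\<lambda>i. if i \<in> U then ?x i + ?y i else ?x i) (\<lambda>i. if i \<in> U then 0 else ?y i) = conv M N W ?x ?y"
      by (rule conv_shift[OF aff fin W subset_refl])
    moreover have "(\<lambda>i. if i \<in> U then ?x i + ?y i else ?x i) = z" "(\<lambda>i. if i \<in> U then 0 else ?y i) = (\<lambda>_. 0)"
      by (auto simp: fun_eq_iff)
    moreover have "conv M N W ?x ?y \<noteq> 0"
      by (rule conv_nonzero[OF M N fin W]) (use z in auto)
    ultimately show ?thesis by simp
  qed
  then show ?thesis
    unfolding stable_family_def affine_family_def using conv_affine[OF aff(1) fin] by auto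
qed

text \<open>Otherwise minus the quotient is an admissible shift of \<open>x i\<close>, and this
  shift makes the affine function \<open>P W\<close> of \<open>x i\<close> vanish.\<close>

lemma stable_ratio:
  assumes P: "stable_family U P" and W: "W \<subseteq> U" "i \<in> W" and x: "\<forall>i\<in>U. Im (x i) > 0"
  shows "Im (P W x / P (W - {i}) x) > 0"
proof (rule ccontr)
  define t where "t = - (P W x / P (W - {i}) x)"
  assume "\<not> ?thesis"
  then have t: "Im t \<ge> 0" by (simp add: t_def del: Im_divide)
  have "P (W - {i}) x \<noteq> 0" by (rule stable_family_nonzero[OF P _ x]) (use W in auto)
  then have 0: "P W x + t * P (W - {i}) x = 0" by (simp add: t_def)
  have "P W (x(i := x i + t)) = P W x + t * P (W - {i}) x"
    by (rule affine_familyD[OF stable_family_affine[OF P] W])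
  moreover have "P W (x(i := x i + t)) \<noteq> 0"
    by (rule stable_family_nonzero[OF P W(1)]) (use x t in \<open>auto intro: add_pos_nonneg\<close>)
  ultimately show False using 0 by simp
qed

text \<open>The operator is 1 - c \<partial>i \<partial>j. A zero at \<open>x\<close> would mean
  that shifting \<open>x i\<close> by \<open>t = - c * d / b\<close>, with \<open>d\<close> and
  \<open>b\<close> the members of \<open>W - {i, j}\<close> and \<open>W - {i}\<close>, produces a
  zero of \<open>P W\<close>. This shift is admissible because \<open>b / d\<close> lies in the
  upper half-plane by \<open>stable_ratio\<close>.\<close>

lemma stable_family_edge:
  assumes P: "stable_family U P" and ij: "i \<noteq> j" and c: "c > 0"
  shows "stable_family U (\<lambda>W x. P W x - (if i \<in> W \<and> j \<in> W then of_real c * P (W - {i, j}) x else 0))"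
proof -
  have aff: "affine_family U P" and nz: "\<And>W x. W \<subseteq> U \<Longrightarrow> \<forall>i\<in>U. Im (x i) > 0 \<Longrightarrow> P W x \<noteq> 0"
    using P by (auto simp: stable_family_def)
  have "P W x - of_real c * P (W - {i, j}) x \<noteq> 0"
    if W: "W \<subseteq> U" and ijW: "i \<in> W" "j \<in> W" and x: "\<forall>i\<in>U. Im (x i) > 0" for W x
  proof
    assume eq: "P W x - of_real c * P (W - {i, j}) x = 0"
    have W2: "W - {i} - {j} = W - {i, j}" by auto
    let ?d = "P (W - {i, j}) x" and ?b = "P (W - {i}) x"
    have "Im (?b / ?d) > 0"
      using stable_ratio[OF P _ _ x, of "W - {i}" j] W ijW ij W2 by auto
    define t where "t = - (of_real c * ?d / ?b)"
    have b: "?b \<noteq> 0" "?d \<noteq> 0" by (rule nz[OF _ x]; use W in auto)+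
    define r where "r = ?b / ?d"
    have "t = - (of_real c * inverse r)" using b by (simp add: t_def r_def field_simps)
    then have "Im t = c * (Im r / ((Re r)\<^sup>2 + (Im r)\<^sup>2))" by simp
    then have t: "Im t \<ge> 0" using c \<open>Im (?b / ?d) > 0\<close> unfolding r_def[symmetric] by simp
    have "P W (x(i := x i + t)) = P W x + t * ?b" using aff W ijW by (intro affine_familyD)
    also have "\<dots> = 0" using eq b by (simp add: t_def)
    finally have "P W (x(i := x i + t)) = 0" .
    moreover have "P W (x(i := x i + t)) \<noteq> 0"
      by (rule nz[OF W]) (use x t in \<open>auto intro: add_pos_nonneg\<close>)
    ultimately show False by simp
  qed
  moreover have "affine_family U (\<lambda>W x. P W x - (if i \<in> W \<and> j \<in> W then of_real c * P (W - {i, j}) x else 0))"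
    unfolding affine_family_def
  proof (intro allI impI)
    fix W x k and t :: complex assume W: "W \<subseteq> U" and k: "k \<in> U"
    have 1: "P W (x(k := x k + t)) = P W x + (if k \<in> W then t * P (W - {k}) x else 0)"
      "P (W - {i, j}) (x(k := x k + t)) = P (W - {i, j}) x + (if k \<in> W - {i, j} then t * P (W - {i, j} - {k}) x else 0)"
      using aff W k unfolding affine_family_def by (meson Diff_subset subset_trans)+
    have 2: "W - {i, j} - {k} = W - {k} - {i, j}" by auto
    show "P W (x(k := x k + t)) - (if i \<in> W \<and> j \<in> W then of_real c * P (W - {i, j}) (x(k := x k + t)) else 0)
      = P W x - (if i \<in> W \<and> j \<in> W then of_real c * P (W - {i, j}) x else 0)
      + (if k \<in> W then t * (P (W - {k}) x - (if i \<in> W - {k} \<and> j \<in> W - {k} then of_real c * P (W - {k} - {i, j}) x else 0)) else 0)"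
      unfolding 1 2 by (auto simp: algebra_simps)
  qed
  ultimately show ?thesis using nz unfolding stable_family_def by auto
qed

section \<open>Stability of determinants of Hermitian matrices\<close>

definition dminor :: "(nat \<Rightarrow> nat \<Rightarrow> 'a) \<Rightarrow> 'a::comm_ring_1 family" where
  "dminor B W z = pminor W (\<lambda>i j. (if i = j then z i else 0) + B i j)"

lemma affine_family_dminor: "finite U \<Longrightarrow> affine_family U (dminor B)"
  unfolding affine_family_def
proof (intro allI impI)
  fix W x i and t :: 'a assume U: "finite U" and W: "W \<subseteq> U" and i: "i \<in> U"
  have fin: "finite W" using U W finite_subset by blast
  show "dminor B W (x(i := x i + t)) = dminor B W x + (if i \<in> W then t * dminor B (W - {i}) x else 0)"
  proof (cases "i \<in> W")
    case True
    then show ?thesis unfolding dminor_def using fin by (simp, intro pminor_diag_add) auto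
  next
    case False
    then show ?thesis unfolding dminor_def by (simp, intro pminor_cong) auto
  qed
qed

text \<open>Pair a kernel vector \<open>u\<close> with its own equation: the form \<open>T\<close>
  of the Hermitian part is real, so the imaginary part leaves the sum of |u i|^2 Im (z i), which is
  positive.\<close>

lemma dminor_nonzero:
  fixes B :: "nat \<Rightarrow> nat \<Rightarrow> complex"
  assumes fin: "finite W" and sym: "\<And>i j. i \<in> W \<Longrightarrow> j \<in> W \<Longrightarrow> B i j = cnj (B j i)" and z: "\<And>i. i \<in> W \<Longrightarrow> Im (z i) > 0"
  shows "dminor B W z \<noteq> 0"
proof
  assume "dminor B W z = 0"
  then have 0: "pminor W (\<lambda>i j. (if i = j then z i else 0) + B i j) = 0" by (simp add: dminor_def)
  obtain u where u: "\<exists>i\<in>W. u i \<noteq> 0"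
    and eq: "\<And>i. i \<in> W \<Longrightarrow> (\<Sum>j\<in>W. ((if i = j then z i else 0) + B i j) * u j) = 0"
    by (rule pminor_kernel[OF fin 0]) blast
  define T where "T = (\<Sum>i\<in>W. \<Sum>j\<in>W. cnj (u i) * B i j * u j)"
  have "cnj T = (\<Sum>i\<in>W. \<Sum>j\<in>W. cnj (u j) * B j i * u i)"
    unfolding T_def by (simp add: sum_distrib_left mult_ac sym[symmetric] cong: sum.cong)
  also have "\<dots> = T" unfolding T_def by (rule sum.swap)
  finally have T: "Im T = 0" by (metis Reals_cnj_iff complex_is_Real_iff)
  have row: "(\<Sum>j\<in>W. ((if i = j then z i else 0) + B i j) * u j) = z i * u i + (\<Sum>j\<in>W. B i j * u j)"
    if "i \<in> W" for i
    using fin that by (simp add: distrib_right sum.distrib if_distrib[of "\<lambda>x. x * _"] cong: if_cong)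
  have "0 = (\<Sum>i\<in>W. cnj (u i) * (z i * u i + (\<Sum>j\<in>W. B i j * u j)))"
    using eq row by simp
  also have "\<dots> = (\<Sum>i\<in>W. cnj (u i) * z i * u i) + T"
    unfolding T_def by (simp add: distrib_left sum.distrib sum_distrib_left mult.assoc)
  finally have "Im ((\<Sum>i\<in>W. cnj (u i) * z i * u i) + T) = 0" by simp
  then have "Im (\<Sum>i\<in>W. cnj (u i) * z i * u i) = 0" using T by simp
  moreover have "cnj (u i) * z i * u i = of_real ((cmod (u i))\<^sup>2) * z i" for i
    by (simp only: complex_norm_square mult_ac)
  ultimately have "(\<Sum>i\<in>W. (cmod (u i))\<^sup>2 * Im (z i)) = 0" by simp
  moreover obtain k where k: "k \<in> W" "u k \<noteq> 0" using u by blast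
  have "(\<Sum>i\<in>W. (cmod (u i))\<^sup>2 * Im (z i)) > 0"
    by (rule sum_pos2[OF fin k(1)]) (use k z in \<open>simp_all add: less_imp_le\<close>)
  ultimately show False by simp
qed

lemma stable_family_dminor:
  fixes B :: "nat \<Rightarrow> nat \<Rightarrow> complex"
  assumes fin: "finite U" and sym: "\<And>i j. i \<in> U \<Longrightarrow> j \<in> U \<Longrightarrow> B i j = cnj (B j i)"
  shows "stable_family U (dminor B)"
  unfolding stable_family_def
proof (intro conjI allI impI)
  fix W x assume "W \<subseteq> U" "\<forall>i\<in>U. Im (x i) > 0"
  then show "dminor B W x \<noteq> 0"
    by (intro dminor_nonzero) (simp_all add: finite_subset[OF _ fin] subset_iff flip: sym)
qed (rule affine_family_dminor[OF fin])

definition mixed_char :: "(nat \<Rightarrow> nat \<Rightarrow> 'a) \<Rightarrow> 'a::comm_ring_1 family" where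
  "mixed_char A V z = (\<Sum>S\<in>Pow V. dminor (\<lambda>i j. - A i j) S z * pminor (V - S) A)"

lemma mixed_char_conv: "mixed_char A V z = conv (dminor (\<lambda>i j. - A i j)) (dminor A) V z (\<lambda>_. 0)"
  by (simp add: mixed_char_def conv_def dminor_def[of A])

abbreviation cmat :: "(nat \<Rightarrow> nat \<Rightarrow> real) \<Rightarrow> nat \<Rightarrow> nat \<Rightarrow> complex" where
  "cmat A \<equiv> \<lambda>i j. complex_of_real (A i j)"

lemma stable_family_mixed_char:
  fixes A :: "nat \<Rightarrow> nat \<Rightarrow> real"
  assumes fin: "finite U" and sym: "\<And>i j. i \<in> U \<Longrightarrow> j \<in> U \<Longrightarrow> A i j = A j i"
  shows "stable_family U (mixed_char (cmat A))"
  unfolding mixed_char_conv[abs_def]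
  by (rule stable_family_conv[OF stable_family_dminor stable_family_dminor fin]) (use fin sym in auto)

section \<open>The mixed polynomial and averaging over edge signs\<close>

definition edge_mat :: "nat \<Rightarrow> nat \<Rightarrow> 'a \<Rightarrow> nat \<Rightarrow> nat \<Rightarrow> 'a::zero" where
  "edge_mat i j s a b = (if (a = i \<and> b = j) \<or> (a = j \<and> b = i) then s else 0)"

lemma permutes_swapped:
  assumes "i \<in> S" "j \<in> S" "i \<noteq> j"
  shows "{p. p permutes S \<and> p i = j \<and> p j = i} = (\<lambda>q. transpose i j \<circ> q) ` {q. q permutes (S - {i, j})}" (is "?L = _")
proof (rule equalityI; rule subsetI)
  fix p assume "p \<in> ?L"
  then have p: "p permutes S" "p i = j" "p j = i" by auto
  have "(transpose i j \<circ> p) permutes (S - {i, j})"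
    by (rule permutes_superset[OF permutes_compose[OF p(1) permutes_swap_id[OF assms(1,2)]]])
       (use p in auto)
  moreover have "p = transpose i j \<circ> (transpose i j \<circ> p)" by (simp add: fun_eq_iff)
  ultimately show "p \<in> (\<lambda>q. transpose i j \<circ> q) ` {q. q permutes (S - {i, j})}" by blast
next
  fix p assume "p \<in> (\<lambda>q. transpose i j \<circ> q) ` {q. q permutes (S - {i, j})}"
  then obtain q where q: "q permutes (S - {i, j})" "p = transpose i j \<circ> q" by blast
  have "q permutes S" by (rule permutes_subset[OF q(1)]) auto
  then have "p permutes S" unfolding q(2) by (rule permutes_compose[OF _ permutes_swap_id[OF assms(1,2)]])
  moreover have "q i = i" "q j = j" using permutes_not_in[OF q(1)] by auto
  ultimately show "p \<in> ?L" by (simp add: q(2))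
qed

lemma pminor_swapped_sum:
  assumes fin: "finite S" and ij: "i \<in> S" "j \<in> S" "i \<noteq> j"
  shows "(\<Sum>p | p permutes S \<and> p i = j \<and> p j = i. signof p * (\<Prod>k\<in>S - {i, j}. M k (p k)))
    = - pminor (S - {i, j}) M" (is "?L = _")
proof -
  have inj: "inj_on (\<lambda>q. transpose i j \<circ> q) X" for X :: "(nat \<Rightarrow> nat) set"
    by (rule inj_onI) (metis comp_assoc id_comp transpose_comp_involutory)
  have "?L
     = (\<Sum>q | q permutes (S - {i, j}). signof (transpose i j \<circ> q) * (\<Prod>k\<in>S - {i, j}. M k ((transpose i j \<circ> q) k)))"
    unfolding permutes_swapped[OF ij] by (simp add: sum.reindex[OF inj])
  also have "\<dots> = (\<Sum>q | q permutes (S - {i, j}). - (signof q * (\<Prod>k\<in>S - {i, j}. M k (q k))))"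
  proof (rule sum.cong[OF refl])
    fix q assume "q \<in> {q. q permutes (S - {i, j})}"
    then have q: "q permutes (S - {i, j})" by simp
    have "permutation q" using q fin permutation_permutes by blast
    then have "sign (transpose i j \<circ> q) = - sign q"
      using sign_compose[OF permutation_swap_id, of q i j] ij by (simp add: sign_swap_id)
    moreover have "(\<Prod>k\<in>S - {i, j}. M k ((transpose i j \<circ> q) k)) = (\<Prod>k\<in>S - {i, j}. M k (q k))"
    proof (rule prod.cong[OF refl])
      fix k assume "k \<in> S - {i, j}"
      then have "q k \<in> S - {i, j}" using q permutes_in_image by metis
      then show "M k ((transpose i j \<circ> q) k) = M k (q k)" by (auto simp: transpose_def)
    qed
    ultimately show "signof (transpose i j \<circ> q) * (\<Prod>k\<in>S - {i, j}. M k ((transpose i j \<circ> q) k))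
      = - (signof q * (\<Prod>k\<in>S - {i, j}. M k (q k)))" by (simp only: of_int_minus mult_minus_left)
  qed
  finally show ?thesis by (simp add: pminor_def sum_negf)
qed

text \<open>Each permutation contributes at most degree 2 in \<open>s\<close>. The square needs both
  changed entries, hence a permutation exchanging \<open>i\<close> and \<open>j\<close>, and the
  sign of that transposition gives the minus. The linear part \<open>L\<close> can stay anonymous
  because it cancels in the mean over \<open>s = 1\<close> and \<open>s = -1\<close>.\<close>

lemma pminor_edge:
  assumes fin: "finite S" and ne: "i \<noteq> j"
  shows "\<exists>L. \<forall>s. pminor S (\<lambda>a b. M a b + edge_mat i j s a b)
    = pminor S M + s * L - (if i \<in> S \<and> j \<in> S then s\<^sup>2 * pminor (S - {i, j}) M else 0)"
proof (cases "i \<in> S \<and> j \<in> S")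
  case False
  have "pminor S (\<lambda>a b. M a b + edge_mat i j s a b) = pminor S M" for s
    by (rule pminor_cong) (use False in \<open>auto simp: edge_mat_def\<close>)
  then show ?thesis using False by (intro exI[of _ 0]) auto
next
  case True
  then have ij: "i \<in> S" "j \<in> S" by auto
  \<comment> \<open>\<open>R\<close> is the product over the unchanged rows, \<open>X\<close>
    collects the terms that use exactly one of the two changed entries.\<close>
  define R where "R p = (\<Prod>k\<in>S - {i, j}. M k (p k))" for p :: "nat \<Rightarrow> nat"
  define X where "X p = (if p i = j then M j (p j) else 0) + (if p j = i then M i (p i) else 0)" for p
  let ?sw = "\<lambda>p. p i = j \<and> p j = i"
  have prod_split: "(\<Prod>k\<in>S. N k (p k)) = N i (p i) * N j (p j) * (\<Prod>k\<in>S - {i, j}. N k (p k))"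
    for N :: "nat \<Rightarrow> nat \<Rightarrow> 'a" and p
  proof -
    have "S - {i} - {j} = S - {i, j}" by auto
    then show ?thesis
      using fin ij ne prod.remove[OF fin ij(1), of "\<lambda>k. N k (p k)"]
        prod.remove[of "S - {i}" j "\<lambda>k. N k (p k)"] by (simp add: mult_ac)
  qed
  have expand: "signof p * (\<Prod>k\<in>S. M k (p k) + edge_mat i j s k (p k))
     = signof p * (\<Prod>k\<in>S. M k (p k)) + s * (signof p * (X p * R p))
       + s\<^sup>2 * (if ?sw p then signof p * R p else 0)" for p s
  proof -
    have "(\<Prod>k\<in>S - {i, j}. M k (p k) + edge_mat i j s k (p k)) = R p"
      unfolding R_def by (rule prod.cong) (auto simp: edge_mat_def)
    then show ?thesis
      using prod_split[of "\<lambda>k l. M k l + edge_mat i j s k l" p] prod_split[of M p] ne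
      by (auto simp: R_def[symmetric] X_def edge_mat_def algebra_simps power2_eq_square)
  qed
  have finp: "finite {p. p permutes S}" using finite_permutations[OF fin] .
  have "(\<Sum>p | p permutes S. if ?sw p then signof p * R p else 0)
      = (\<Sum>p | p permutes S \<and> ?sw p. signof p * R p)"
    using sum.inter_filter[OF finp, of "\<lambda>p. signof p * R p" ?sw] by simp
  also have "\<dots> = - pminor (S - {i, j}) M"
    unfolding R_def by (rule pminor_swapped_sum[OF fin ij ne])
  finally have sw: "(\<Sum>p | p permutes S. if ?sw p then signof p * R p else 0) = - pminor (S - {i, j}) M" .
  have "pminor S (\<lambda>a b. M a b + edge_mat i j s a b)
    = pminor S M + s * (\<Sum>p | p permutes S. signof p * (X p * R p)) - s\<^sup>2 * pminor (S - {i, j}) M" for s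
    unfolding pminor_def[of S] expand sum.distrib sum_distrib_left[symmetric] sw by simp
  then show ?thesis using ij by auto
qed

lemma dminor_edge:
  assumes fin: "finite S" and ne: "i \<noteq> j"
  shows "\<exists>L. \<forall>s. dminor (\<lambda>a b. B a b + edge_mat i j s a b) S z
    = dminor B S z + s * L - (if i \<in> S \<and> j \<in> S then s\<^sup>2 * dminor B (S - {i, j}) z else 0)"
  using pminor_edge[OF assms, of "\<lambda>a b. (if a = b then z a else 0) + B a b"]
  unfolding dminor_def add.assoc by assumption

text \<open>The factor 2 arises because the edge can lie inside \<open>S\<close> or inside
  \<open>V - S\<close>; a set \<open>S\<close> separating \<open>i\<close> from \<open>j\<close>
  does not see it. The opposite signs of \<open>A\<close> in the two minors affect only the linear
  part.\<close>

lemma mixed_char_edge: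
  assumes fin: "finite V" and ne: "i \<noteq> j"
  shows "\<exists>L. \<forall>s. mixed_char (\<lambda>a b. A a b + edge_mat i j s a b) V z
    = mixed_char A V z + s * L - (if i \<in> V \<and> j \<in> V then 2 * s\<^sup>2 * mixed_char A (V - {i, j}) z else 0)"
proof -
  let ?A = "\<lambda>s a b. A a b + edge_mat i j s a b" and ?m = "dminor (\<lambda>a b. - A a b)"
  have neg: "(\<lambda>a b. - ?A s a b) = (\<lambda>a b. - A a b + edge_mat i j (- s) a b)" for s
    by (auto simp: edge_mat_def fun_eq_iff)
  define c where "c S = (if i \<in> S \<and> j \<in> S then ?m (S - {i, j}) z * pminor (V - S) A else 0)
    + (if i \<in> V - S \<and> j \<in> V - S then ?m S z * pminor (V - S - {i, j}) A else 0)" for S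
  have "\<exists>L. \<forall>s. dminor (\<lambda>a b. - ?A s a b) S z * pminor (V - S) (?A s)
      = ?m S z * pminor (V - S) A + s * L - s\<^sup>2 * c S" if S: "S \<in> Pow V" for S
  proof -
    have finS: "finite S" "finite (V - S)" using S fin finite_subset by auto
    obtain L1 where L1': "\<And>s. dminor (\<lambda>a b. - A a b + edge_mat i j s a b) S z
        = ?m S z + s * L1 - (if i \<in> S \<and> j \<in> S then s\<^sup>2 * ?m (S - {i, j}) z else 0)"
      using dminor_edge[OF finS(1) ne, of "\<lambda>a b. - A a b" z] by blast
    have L1: "dminor (\<lambda>a b. - ?A s a b) S z
        = ?m S z + (- s) * L1 - (if i \<in> S \<and> j \<in> S then s\<^sup>2 * ?m (S - {i, j}) z else 0)" for s
      unfolding neg L1' by simp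
    obtain L2 where L2: "pminor (V - S) (?A s)
        = pminor (V - S) A + s * L2 - (if i \<in> V - S \<and> j \<in> V - S then s\<^sup>2 * pminor (V - S - {i, j}) A else 0)" for s
      using pminor_edge[OF finS(2) ne, of A] by blast
    show ?thesis
    proof (cases "i \<in> S \<and> j \<in> S")
      case True
      then have "pminor (V - S) (?A s) = pminor (V - S) A" for s
        by (intro pminor_cong) (auto simp: edge_mat_def)
      note d = this
      show ?thesis
        by (rule exI[of _ "- L1 * pminor (V - S) A"], rule allI, unfold L1 d)
           (use True in \<open>simp add: c_def algebra_simps\<close>)
    next
      case False
      then have "dminor (\<lambda>a b. - ?A s a b) S z = ?m S z" for s
        unfolding dminor_def by (intro pminor_cong) (auto simp: edge_mat_def)
      note m = this
      show ?thesis
        by (rule exI[of _ "?m S z * L2"], rule allI, unfold L2 m)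
           (use False in \<open>auto simp: c_def algebra_simps\<close>)
    qed
  qed
  then have "\<forall>S\<in>Pow V. \<exists>L. \<forall>s. dminor (\<lambda>a b. - ?A s a b) S z * pminor (V - S) (?A s)
      = ?m S z * pminor (V - S) A + s * L - s\<^sup>2 * c S" by blast
  from bchoice[OF this] obtain L where L: "\<And>S s. S \<in> Pow V \<Longrightarrow>
      dminor (\<lambda>a b. - ?A s a b) S z * pminor (V - S) (?A s) = ?m S z * pminor (V - S) A + s * L S - s\<^sup>2 * c S"
    by blast
  have c: "(\<Sum>S\<in>Pow V. c S) = (if i \<in> V \<and> j \<in> V then 2 * mixed_char A (V - {i, j}) z else 0)"
  proof (cases "i \<in> V \<and> j \<in> V")
    case True
    let ?W = "V - {i, j}"
    have fW: "finite ?W" using fin by simp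
    have V: "V = insert i (insert j ?W)" using True by auto
    have "(\<Sum>S\<in>Pow V. c S) = (\<Sum>S\<in>Pow (insert i (insert j ?W)). c S)" using V by simp
    also have "\<dots> = (\<Sum>S\<in>Pow ?W. c S + c (insert j S) + (c (insert i S) + c (insert i (insert j S))))"
      using ne fW by (simp add: sum_Pow_insert sum.distrib)
    also have "\<dots> = (\<Sum>S\<in>Pow ?W. 2 * (?m S z * pminor (?W - S) A))"
    proof (rule sum.cong[OF refl])
      fix S assume S: "S \<in> Pow ?W"
      then have 1: "insert i (insert j S) - {i, j} = S" "V - insert i (insert j S) = ?W - S"
        "V - S - {i, j} = ?W - S" by auto
      have 2: "i \<notin> S" "j \<notin> S" using S by auto
      show "c S + c (insert j S) + (c (insert i S) + c (insert i (insert j S))) = 2 * (?m S z * pminor (?W - S) A)"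
        unfolding c_def 1 using 2 ne True by simp
    qed
    also have "\<dots> = 2 * mixed_char A ?W z" by (simp add: mixed_char_def sum_distrib_left)
    finally show ?thesis using True by simp
  next
    case False
    then have "c S = 0" if "S \<in> Pow V" for S using that by (auto simp: c_def)
    then show ?thesis unfolding if_not_P[OF False] by simp
  qed
  have "mixed_char (?A s) V z = mixed_char A V z + s * (\<Sum>S\<in>Pow V. L S)
    - (if i \<in> V \<and> j \<in> V then 2 * s\<^sup>2 * mixed_char A (V - {i, j}) z else 0)" for s
  proof -
    have "mixed_char (?A s) V z = (\<Sum>S\<in>Pow V. ?m S z * pminor (V - S) A + s * L S - s\<^sup>2 * c S)"
      unfolding mixed_char_def by (rule sum.cong[OF refl L])
    also have "\<dots> = mixed_char A V z + s * (\<Sum>S\<in>Pow V. L S) - s\<^sup>2 * (\<Sum>S\<in>Pow V. c S)"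
      by (simp add: mixed_char_def sum.distrib sum_subtractf sum_distrib_left)
    finally show ?thesis unfolding c by simp
  qed
  then show ?thesis by blast
qed

text \<open>The average of \<open>mixed_char\<close> over independent signs on the edges in the list, added to \<open>A\<close>:
  by \<open>avg_char_edge\<close>, the mean over \<open>s = 1\<close> and \<open>s = -1\<close> is the recursion step below.\<close>

fun avg_char :: "(nat \<Rightarrow> nat \<Rightarrow> 'a) \<Rightarrow> (nat \<times> nat) list \<Rightarrow> 'a::comm_ring_1 family" where
  "avg_char A [] V z = mixed_char A V z"
| "avg_char A ((i, j) # es) V z = avg_char A es V z - (if i \<in> V \<and> j \<in> V then 2 * avg_char A es (V - {i, j}) z else 0)"

lemma avg_char_edge:
  assumes fin: "finite V" and ne: "i \<noteq> j"
  shows "\<exists>L. \<forall>s. avg_char (\<lambda>a b. A a b + edge_mat i j s a b) es V z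
    = avg_char A es V z + s * L - (if i \<in> V \<and> j \<in> V then 2 * s\<^sup>2 * avg_char A es (V - {i, j}) z else 0)"
  using fin
proof (induct es arbitrary: V)
  case Nil
  then show ?case unfolding avg_char.simps by (rule mixed_char_edge[OF _ ne])
next
  case (Cons e es)
  obtain k l where e: "e = (k, l)" by force
  obtain L1 where L1: "avg_char (\<lambda>a b. A a b + edge_mat i j s a b) es V z
    = avg_char A es V z + s * L1 - (if i \<in> V \<and> j \<in> V then 2 * s\<^sup>2 * avg_char A es (V - {i, j}) z else 0)" for s
    using Cons(1)[OF Cons(2)] by blast
  obtain L2 where L2: "avg_char (\<lambda>a b. A a b + edge_mat i j s a b) es (V - {k, l}) z
    = avg_char A es (V - {k, l}) z + s * L2
      - (if i \<in> V - {k, l} \<and> j \<in> V - {k, l} then 2 * s\<^sup>2 * avg_char A es (V - {k, l} - {i, j}) z else 0)" for s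
    using Cons(1)[OF finite_Diff[OF Cons(2)]] by blast
  have D: "V - {k, l} - {i, j} = V - {i, j} - {k, l}" by auto
  show ?case
    unfolding e avg_char.simps L1 L2 D
    by (rule exI[of _ "L1 - (if k \<in> V \<and> l \<in> V then 2 * L2 else 0)"])
       (auto simp: algebra_simps)
qed

lemma stable_family_avg_char:
  fixes A :: "nat \<Rightarrow> nat \<Rightarrow> real"
  assumes fin: "finite U" and sym: "\<And>i j. i \<in> U \<Longrightarrow> j \<in> U \<Longrightarrow> A i j = A j i"
    and es: "\<forall>(i, j)\<in>set es. i \<noteq> j"
  shows "stable_family U (avg_char (cmat A) es)"
  using es
proof (induct es)
  case Nil
  have "avg_char (cmat A) [] = mixed_char (cmat A)" by (intro ext) simp
  then show ?case using stable_family_mixed_char[OF fin sym] by simp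
next
  case (Cons e es)
  obtain i j where e: "e = (i, j)" by force
  let ?A = "cmat A"
  let ?P = "\<lambda>W x. avg_char ?A es W x - (if i \<in> W \<and> j \<in> W then of_real 2 * avg_char ?A es (W - {i, j}) x else 0)"
  have "stable_family U ?P"
    using Cons e by (intro stable_family_edge) auto
  moreover have "avg_char ?A (e # es) = ?P"
    by (intro ext) (simp add: e)
  ultimately show ?case by simp
qed

context comm_ring_hom
begin

lemma hom_dminor: "hom (dminor B S z) = dminor (\<lambda>i j. hom (B i j)) S (\<lambda>i. hom (z i))"
  unfolding dminor_def hom_pminor
  by (intro arg_cong[of _ _ "pminor S"] ext) (simp add: hom_distribs)

lemma hom_mixed_char: "hom (mixed_char A V z) = mixed_char (\<lambda>i j. hom (A i j)) V (\<lambda>i. hom (z i))"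
  unfolding mixed_char_def by (simp add: hom_distribs hom_dminor hom_pminor)

lemma hom_avg_char: "hom (avg_char A es V z) = avg_char (\<lambda>i j. hom (A i j)) es V (\<lambda>i. hom (z i))"
proof (induct es arbitrary: V)
  case (Cons e es)
  obtain i j where e: "e = (i, j)" by force
  have "hom 2 = 2" by (metis hom_add hom_one one_add_one)
  then show ?case using Cons by (simp add: e hom_distribs)
qed (simp add: hom_mixed_char)

end

section \<open>One-variable specializations as monic real polynomials\<close>

lemma dminor_char_poly:
  fixes A :: "nat \<Rightarrow> nat \<Rightarrow> 'a::field"
  assumes f: "bij_betw f {0..<m} S"
  shows "dminor (\<lambda>i j. - [:A i j:]) S (\<lambda>_. [:0, 1:]) = char_poly (mat m m (\<lambda>(a, b). A (f a) (f b)))"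
proof -
  have inj: "f a = f b \<longleftrightarrow> a = b" if "a < m" "b < m" for a b
    using f that by (auto simp: bij_betw_def inj_on_def)
  show ?thesis
    unfolding dminor_def pminor_eq_det[OF f] char_poly_def char_poly_matrix_def
    by (rule arg_cong[of _ _ det], rule eq_matI) (auto simp: inj)
qed

text \<open>Stated through coefficients so that sums with terms of lower degree can be handled
  coefficient by coefficient.\<close>

definition monic_deg :: "'a::field poly \<Rightarrow> nat \<Rightarrow> bool" where
  "monic_deg p n \<longleftrightarrow> coeff p n = 1 \<and> (\<forall>k>n. coeff p k = 0)"

lemma monic_degD: "monic_deg p n \<Longrightarrow> degree p = n \<and> lead_coeff p = 1 \<and> p \<noteq> 0"
proof -
  assume p: "monic_deg p n"
  have "degree p = n"
    by (rule antisym[OF degree_le le_degree]) (use p in \<open>auto simp: monic_deg_def\<close>)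
  then show ?thesis using p by (auto simp: monic_deg_def)
qed

lemma monic_deg_dminor:
  fixes A :: "nat \<Rightarrow> nat \<Rightarrow> 'a::field"
  assumes "finite S"
  shows "monic_deg (dminor (\<lambda>i j. - [:A i j:]) S (\<lambda>_. [:0, 1:])) (card S)"
proof -
  obtain f where f: "bij_betw f {0..<card S} S" using ex_bij_betw_nat_finite[OF assms] by blast
  have "mat (card S) (card S) (\<lambda>(a, b). A (f a) (f b)) \<in> carrier_mat (card S) (card S)" by simp
  from degree_monic_char_poly[OF this] show ?thesis
    unfolding dminor_char_poly[OF f] monic_deg_def by (auto simp: coeff_eq_0)
qed

lemma pminor_const: "pminor S (\<lambda>i j. [:A i j:]) = [:pminor S A:]"
proof -
  interpret comm_ring_hom "\<lambda>a. [:a:]" by unfold_locales (auto simp: one_pCons)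
  show ?thesis by (rule hom_pminor[symmetric])
qed

definition avg_poly :: "(nat \<Rightarrow> nat \<Rightarrow> real) \<Rightarrow> (nat \<times> nat) list \<Rightarrow> nat set \<Rightarrow> real poly" where
  "avg_poly A es V = avg_char (\<lambda>i j. [:A i j:]) es V (\<lambda>_. [:0, 1:])"

lemma poly_avg_poly: "poly (avg_poly A es V) x = avg_char A es V (\<lambda>_. x)"
proof -
  have "comm_ring_hom (\<lambda>p. poly p x)" by unfold_locales auto
  then show ?thesis unfolding avg_poly_def by (subst comm_ring_hom.hom_avg_char) simp_all
qed

abbreviation cpoly :: "real poly \<Rightarrow> complex poly" where
  "cpoly \<equiv> map_poly complex_of_real"

lemma comm_ring_hom_cpoly: "comm_ring_hom (\<lambda>p. poly (cpoly p) x)"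
proof -
  interpret cp: map_poly_comm_ring_hom complex_of_real ..
  show ?thesis by unfold_locales (auto simp: cp.hom_add cp.hom_mult)
qed

lemma poly_cpoly_avg_poly:
  "poly (cpoly (avg_poly A es V)) x = avg_char (cmat A) es V (\<lambda>_. x)"
proof -
  show ?thesis
    unfolding avg_poly_def
    by (subst comm_ring_hom.hom_avg_char[OF comm_ring_hom_cpoly]) (simp add: of_real_hom.map_poly_pCons_hom)
qed

lemma monic_deg_avg_poly:
  assumes "finite V"
  shows "monic_deg (avg_poly A es V) (card V)"
  using assms
proof (induct es arbitrary: V)
  case Nil
  let ?m = "\<lambda>S. dminor (\<lambda>i j. - [:A i j:]) S (\<lambda>_. [:0, 1:])"
  have q: "avg_poly A [] V = (\<Sum>S\<in>Pow V. smult (pminor (V - S) A) (?m S))"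
    by (simp add: avg_poly_def mixed_char_def pminor_const)
  \<comment> \<open>Of all sets \<open>S\<close>, only \<open>V\<close> itself reaches the degree
    \<open>card V\<close>, and there with coefficient 1.\<close>
  have lo: "coeff (?m S) k = (if k = card V \<and> S = V then 1 else 0)" if "S \<in> Pow V" "k \<ge> card V" for S k
  proof (cases "S = V")
    case True
    then show ?thesis using monic_deg_dminor[OF Nil, of A] that by (auto simp: monic_deg_def)
  next
    case False
    then have "S \<subset> V" using that by auto
    then have "card S < k" using that Nil psubset_card_mono[of V S] by auto
    then show ?thesis using monic_deg_dminor[OF finite_subset[of S V], of A] that Nil False by (auto simp: monic_deg_def)
  qed
  have "coeff (avg_poly A [] V) k = (\<Sum>S\<in>Pow V. if S = V then (if k = card V then 1 else 0) else 0)" if "k \<ge> card V" for k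
    unfolding q coeff_sum by (rule sum.cong[OF refl]) (use that lo in auto)
  then show ?case using Nil by (simp add: monic_deg_def sum.delta)
next
  case (Cons e es)
  obtain i j where e: "e = (i, j)" by force
  have q: "avg_poly A (e # es) V = avg_poly A es V - (if i \<in> V \<and> j \<in> V then 2 * avg_poly A es (V - {i, j}) else 0)"
    by (simp add: avg_poly_def e)
  have "coeff (2 * avg_poly A es (V - {i, j})) k = 0" if "i \<in> V" "k \<ge> card V" for k
  proof -
    have "card (V - {i, j}) < card V" using that Cons(2) by (intro psubset_card_mono) auto
    then have "coeff (avg_poly A es (V - {i, j})) k = 0"
      using Cons(1)[of "V - {i, j}"] Cons(2) that by (simp add: monic_deg_def)
    then show ?thesis unfolding mult_2 coeff_add by simp
  qed
  then show ?case using Cons(1)[OF Cons(2)] unfolding q by (auto simp: monic_deg_def)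
qed

section \<open>Partial fractions and a homotopy argument\<close>

text \<open>For a real polynomial, conjugation extends this to the lower half-plane, so it says that
  all complex roots are real.\<close>

definition upper_stable :: "real poly \<Rightarrow> bool" where
  "upper_stable h \<longleftrightarrow> (\<forall>x. Im x > 0 \<longrightarrow> poly (cpoly h) x \<noteq> 0)"

lemma poly_cpoly_of_real [simp]: "poly (cpoly p) (complex_of_real x) = complex_of_real (poly p x)"
  by (rule of_real_hom.poly_map_poly)

lemma poly_cpoly_cnj: "poly (cpoly p) (cnj x) = cnj (poly (cpoly p) x)"
  by (induct p) (simp_all add: of_real_hom.map_poly_pCons_hom)

lemma upper_stable_real:
  assumes "upper_stable h" "poly (cpoly h) x = 0"
  shows "x = complex_of_real (Re x)" "poly h (Re x) = 0"
proof -
  have "\<not> Im x > 0" "\<not> Im (cnj x) > 0"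
    using assms poly_cpoly_cnj[of h x] unfolding upper_stable_def by auto
  then show x: "x = complex_of_real (Re x)" by (simp add: complex_eq_iff)
  have "poly (cpoly h) (complex_of_real (Re x)) = 0" using assms(2) x by simp
  then show "poly h (Re x) = 0" by (simp del: of_real_hom.poly_map_poly)
qed

text \<open>All roots are real and at most \<open>y\<close>, so each linear factor is at least
  \<open>x - y\<close>. Unlike strict positivity, the resulting bound is a closed condition, which
  \<open>homotopy_positive\<close> exploits.\<close>

lemma monic_lower_bound:
  assumes h: "upper_stable h" "monic_deg h n" and roots: "\<And>x. poly h x = 0 \<Longrightarrow> x \<le> y" and x: "x \<ge> y"
  shows "poly h x \<ge> (x - y) ^ n"
proof -
  obtain as where as: "smult (coeff (cpoly h) (degree (cpoly h))) (\<Prod>a\<leftarrow>as. [:- a, 1:]) = cpoly h"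
    "length as = degree (cpoly h)" using fundamental_theorem_algebra_factorized by blast
  have deg: "degree (cpoly h) = n" "coeff (cpoly h) (degree (cpoly h)) = 1"
    using monic_degD[OF h(2)] by auto
  have eq: "(\<Prod>a\<leftarrow>as. [:- a, 1:]) = cpoly h" using as(1) deg by simp
  have a: "a = complex_of_real (Re a) \<and> Re a \<le> y" if "a \<in> set as" for a
  proof -
    have "poly (cpoly h) a = 0" unfolding eq[symmetric] poly_prod_list using that
      by (auto simp: prod_list_zero_iff image_iff)
    then show ?thesis using upper_stable_real[OF h(1)] roots by auto
  qed
  have "complex_of_real (poly h x) = (\<Prod>a\<leftarrow>as. complex_of_real x - a)"
    unfolding poly_cpoly_of_real[symmetric] eq[symmetric] poly_prod_list by (simp add: o_def)
  also have "\<dots> = complex_of_real (\<Prod>a\<leftarrow>as. x - Re a)"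
    using a by (induct as) auto
  finally have "poly h x = (\<Prod>a\<leftarrow>as. x - Re a)" using of_real_eq_iff by blast
  moreover have "(\<Prod>a\<leftarrow>as. x - Re a) \<ge> (x - y) ^ length as"
  proof -
    have "\<forall>a\<in>set as. Re a \<le> y" using a by blast
    then show ?thesis using x by (induct as) (auto intro!: mult_mono)
  qed
  ultimately show ?thesis using as(2) deg(1) by simp
qed

text \<open>A continuity argument that tracks no roots. The parameters in \<open>G\<close>, where
  \<open>P s\<close> dominates \<open>(x - y) ^ n\<close> for all \<open>x \<ge> y\<close>, and
  those in \<open>B\<close>, where \<open>P s\<close> has a root beyond \<open>y\<close>, form
  closed disjoint sets covering [0, 1]. As 0 is in \<open>G\<close>, connectedness leaves no room
  for \<open>B\<close>. The term with \<open>D\<close> admits paths that are quadratic in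
  \<open>s\<close>.\<close>

lemma homotopy_positive:
  fixes p q D :: "real poly"
  defines "P \<equiv> \<lambda>s. smult (1 - s) p + smult s q + smult (s * (1 - s)) D"
  assumes st: "\<And>s. 0 \<le> s \<Longrightarrow> s \<le> 1 \<Longrightarrow> upper_stable (P s) \<and> monic_deg (P s) n"
    and D: "\<And>x. x \<ge> y \<Longrightarrow> poly D x \<ge> 0"
    and p: "\<And>x. x \<ge> y \<Longrightarrow> poly p x > 0"
    and q: "poly q y > 0"
    and x: "x \<ge> y"
  shows "poly q x > 0"
proof -
  define f where "f s x = (1 - s) * poly p x + s * poly q x + s * (1 - s) * poly D x" for s x
  have f: "poly (P s) x = f s x" for s x by (simp add: P_def f_def)
  have q1: "monic_deg q n" using st[of 1] by (simp add: P_def)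
  have "\<exists>N. \<forall>x\<ge>N. poly q x \<ge> lead_coeff q"
    using monic_degD[OF q1] by (intro poly_pinfty_gt_lc) auto
  then obtain N where N: "\<And>x. x \<ge> N \<Longrightarrow> poly q x \<ge> lead_coeff q" by blast
  \<comment> \<open>Beyond \<open>Y\<close> both ends of the path are positive, and so is every
    \<open>P s\<close>. The roots to be excluded thus lie in a compact interval, and
    \<open>B\<close> is a projection of a compact set.\<close>
  define Y where "Y = max y N"
  have pos: "f s x > 0" if "0 \<le> s" "s \<le> 1" "x \<ge> y" "poly q x > 0" for s x
  proof -
    have "(1 - s) * poly p x + s * poly q x > 0"
      using that p[of x] by (cases "s = 0") (auto intro: add_nonneg_pos)
    moreover have "s * (1 - s) * poly D x \<ge> 0" using that D[of x] by simp
    ultimately show ?thesis unfolding f_def by linarith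
  qed
  have big: "f s x > 0" if "0 \<le> s" "s \<le> 1" "x \<ge> Y" for s x
    using pos[of s x] N[of x] that monic_degD[OF q1] by (auto simp: Y_def)
  have at_y: "f s y > 0" if "0 \<le> s" "s \<le> 1" for s using pos[of s y] q that by simp
  define Z where "Z = ({0..1} \<times> {y..Y}) \<inter> {z. f (fst z) (snd z) = 0}"
  define B where "B = fst ` Z"
  define G where "G = {0..1} \<inter> (\<Inter>x\<in>{y..}. {s. (x - y) ^ n \<le> f s x})"
  have cont: "continuous_on UNIV (\<lambda>z. f (fst z) (snd z))"
    unfolding f_def by (intro continuous_intros)
  have "closed {z. f (fst z) (snd z) = 0}"
    by (rule closed_Collect_eq[OF cont continuous_on_const])
  then have "compact Z" unfolding Z_def by (intro compact_Int_closed compact_Times) auto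
  then have "compact B" unfolding B_def by (intro compact_continuous_image continuous_on_fst continuous_on_id)
  then have cB: "closed B" by (rule compact_imp_closed)
  have cG: "closed G" unfolding G_def f_def
    by (intro closed_Int closed_INT ballI closed_Collect_le continuous_intros)
  have cover: "{0..1} \<subseteq> G \<union> B"
  proof
    fix s :: real assume s: "s \<in> {0..1}"
    show "s \<in> G \<union> B"
    proof (cases "s \<in> B")
      case False
      have nz: "f s x \<noteq> 0" if "x \<in> {y..Y}" for x
        using False s that unfolding B_def Z_def by force
      have "x \<le> y" if "poly (P s) x = 0" for x
        using that nz[of x] big[of s x] s unfolding f by force
      then have "\<And>x. x \<ge> y \<Longrightarrow> poly (P s) x \<ge> (x - y) ^ n"
        using st[of s] s by (intro monic_lower_bound) auto
      then show ?thesis using s by (auto simp: G_def f)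
    qed simp
  qed
  \<comment> \<open>Domination leaves only \<open>x = y\<close> as a possible root, and there
    positivity of both ends and of \<open>D\<close> excludes it.\<close>
  have disj: "G \<inter> B \<inter> {0..1} = {}"
  proof (rule ccontr)
    assume "G \<inter> B \<inter> {0..1} \<noteq> {}"
    then obtain s x where s: "s \<in> G" "0 \<le> s" "s \<le> 1" and x: "y \<le> x" "x \<le> Y" "f s x = 0"
      unfolding B_def Z_def by auto
    have "(x - y) ^ n \<le> f s x" using s(1) x(1) by (auto simp: G_def)
    then have "(x - y) ^ n \<le> 0" using x(3) by simp
    then have "x = y" using x(1) zero_less_power[of "x - y" n] by linarith
    then show False using at_y[of s] s x by simp
  qed
  have "B \<inter> {0..1} = {} \<or> G \<inter> {0..1} = {}"
  proof (rule ccontr)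
    assume "\<not> ?thesis"
    then show False using connected_closedD[OF connected_Icc[of 0 1] _ _ cG cB] disj cover
      by (metis inf_commute)
  qed
  moreover have "0 \<in> G"
  proof -
    have "0 \<notin> B"
    proof
      assume "0 \<in> B"
      then obtain x where "y \<le> x" "poly p x = 0" unfolding B_def Z_def by (auto simp: f_def)
      then show False using p[of x] by simp
    qed
    then show ?thesis using subsetD[OF cover, of 0] by simp
  qed
  ultimately have "B \<inter> {0..1} = {}" by auto
  then have "1 \<in> G" "1 \<notin> B" using subsetD[OF cover, of 1] by auto
  then have G1: "(x - y) ^ n \<le> poly q x" using x by (auto simp: G_def f_def)
  show ?thesis
  proof (cases "x = y")
    case False
    then have "(x - y) ^ n > 0" using x by simp
    then show ?thesis using G1 by linarith
  qed (use q in simp)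
qed

lemma Im_complex_of_real_mult: "Im (complex_of_real a * z) = a * Im z"
  by simp

text \<open>Along the ray from \<open>l\<close> at angle \<theta>, the quotient \<open>k / h\<close>
  behaves like c e^(-p) times \<open>cis (- (p * \<theta>))\<close> with c =
  \<open>poly k l / poly g l\<close>. Multiplying by the positive number e^p keeps the sign of the
  imaginary part, and the limit e \<rightarrow> 0 gives the claim.\<close>

lemma residue_sign:
  fixes k g :: "real poly"
  assumes h: "h = [:- l, 1:] ^ p * g" and gl: "poly g l \<noteq> 0"
    and im: "\<And>x. Im x > 0 \<Longrightarrow> Im (poly (cpoly k) x / poly (cpoly h) x) \<le> 0"
    and th: "0 < \<theta>" "\<theta> < pi"
  shows "poly k l / poly g l * sin (p * \<theta>) \<ge> 0"
proof -
  define x where "x e = complex_of_real l + complex_of_real e * cis \<theta>" for e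
  define F where "F e = poly (cpoly k) (x e) / (cis (p * \<theta>) * poly (cpoly g) (x e))" for e
  interpret cp: map_poly_comm_ring_hom complex_of_real ..
  have hx: "poly (cpoly h) (x e) = of_real (e ^ p) * (cis (p * \<theta>) * poly (cpoly g) (x e))" for e
  proof -
    have "poly (cpoly h) (x e) = (x e - of_real l) ^ p * poly (cpoly g) (x e)"
      unfolding h by (simp add: cp.hom_mult cp.hom_power of_real_hom.map_poly_pCons_hom poly_power)
    also have "x e - of_real l = of_real e * cis \<theta>" by (simp add: x_def)
    finally show ?thesis by (simp add: power_mult_distrib DeMoivre)
  qed
  have le: "Im (F e) \<le> 0" if "e > 0" for e
  proof -
    have "Im (x e) > 0" using that th by (simp add: x_def sin_gt_zero)
    then have "Im (poly (cpoly k) (x e) / poly (cpoly h) (x e)) \<le> 0" by (rule im)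
    moreover have "F e = of_real (e ^ p) * (poly (cpoly k) (x e) / poly (cpoly h) (x e))"
      unfolding hx F_def using that by simp
    ultimately show ?thesis using that
      by (simp only: Im_complex_of_real_mult mult_nonneg_nonpos zero_le_power less_imp_le)
  qed
  have x0: "(x \<longlongrightarrow> of_real l) (at_right 0)"
    unfolding x_def by (auto intro!: tendsto_eq_intros)
  have "(F \<longlongrightarrow> poly (cpoly k) (of_real l) / (cis (p * \<theta>) * poly (cpoly g) (of_real l))) (at_right 0)"
    unfolding F_def using gl by (intro tendsto_intros tendsto_poly x0) auto
  then have "((\<lambda>e. Im (F e)) \<longlongrightarrow> Im (poly (cpoly k) (of_real l) / (cis (p * \<theta>) * poly (cpoly g) (of_real l)))) (at_right 0)"
    by (rule tendsto_Im)
  then have "Im (poly (cpoly k) (of_real l) / (cis (p * \<theta>) * poly (cpoly g) (of_real l))) \<le> 0"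
    by (rule tendsto_upperbound) (auto simp: le eventually_at_right_less intro: eventually_at_rightI[of 0 1])
  moreover have "poly (cpoly k) (of_real l) / (cis (p * \<theta>) * poly (cpoly g) (of_real l))
      = of_real (poly k l / poly g l) * cis (- (p * \<theta>))"
    using gl by (simp add: field_simps cis_mult flip: cis_inverse)
  ultimately show ?thesis by simp
qed

text \<open>At a pole of order \<open>p\<close> the argument of \<open>k / h\<close> turns
  \<open>p\<close> half circles while that of the variable turns one; for \<open>p \<ge> 2\<close>
  both signs of the imaginary part would occur.\<close>

lemma residue_simple:
  fixes k g :: "real poly"
  assumes h: "h = [:- l, 1:] ^ p * g" and gl: "poly g l \<noteq> 0" and kl: "poly k l \<noteq> 0" and p: "p \<ge> 1"
    and im: "\<And>x. Im x > 0 \<Longrightarrow> Im (poly (cpoly k) x / poly (cpoly h) x) \<le> 0"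
  shows "p = 1 \<and> poly k l / poly g l > 0"
proof -
  let ?c = "poly k l / poly g l"
  have c0: "?c \<noteq> 0" using gl kl by simp
  have "?c * sin (p * (pi / (2 * p))) \<ge> 0"
    by (rule residue_sign[OF h gl im]) (use p in \<open>auto simp: field_simps\<close>)
  moreover have "p * (pi / (2 * p)) = pi / 2" using p by simp
  ultimately have "?c * sin (pi / 2) \<ge> 0" by metis
  then have c: "?c > 0" using c0 by (simp add: less_le)
  have "\<not> p \<ge> 2"
  proof
    assume p2: "p \<ge> 2"
    \<comment> \<open>The angle 3 pi / (2 p) is below pi exactly when \<open>p \<ge> 2\<close>, and
      there the sine is -1, against \<open>?c > 0\<close>.\<close>
    have "?c * sin (p * (3 * pi / (2 * p))) \<ge> 0"
      by (rule residue_sign[OF h gl im]) (use p2 in \<open>auto simp: field_simps\<close>)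
    moreover have "p * (3 * pi / (2 * p)) = pi / 2 + pi" using p by (simp add: field_simps)
    ultimately have "?c * sin (pi / 2 + pi) \<ge> 0" by metis
    then show False using c by (simp only: sin_periodic_pi) simp
  qed
  then show ?thesis using c p by simp
qed

text \<open>A quotient with nonpositive imaginary part in the upper half-plane has only simple poles
  with positive residues. Common roots of \<open>h\<close> and \<open>k\<close> hide the order of
  the pole, so they are cancelled first by induction on the degree; once none is left,
  \<open>residue_simple\<close> applies at every root of \<open>h\<close>.\<close>

lemma partial_fractions:
  fixes h k :: "real poly"
  assumes "upper_stable h" "h \<noteq> 0" "k = 0 \<or> degree k < degree h"
    and "\<And>x. Im x > 0 \<Longrightarrow> Im (poly (cpoly k) x / poly (cpoly h) x) \<le> 0"
  shows "\<exists>w. (\<forall>l. w l \<ge> 0) \<and> (\<forall>x. poly h x \<noteq> 0 \<longrightarrow>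
     poly k x = poly h x * (\<Sum>l | poly h l = 0. w l / (x - l)))"
  using assms
proof (induct "degree h" arbitrary: h k rule: less_induct)
  case less
  interpret cp: map_poly_comm_ring_hom complex_of_real ..
  note st = less.prems(1) and h0 = less.prems(2) and im = less.prems(4)
  have finL: "finite {l. poly h l = 0}" using poly_roots_finite[OF h0] .
  show ?case
  proof (cases "k = 0")
    case True
    then show ?thesis by (intro exI[of _ "\<lambda>_. 0"]) auto
  next
    case k0: False
    then have deg: "degree k < degree h" using less.prems(3) by simp
    show ?thesis
    proof (cases "\<exists>l. poly h l = 0 \<and> poly k l = 0")
      case True
      then obtain l where "poly h l = 0" "poly k l = 0" by blast
      then obtain h1 k1 where h1: "h = [:- l, 1:] * h1" and k1: "k = [:- l, 1:] * k1"
        by (metis dvdE poly_eq_0_iff_dvd)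
      have nz: "h1 \<noteq> 0" "k1 \<noteq> 0" using h1 k1 h0 k0 by auto
      have d: "degree h = Suc (degree h1)" "degree k = Suc (degree k1)"
        unfolding h1 k1 using nz by (subst degree_mult_eq; simp)+
      have ev: "poly (cpoly h) x = (x - of_real l) * poly (cpoly h1) x"
        "poly (cpoly k) x = (x - of_real l) * poly (cpoly k1) x" for x
        unfolding h1 k1 by (simp_all add: cp.hom_mult of_real_hom.map_poly_pCons_hom del: mult_pCons_left)
      have "upper_stable h1" using st unfolding upper_stable_def ev by auto
      moreover have "Im (poly (cpoly k1) x / poly (cpoly h1) x) \<le> 0" if "Im x > 0" for x
      proof -
        have "x \<noteq> of_real l" using that by auto
        then have "poly (cpoly k1) x / poly (cpoly h1) x = poly (cpoly k) x / poly (cpoly h) x"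
          unfolding ev by simp
        then show ?thesis using im[OF that] by simp
      qed
      ultimately obtain w where w: "\<forall>l. w l \<ge> 0"
        "\<And>x. poly h1 x \<noteq> 0 \<Longrightarrow> poly k1 x = poly h1 x * (\<Sum>l | poly h1 l = 0. w l / (x - l))"
        using less.hyps[of h1 k1] d nz deg by auto
      \<comment> \<open>The cancelled point \<open>l\<close> may no longer be a root of
        \<open>h1\<close>; it then gets weight 0.\<close>
      define w' where "w' m = (if poly h1 m = 0 then w m else 0)" for m
      have sub: "{m. poly h1 m = 0} \<subseteq> {m. poly h m = 0}" unfolding h1 by auto
      have "poly k x = poly h x * (\<Sum>m | poly h m = 0. w' m / (x - m))" if "poly h x \<noteq> 0" for x
      proof -
        have "(\<Sum>m | poly h m = 0. w' m / (x - m)) = (\<Sum>m | poly h1 m = 0. w m / (x - m))"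
          by (rule sum.mono_neutral_cong_right[OF finL sub]) (auto simp: w'_def)
        moreover have "poly h x = (x - l) * poly h1 x" "poly k x = (x - l) * poly k1 x"
          unfolding h1 k1 by (simp_all add: algebra_simps)
        ultimately show ?thesis using w(2)[of x] that by auto
      qed
      moreover have "\<forall>m. w' m \<ge> 0" using w(1) by (simp add: w'_def)
      ultimately show ?thesis by blast
    next
      case False
      define L where "L = {l. poly h l = 0}"
      have simple: "\<exists>g. h = [:- l, 1:] * g \<and> poly k l / poly g l > 0" if l: "l \<in> L" for l
      proof -
        obtain g where g: "h = [:- l, 1:] ^ order l h * g" "\<not> [:- l, 1:] dvd g"
          using order_decomp[OF h0, of l] by blast
        have gl: "poly g l \<noteq> 0" using g(2) poly_eq_0_iff_dvd by blast
        have kl: "poly k l \<noteq> 0" using False l by (auto simp: L_def)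
        have o: "order l h \<ge> 1" using l h0 order_root[of h l] by (simp add: L_def Suc_le_eq)
        show ?thesis using residue_simple[OF g(1) gl kl o im] g(1) by auto
      qed
      then obtain H where H: "\<And>l. l \<in> L \<Longrightarrow> h = [:- l, 1:] * H l"
        and Hpos: "\<And>l. l \<in> L \<Longrightarrow> poly k l / poly (H l) l > 0"
        by metis
      define w where "w l = (if l \<in> L then poly k l / poly (H l) l else 0)" for l
      have w: "w l \<ge> 0" for l using Hpos[of l] by (simp add: w_def less_imp_le)
      have Hl: "poly (H l) l \<noteq> 0" if "l \<in> L" for l using Hpos[OF that] by auto
      have Hm: "poly (H m) l = 0" if "l \<in> L" "m \<in> L" "l \<noteq> m" for l m
        using H[OF that(2)] that(1,3) by (auto simp: L_def)
      \<comment> \<open>The interpolation error vanishes at every root of \<open>h\<close>. These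
        roots are real and simple, hence \<open>degree h\<close> in number, more than the degree of
        \<open>R\<close> allows.\<close>
      define R where "R = k - (\<Sum>m\<in>L. smult (w m) (H m))"
      have R0: "poly R l = 0" if "l \<in> L" for l
      proof -
        have "(\<Sum>m\<in>L. w m * poly (H m) l) = (\<Sum>m\<in>L. if m = l then poly k l else 0)"
          using that Hl Hm by (intro sum.cong) (auto simp: w_def)
        then show ?thesis using that finL by (simp add: R_def poly_sum L_def[symmetric])
      qed
      have degH: "degree (H m) < degree h" if "m \<in> L" for m
      proof -
        have "H m \<noteq> 0" using H[OF that] h0 by auto
        then have "degree h = Suc (degree (H m))"
          by (subst H[OF that], subst degree_mult_eq) auto
        then show ?thesis by simp
      qed
      have h_pos: "degree h > 0" using deg by simp
      have degR: "degree R < degree h"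
        unfolding R_def
        by (intro degree_diff_less deg degree_sum_less h_pos) (use degH h_pos in \<open>auto intro: le_less_trans[OF degree_smult_le]\<close>)
      have "R = 0"
      proof (rule ccontr)
        assume R: "R \<noteq> 0"
        have c0: "cpoly h \<noteq> 0" using h0 by simp
        have "rsquarefree (cpoly h)"
          unfolding rsquarefree_roots
        proof (intro allI notI)
          fix a assume a: "poly (cpoly h) a = 0 \<and> poly (pderiv (cpoly h)) a = 0"
          define l where "l = Re a"
          have l: "a = of_real l" "l \<in> L" using upper_stable_real[OF st] a by (auto simp: l_def L_def)
          have "poly (pderiv h) l = poly (H l) l"
            by (subst H[OF l(2)], subst pderiv_mult) (simp add: pderiv_pCons)
          moreover have "poly (pderiv (cpoly h)) a = of_real (poly (pderiv h) l)"
            unfolding l(1) by (simp flip: of_real_hom.map_poly_pderiv)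
          ultimately show False using a Hl[OF l(2)] by simp
        qed
        then have "card {z. poly (cpoly h) z = 0} = degree h"
          using rsquarefree_card_degree[OF c0] by simp
        moreover have "{z. poly (cpoly h) z = 0} = complex_of_real ` L"
          using upper_stable_real[OF st] by (auto simp: L_def image_iff)
        moreover have "card (complex_of_real ` L) = card L" by (rule card_image) (auto simp: inj_on_def)
        ultimately have "card L = degree h" by simp
        moreover have "card L \<le> card {x. poly R x = 0}"
          by (rule card_mono[OF poly_roots_finite[OF R]]) (use R0 in auto)
        moreover have "card {x. poly R x = 0} \<le> degree R" by (rule card_poly_roots_bound[OF R])
        ultimately show False using degR by simp
      qed
      have "poly k x = poly h x * (\<Sum>l | poly h l = 0. w l / (x - l))" if x: "poly h x \<noteq> 0" for x
      proof -
        have "poly k x = (\<Sum>m\<in>L. w m * poly (H m) x)"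
          using arg_cong[OF \<open>R = 0\<close>, of "\<lambda>p. poly p x"] by (simp add: R_def poly_sum)
        also have "\<dots> = (\<Sum>m\<in>L. poly h x * (w m / (x - m)))"
        proof (rule sum.cong[OF refl])
          fix m assume m: "m \<in> L"
          have "x \<noteq> m" using m x by (auto simp: L_def)
          moreover have "poly h x = (x - m) * poly (H m) x" by (subst H[OF m]) (simp add: algebra_simps)
          ultimately show "w m * poly (H m) x = poly h x * (w m / (x - m))" by simp
        qed
        finally show ?thesis by (simp add: L_def sum_distrib_left)
      qed
      then show ?thesis using w by blast
    qed
  qed
qed

section \<open>Choosing the signs\<close>

lemma upper_stable_avg_poly:
  assumes "finite V" "\<And>i j. i \<in> V \<Longrightarrow> j \<in> V \<Longrightarrow> A i j = A j i" "\<forall>(i, j)\<in>set es. i \<noteq> j"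
  shows "upper_stable (avg_poly A es V)"
  unfolding upper_stable_def poly_cpoly_avg_poly
  by (intro allI impI stable_family_nonzero[OF stable_family_avg_char[OF assms] subset_refl] ballI)

text \<open>Deleting a vertex cannot move the largest root to the right: the quotient of the two
  polynomials is a sum of terms \<open>w l / (x - l)\<close> with \<open>w l \<ge> 0\<close> and
  \<open>l \<le> y\<close>. A zero at a single \<open>x > y\<close> would force all weights, and
  then the smaller polynomial, to vanish.\<close>

lemma avg_poly_remove_pos:
  assumes fin: "finite V" and sym: "\<And>i j. i \<in> V \<Longrightarrow> j \<in> V \<Longrightarrow> A i j = A j i"
    and es: "\<forall>(i, j)\<in>set es. i \<noteq> j" and i: "i \<in> V"
    and pos: "\<And>x. x > y \<Longrightarrow> poly (avg_poly A es V) x > 0" and x: "x > y"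
  shows "poly (avg_poly A es (V - {i})) x > 0"
proof -
  let ?h = "avg_poly A es V" and ?k = "avg_poly A es (V - {i})"
  have h: "degree ?h = card V" "?h \<noteq> 0" using monic_degD[OF monic_deg_avg_poly[OF fin]] by auto
  have k: "degree ?k = card (V - {i})" "?k \<noteq> 0"
    using monic_degD[OF monic_deg_avg_poly[OF finite_Diff[OF fin]]] by auto
  have deg: "degree ?k < degree ?h"
    unfolding h k by (rule psubset_card_mono[OF fin]) (use i in auto)
  have im: "Im (poly (cpoly ?k) z / poly (cpoly ?h) z) \<le> 0" if z: "Im z > 0" for z
  proof -
    define r where "r = poly (cpoly ?h) z / poly (cpoly ?k) z"
    have "Im r > 0"
      unfolding r_def poly_cpoly_avg_poly
      by (rule stable_ratio[OF stable_family_avg_char[OF fin sym es] subset_refl i]) (use z in auto)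
    moreover have "poly (cpoly ?k) z / poly (cpoly ?h) z = inverse r" by (simp add: r_def)
    ultimately show ?thesis by (simp add: divide_nonneg_nonneg)
  qed
  obtain w where w: "\<And>l. w l \<ge> 0" and eq: "\<And>x. poly ?h x \<noteq> 0 \<Longrightarrow>
      poly ?k x = poly ?h x * (\<Sum>l | poly ?h l = 0. w l / (x - l))"
    using partial_fractions[OF upper_stable_avg_poly[OF fin sym es] h(2) _ im] deg by blast
  have l: "l \<le> y" if "poly ?h l = 0" for l using pos[of l] that by force
  have finR: "finite {l. poly ?h l = 0}" using poly_roots_finite[OF h(2)] .
  have nn: "w l / (x - l) \<ge> 0" if "poly ?h l = 0" for l using w[of l] l[OF that] x by simp
  have "poly ?k x \<ge> 0"
    using eq[of x] pos[OF x] by (auto intro!: mult_nonneg_nonneg sum_nonneg nn)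
  moreover have "poly ?k x \<noteq> 0"
  proof
    assume "poly ?k x = 0"
    then have "(\<Sum>l | poly ?h l = 0. w l / (x - l)) = 0" using eq[of x] pos[OF x] by auto
    then have "\<forall>l\<in>{l. poly ?h l = 0}. w l / (x - l) = 0"
      using sum_nonneg_eq_0_iff[OF finR, of "\<lambda>l. w l / (x - l)"] nn by auto
    then have "w m = 0" if "poly ?h m = 0" for m using that l[OF that] x by auto
    then have "poly ?k z = 0" if "z > y" for z
      using eq[of z] pos[OF that] by auto
    then have "{y<..} \<subseteq> {z. poly ?k z = 0}" by auto
    then show False using poly_roots_finite[OF k(2)] infinite_Ioi finite_subset by blast
  qed
  ultimately show ?thesis by simp
qed

text \<open>If both signs failed, take the smaller of the two places of failure. There the sum of
  both polynomials is positive, so one of them is, and by the homotopy it stays positive to the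
  right, where it was supposed to fail.\<close>

lemma choose_sign:
  assumes fin: "finite V" and sym: "\<And>i j. i \<in> V \<Longrightarrow> j \<in> V \<Longrightarrow> A i j = A j i"
    and es: "\<forall>(i, j)\<in>set es. i \<noteq> j" and ij: "i \<in> V" "j \<in> V" "i \<noteq> j"
    and pos: "\<And>x. x > y \<Longrightarrow> poly (avg_poly A ((i, j) # es) V) x > 0"
  shows "\<exists>s\<in>{-1, 1}. \<forall>x>y. poly (avg_poly (\<lambda>a b. A a b + edge_mat i j s a b) es V) x > 0"
proof -
  let ?A = "\<lambda>s a b. A a b + edge_mat i j s a b"
  define D where "D = avg_poly A es (V - {i, j})"
  have es': "\<forall>(i, j)\<in>set ((i, j) # es). i \<noteq> j" using es ij by auto
  have Dpos: "poly D x > 0" if "x > y" for x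
  proof -
    have 1: "poly (avg_poly A ((i, j) # es) (V - {i})) x > 0" if "x > y" for x
      by (rule avg_poly_remove_pos[OF fin _ es' ij(1) pos that]) (use sym in auto)
    have "poly (avg_poly A ((i, j) # es) (V - {i} - {j})) x > 0"
      by (rule avg_poly_remove_pos[OF _ _ es' _ 1 that]) (use fin sym ij in auto)
    moreover have "avg_poly A ((i, j) # es) (V - {i} - {j}) = D"
      by (simp add: avg_poly_def D_def Diff_insert2[symmetric] insert_commute)
    ultimately show ?thesis by simp
  qed
  have cst: "(\<lambda>a b. [:?A s a b:]) = (\<lambda>a b. [:A a b:] + edge_mat i j [:s:] a b)" for s
    by (auto simp: fun_eq_iff edge_mat_def)
  obtain L where L: "\<And>s. avg_char (\<lambda>a b. [:A a b:] + edge_mat i j s a b) es V (\<lambda>_. [:0, 1:])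
      = avg_char (\<lambda>a b. [:A a b:]) es V (\<lambda>_. [:0, 1:]) + s * L
        - (if i \<in> V \<and> j \<in> V then 2 * s\<^sup>2 * avg_char (\<lambda>a b. [:A a b:]) es (V - {i, j}) (\<lambda>_. [:0, 1:]) else 0)"
    using avg_char_edge[OF fin ij(3), of "\<lambda>a b. [:A a b:]" es "\<lambda>_. [:0, 1:]"] by blast
  have q: "avg_poly (?A s) es V = avg_poly A es V + smult s L - smult (2 * s\<^sup>2) D" for s
    unfolding avg_poly_def cst L using ij
    by (simp add: D_def avg_poly_def power2_eq_square numeral_poly mult_ac)
  have avg: "poly (avg_poly A ((i, j) # es) V) x = poly (avg_poly A es V) x - 2 * poly D x" for x
    using ij by (simp add: avg_poly_def D_def)
  have symA: "?A s a b = ?A s b a" if "a \<in> V" "b \<in> V" for s a b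
    using sym[OF that] by (simp add: edge_mat_def disj_commute conj_commute)
  \<comment> \<open>The path is \<open>avg_poly (?A (t * s)) es V\<close> for \<open>t\<close> in
    [0, 1], all of it real-rooted. Its quadratic term in \<open>t\<close> is
    \<open>- 2 * t\<^sup>2\<close> times \<open>D\<close>, so it exceeds linear interpolation by
    \<open>2 * t * (1 - t)\<close> times \<open>D\<close>, and \<open>D\<close> is positive beyond
    \<open>y\<close> since it arises by deleting two vertices.\<close>
  have up: "poly (avg_poly (?A s) es V) x > 0"
    if s: "s \<in> {-1, 1}" and z: "z > y" "poly (avg_poly (?A s) es V) z > 0" and x: "x \<ge> z" for s z x
  proof (rule homotopy_positive[of "avg_poly A es V" "avg_poly (?A s) es V" "smult 2 D" "card V" z])
    fix t :: real assume t: "0 \<le> t" "t \<le> 1"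
    let ?P = "smult (1 - t) (avg_poly A es V) + smult t (avg_poly (?A s) es V) + smult (t * (1 - t)) (smult 2 D)"
    have "s\<^sup>2 = 1" using s by auto
    then have eq: "?P
        = avg_poly (?A (t * s)) es V"
      unfolding q by (intro poly_eqI) (simp add: algebra_simps power2_eq_square)
    show "upper_stable ?P
      \<and> monic_deg ?P (card V)"
      unfolding eq by (intro conjI upper_stable_avg_poly[OF fin symA es] monic_deg_avg_poly[OF fin])
  next
    fix x assume x: "x \<ge> z"
    then have "x > y" using z by simp
    then show "poly (smult 2 D) x \<ge> 0" "poly (avg_poly A es V) x > 0"
      using Dpos[of x] pos[of x] avg[of x] by simp_all
  qed (use z x in auto)
  show ?thesis
  proof (rule ccontr)
    assume "\<not> ?thesis"
    then obtain x1 x2 where x: "x1 > y" "\<not> poly (avg_poly (?A (-1)) es V) x1 > 0"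
      "x2 > y" "\<not> poly (avg_poly (?A 1) es V) x2 > 0" by auto
    define z where "z = min x1 x2"
    have z: "z > y" "x1 \<ge> z" "x2 \<ge> z" using x by (auto simp: z_def)
    have "poly (avg_poly (?A (-1)) es V) z + poly (avg_poly (?A 1) es V) z
        = 2 * poly (avg_poly A ((i, j) # es) V) z"
      unfolding avg q by simp
    then have "poly (avg_poly (?A (-1)) es V) z > 0 \<or> poly (avg_poly (?A 1) es V) z > 0"
      using pos[OF z(1)] by linarith
    then show False using up[of "-1" z x1] up[of 1 z x2] x z by auto
  qed
qed

lemma choose_signs:
  assumes fin: "finite V" and sym: "\<And>i j. i \<in> V \<Longrightarrow> j \<in> V \<Longrightarrow> A i j = A j i"
    and es: "distinct es" "\<forall>(i, j)\<in>set es. i < j \<and> i \<in> V \<and> j \<in> V"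
    and pos: "\<And>x. x > y \<Longrightarrow> poly (avg_poly A es V) x > 0"
  shows "\<exists>\<tau>. (\<forall>i j. \<tau> i j = \<tau> j i) \<and>
     (\<forall>i j. if (i, j) \<in> set es \<or> (j, i) \<in> set es then \<tau> i j \<in> {-1, 1} else \<tau> i j = 0) \<and>
     (\<forall>x>y. poly (avg_poly (\<lambda>a b. A a b + \<tau> a b) [] V) x > 0)"
  using sym es pos
proof (induct es arbitrary: A)
  case Nil
  then show ?case by (intro exI[of _ "\<lambda>_ _. 0"]) simp
next
  case (Cons e es)
  obtain i j where e: "e = (i, j)" by force
  have ij: "i \<in> V" "j \<in> V" "i < j" "(i, j) \<notin> set es" using Cons.prems(2,3) by (auto simp: e)
  have ne: "\<forall>(i, j)\<in>set es. i \<noteq> j" using Cons.prems(3) by auto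
  have nji: "(j, i) \<notin> set es" using ij(3) Cons.prems(3) by auto
  obtain s where s: "s \<in> {-1, 1}"
    and pos: "\<forall>x>y. poly (avg_poly (\<lambda>a b. A a b + edge_mat i j s a b) es V) x > 0"
    using choose_sign[OF fin Cons.prems(1) ne ij(1,2) less_imp_neq[OF ij(3)]
        Cons.prems(4)[unfolded e]] by blast
  obtain \<tau> where t: "\<forall>i j. \<tau> i j = \<tau> j i"
     "\<forall>i j. if (i, j) \<in> set es \<or> (j, i) \<in> set es then \<tau> i j \<in> {-1, 1} else \<tau> i j = 0"
     "\<forall>x>y. poly (avg_poly (\<lambda>a b. (A a b + edge_mat i j s a b) + \<tau> a b) [] V) x > 0"
  proof -
    have "\<exists>\<tau>. (\<forall>i j. \<tau> i j = \<tau> j i) \<and>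
     (\<forall>i j. if (i, j) \<in> set es \<or> (j, i) \<in> set es then \<tau> i j \<in> {-1, 1} else \<tau> i j = 0) \<and>
     (\<forall>x>y. poly (avg_poly (\<lambda>a b. (A a b + edge_mat i j s a b) + \<tau> a b) [] V) x > 0)"
    proof (rule Cons.hyps)
      show "A a b + edge_mat i j s a b = A b a + edge_mat i j s b a" if "a \<in> V" "b \<in> V" for a b
        using Cons.prems(1)[OF that] by (auto simp: edge_mat_def)
    qed (use Cons.prems pos in auto)
    then show ?thesis using that by blast
  qed
  define \<tau>' where "\<tau>' a b = edge_mat i j s a b + \<tau> a b" for a b
  have "\<tau>' a b = \<tau>' b a" for a b using t(1) by (auto simp: \<tau>'_def edge_mat_def)
  moreover have "if (a, b) \<in> set (e # es) \<or> (b, a) \<in> set (e # es) then \<tau>' a b \<in> {-1, 1} else \<tau>' a b = 0" for a b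
    using t(2)[rule_format, of a b] s ij nji by (auto simp: \<tau>'_def edge_mat_def e split: if_splits)
  moreover have "\<forall>x>y. poly (avg_poly (\<lambda>a b. A a b + \<tau>' a b) [] V) x > 0"
    using t(3) by (simp add: \<tau>'_def add.assoc)
  ultimately show ?case by blast
qed

section \<open>The Heilmann-Lieb bound for matchings of edge weight 2\<close>

definition nbrs_in :: "(nat \<times> nat) list \<Rightarrow> nat \<Rightarrow> nat set \<Rightarrow> nat list" where
  "nbrs_in es i W = map (\<lambda>(a, b). if a = i then b else a)
     (filter (\<lambda>(a, b). (a = i \<and> b \<in> W) \<or> (b = i \<and> a \<in> W)) es)"

lemma nbrs_in_Nil [simp]: "nbrs_in [] i W = []"
  by (simp add: nbrs_in_def)

lemma nbrs_in_Cons: "nbrs_in ((a, b) # es) i W =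
  (if a = i \<and> b \<in> W then b # nbrs_in es i W else if b = i \<and> a \<in> W then a # nbrs_in es i W else nbrs_in es i W)"
  by (auto simp: nbrs_in_def)

lemma nbrs_in_subset: "set (nbrs_in es i W) \<subseteq> W"
  by (auto simp: nbrs_in_def)

lemma nbrs_in_length_mono: "W \<subseteq> W' \<Longrightarrow> length (nbrs_in es i W) \<le> length (nbrs_in es i W')"
  by (induct es) (auto simp: nbrs_in_Cons)

lemma nbrs_in_length_remove:
  assumes "j \<in> set (nbrs_in es i W)" "i \<in> W"
  shows "Suc (length (nbrs_in es j (W - {i}))) \<le> length (nbrs_in es j W)"
  using assms
proof (induct es)
  case (Cons e es)
  obtain a b where e: "e = (a, b)" by force
  have "length (nbrs_in es j (W - {i})) \<le> length (nbrs_in es j W)" by (rule nbrs_in_length_mono) auto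
  then show ?case using Cons nbrs_in_subset[of es i W] by (auto simp: e nbrs_in_Cons split: if_splits)
qed simp

lemma avg_char_zero_Nil:
  assumes "finite W"
  shows "avg_char (\<lambda>_ _. 0) [] W z = (\<Prod>i\<in>W. z i)"
proof -
  have d: "pminor S (\<lambda>_ _. 0) = (0::'a)" if "finite S" "S \<noteq> {}" for S
    using that pminor_row[of S _ "\<lambda>_ _. 0::'a"] by auto
  have "avg_char (\<lambda>_ _. 0) [] W z = (\<Sum>S\<in>Pow W. if S = W then dminor (\<lambda>_ _. 0) W z else 0)"
    unfolding avg_char.simps mixed_char_def
  proof (rule sum.cong[OF refl])
    fix S assume S: "S \<in> Pow W"
    show "dminor (\<lambda>i j. - 0) S z * pminor (W - S) (\<lambda>_ _. 0) = (if S = W then dminor (\<lambda>_ _. 0) W z else 0)"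
      using S assms d[of "W - S"] by auto
  qed
  then show ?thesis using assms by (simp add: dminor_def pminor_diag)
qed

text \<open>For the zero matrix, \<open>avg_char\<close> sums over matchings, with a factor -2 for
  each matched pair. This is the recursion at a vertex: \<open>i\<close> is unmatched or matched to
  a neighbour \<open>j\<close>. As the definition peels off edges, it needs an induction on the
  list, distinguishing whether the first edge meets \<open>i\<close>.\<close>

lemma avg_char_zero_expand:
  fixes z :: "nat \<Rightarrow> 'a::comm_ring_1"
  assumes "finite W" "i \<in> W" "\<forall>(a, b)\<in>set es. a \<noteq> b"
  shows "avg_char (\<lambda>_ _. 0) es W z = z i * avg_char (\<lambda>_ _. 0) es (W - {i}) z
    - 2 * (\<Sum>j\<leftarrow>nbrs_in es i W. avg_char (\<lambda>_ _. 0) es (W - {i, j}) z)"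
  using assms
proof (induct es arbitrary: W)
  case Nil
  then show ?case by (simp add: avg_char_zero_Nil prod.remove del: avg_char.simps)
next
  case (Cons e es)
  obtain k l where e: "e = (k, l)" by force
  have kl: "k \<noteq> l" and es: "\<forall>(a, b)\<in>set es. a \<noteq> b" using Cons.prems(3) by (auto simp: e)
  let ?Q = "\<lambda>W. avg_char (\<lambda>_ _. 0) es W z"
  have IH: "?Q W = z i * ?Q (W - {i}) - 2 * (\<Sum>j\<leftarrow>nbrs_in es i W. ?Q (W - {i, j}))"
    using Cons.hyps[OF Cons.prems(1,2) es] .
  have inc: "avg_char (\<lambda>_ _. 0) (e # es) (W - X) z = ?Q (W - X)" if "k \<in> X \<or> l \<in> X" for X
    using that by (auto simp: e)
  show ?case
  proof (cases "k \<in> W \<and> l \<in> W")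
    case False
    then have "avg_char (\<lambda>_ _. 0) (e # es) W' z = ?Q W'" if "W' \<subseteq> W" for W'
      using that by (auto simp: e)
    moreover have "nbrs_in (e # es) i W = nbrs_in es i W" using False Cons.prems(2) by (auto simp: e nbrs_in_Cons)
    ultimately show ?thesis using IH by simp
  next
    case True
    show ?thesis
    proof (cases "k = i \<or> l = i")
      case i: True
      define m where "m = (if k = i then l else k)"
      have m: "nbrs_in (e # es) i W = m # nbrs_in es i W" "{k, l} = {i, m}"
        using i True kl by (auto simp: m_def e nbrs_in_Cons)
      have "avg_char (\<lambda>_ _. 0) (e # es) W z = ?Q W - 2 * ?Q (W - {i, m})"
        using True m(2) by (simp add: e)
      moreover have "avg_char (\<lambda>_ _. 0) (e # es) (W - {i}) z = ?Q (W - {i})" by (rule inc) (use i in auto)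
      moreover have "avg_char (\<lambda>_ _. 0) (e # es) (W - {i, j}) z = ?Q (W - {i, j})" for j
        by (rule inc) (use i in auto)
      ultimately show ?thesis unfolding m(1) IH by (simp add: algebra_simps)
    next
      case ni: False
      have IH2: "?Q (W - {k, l}) = z i * ?Q (W - {k, l} - {i})
          - 2 * (\<Sum>j\<leftarrow>nbrs_in es i (W - {k, l}). ?Q (W - {k, l} - {i, j}))"
        using Cons.hyps[of "W - {k, l}"] Cons.prems es ni by auto
      have adj: "nbrs_in (e # es) i W = nbrs_in es i W" using ni by (auto simp: e nbrs_in_Cons)
      have s1: "(\<Sum>j\<leftarrow>nbrs_in es i W. avg_char (\<lambda>_ _. 0) (e # es) (W - {i, j}) z)
          = (\<Sum>j\<leftarrow>nbrs_in es i W. ?Q (W - {i, j})) - 2 * (\<Sum>j\<leftarrow>nbrs_in es i (W - {k, l}). ?Q (W - {k, l} - {i, j}))"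
      proof -
        have *: "avg_char (\<lambda>_ _. 0) (e # es) (W - {i, j}) z
          = ?Q (W - {i, j}) - (if j \<in> {k, l} then 0 else 2 * ?Q (W - {k, l} - {i, j}))" for j
        proof -
          have "W - {i, j} - {k, l} = W - {k, l} - {i, j}" by auto
          then show ?thesis using True ni by (auto simp: e)
        qed
        have f: "nbrs_in es i (W - {k, l}) = filter (\<lambda>j. j \<notin> {k, l}) (nbrs_in es i W)"
          by (induct es) (use ni in \<open>auto simp: nbrs_in_Cons\<close>)
        have g: "(\<Sum>j\<leftarrow>js. ?Q (W - {i, j}) - (if j \<in> {k, l} then 0 else 2 * ?Q (W - {k, l} - {i, j})))
          = (\<Sum>j\<leftarrow>js. ?Q (W - {i, j})) - 2 * (\<Sum>j\<leftarrow>filter (\<lambda>j. j \<notin> {k, l}) js. ?Q (W - {k, l} - {i, j}))" for js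
          by (induct js) (simp_all add: algebra_simps)
        show ?thesis unfolding * f g ..
      qed
      have square_walks: "avg_char (\<lambda>_ _. 0) (e # es) W z = ?Q W - 2 * ?Q (W - {k, l})" using True by (simp add: e)
      have s3: "avg_char (\<lambda>_ _. 0) (e # es) (W - {i}) z = ?Q (W - {i}) - 2 * ?Q (W - {k, l} - {i})"
      proof -
        have "W - {i} - {k, l} = W - {k, l} - {i}" by auto
        then show ?thesis using True ni by (auto simp: e)
      qed
      show ?thesis unfolding adj s1 square_walks s3 IH IH2 by (simp add: algebra_simps)
    qed
  qed
qed

text \<open>The quotient of the values at \<open>W\<close> and \<open>W - {i}\<close> is
  \<open>x\<close> minus twice a sum of inverse quotients at the neighbours of \<open>i\<close>,
  each of which has lost the neighbour \<open>i\<close> and so has at most \<open>d - 1\<close>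
  left. If these quotients are at least \<open>y\<close>, the new one is at least x - 2(d - 1)/y = x
  - y > y; this is why y^2 = 2(d - 1) and the threshold is \<open>2 * y\<close>.\<close>

lemma heilmann_lieb:
  fixes x y :: real
  assumes d: "d \<ge> 2" and y: "y > 0" "y\<^sup>2 = 2 * (real d - 1)" and x: "x > 2 * y"
    and es: "\<forall>(a, b)\<in>set es. a \<noteq> b" and fin: "finite W"
    and deg: "\<And>i. i \<in> W \<Longrightarrow> length (nbrs_in es i W) \<le> d"
  shows "avg_char (\<lambda>_ _. 0) es W (\<lambda>_. x) > 0 \<and>
    (\<forall>i\<in>W. length (nbrs_in es i W) \<le> d - 1 \<longrightarrow>
      avg_char (\<lambda>_ _. 0) es W (\<lambda>_. x) \<ge> y * avg_char (\<lambda>_ _. 0) es (W - {i}) (\<lambda>_. x))"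
  using fin deg
proof (induct "card W" arbitrary: W rule: less_induct)
  case less
  let ?Q = "\<lambda>W. avg_char (\<lambda>_ _. 0) es W (\<lambda>_. x)"
  have step: "?Q (W - {i}) > 0 \<and> ?Q W \<ge> (x - 2 * real (length (nbrs_in es i W)) / y) * ?Q (W - {i})"
    if i: "i \<in> W" for i
  proof -
    have c: "card (W - {i}) < card W" using i less.prems(1) by (intro psubset_card_mono) auto
    have deg': "length (nbrs_in es j (W - {i})) \<le> d" if "j \<in> W - {i}" for j
      using less.prems(2)[of j] nbrs_in_length_mono[of "W - {i}" W es j] that by force
    note IH = less.hyps[OF c finite_Diff[OF less.prems(1)] deg']
    have bd: "?Q (W - {i, j}) \<le> ?Q (W - {i}) / y" if j: "j \<in> set (nbrs_in es i W)" for j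
    proof -
      have jW: "j \<in> W" "j \<noteq> i" using j nbrs_in_subset[of es i W] es by (auto simp: nbrs_in_def split: if_splits)
      have "length (nbrs_in es j (W - {i})) \<le> d - 1"
        using nbrs_in_length_remove[OF j i] less.prems(2)[OF jW(1)] by simp
      then have "y * ?Q (W - {i} - {j}) \<le> ?Q (W - {i})" using IH jW by auto
      moreover have "W - {i} - {j} = W - {i, j}" by auto
      ultimately show ?thesis using y(1) by (simp add: field_simps)
    qed
    have "(\<Sum>j\<leftarrow>js. ?Q (W - {i, j})) \<le> real (length js) * (?Q (W - {i}) / y)"
      if "set js \<subseteq> set (nbrs_in es i W)" for js
      using that by (induct js) (auto simp: algebra_simps add_divide_distrib intro!: add_mono bd)
    from this[of "nbrs_in es i W"]
    have "(\<Sum>j\<leftarrow>nbrs_in es i W. ?Q (W - {i, j})) \<le> real (length (nbrs_in es i W)) * (?Q (W - {i}) / y)" by simp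
    then show ?thesis
      using avg_char_zero_expand[OF less.prems(1) i es, of "\<lambda>_. x"] IH by (simp add: algebra_simps)
  qed
  have yy: "y * y = 2 * (real d - 1)" using y(2) by (simp add: power2_eq_square)
  have pos: "?Q W > 0"
  proof (cases "W = {}")
    case True
    have "avg_char (\<lambda>_ _. 0) es {} (\<lambda>_. x) = 1" by (induct es) (auto simp: mixed_char_def dminor_def)
    then show ?thesis using True by simp
  next
    case False
    then obtain i where i: "i \<in> W" by blast
    have "real (length (nbrs_in es i W)) / y \<le> real d / y" using less.prems(2)[OF i] y by (simp add: divide_right_mono)
    \<comment> \<open>A vertex that still has all \<open>d\<close> neighbours only needs positivity,
      for which d \<le> 2(d - 1) suffices; this is where \<open>d \<ge> 2\<close> enters.\<close>
    moreover have "real d / y \<le> y" using yy d y by (simp add: divide_le_eq)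
    ultimately have "x - 2 * real (length (nbrs_in es i W)) / y > 0" using x by simp
    then show ?thesis using step[OF i] by (meson mult_pos_pos less_le_trans)
  qed
  have "?Q W \<ge> y * ?Q (W - {i})" if i: "i \<in> W" and l: "length (nbrs_in es i W) \<le> d - 1" for i
  proof -
    have "real (length (nbrs_in es i W)) \<le> real d - 1" using l d by linarith
    then have "2 * real (length (nbrs_in es i W)) \<le> y * y" using yy by simp
    then have "2 * real (length (nbrs_in es i W)) / y \<le> y" using y by (simp add: divide_le_eq)
    then have "y \<le> x - 2 * real (length (nbrs_in es i W)) / y" using x by linarith
    then have "y * ?Q (W - {i}) \<le> (x - 2 * real (length (nbrs_in es i W)) / y) * ?Q (W - {i})"
      using step[OF i] by (intro mult_right_mono) auto
    then show ?thesis using step[OF i] by linarith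
  qed
  then show ?case using pos by blast
qed

lemma exists_good_signing:
  fixes y :: real
  assumes d: "d \<ge> 2" and y: "y > 0" "y\<^sup>2 = 2 * (real d - 1)"
    and es: "distinct es" "\<forall>(i, j)\<in>set es. i < j \<and> i \<in> V \<and> j \<in> V" and fin: "finite V"
    and deg: "\<And>i. i \<in> V \<Longrightarrow> length (nbrs_in es i V) \<le> d"
  shows "\<exists>\<tau>. (\<forall>i j. \<tau> i j = \<tau> j i) \<and>
     (\<forall>i j. if (i, j) \<in> set es \<or> (j, i) \<in> set es then \<tau> i j \<in> {-1, 1} else \<tau> i j = 0) \<and>
     (\<forall>x>2 * y. poly (avg_poly \<tau> [] V) x > 0)"
proof -
  have "\<exists>\<tau>. (\<forall>i j. \<tau> i j = \<tau> j i) \<and>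
     (\<forall>i j. if (i, j) \<in> set es \<or> (j, i) \<in> set es then \<tau> i j \<in> {-1, 1} else \<tau> i j = 0) \<and>
     (\<forall>x>2 * y. poly (avg_poly (\<lambda>a b. 0 + \<tau> a b) [] V) x > 0)"
  proof (rule choose_signs[OF fin _ es])
    fix x assume "x > 2 * y"
    then show "poly (avg_poly (\<lambda>_ _. 0) es V) x > 0"
      unfolding poly_avg_poly using heilmann_lieb[OF d y _ _ fin deg] es(2) by fastforce
  qed simp
  then show ?thesis by simp
qed

section \<open>The spectral measure of a vector\<close>

lemma dminor_cong:
  assumes "\<And>i. i \<in> W \<Longrightarrow> z i = z' i" "\<And>i j. i \<in> W \<Longrightarrow> j \<in> W \<Longrightarrow> B i j = B' i j"
  shows "dminor B W z = dminor B' W z'"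
  unfolding dminor_def by (rule pminor_cong) (use assms in auto)

lemma dminor_expand:
  assumes fin: "finite W"
  shows "dminor B W z = (\<Sum>T\<in>Pow W. (\<Prod>i\<in>T. z i) * pminor (W - T) B)"
proof -
  \<comment> \<open>Only the variables in \<open>K\<close> are switched on, so that the induction
    can add them one at a time.\<close>
  have "dminor B W (\<lambda>i. if i \<in> K then z i else 0) = (\<Sum>T\<in>Pow K. (\<Prod>i\<in>T. z i) * pminor (W - T) B)"
    if "finite K" "K \<subseteq> W" "finite W" for K W
    using that
  proof (induct arbitrary: W rule: finite_induct)
    case empty
    then show ?case by (simp add: dminor_def cong: if_cong)
  next
    case (insert i K)
    have i: "i \<in> W" and K: "K \<subseteq> W - {i}" "K \<subseteq> W" using insert by auto
    have z: "(\<lambda>j. if j \<in> insert i K then z j else 0) = (\<lambda>j. if j \<in> K then z j else 0)(i := (if i \<in> K then z i else 0) + z i)"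
      using insert(2) by (auto simp: fun_eq_iff)
    have "dminor B W (\<lambda>j. if j \<in> insert i K then z j else 0)
      = dminor B W (\<lambda>j. if j \<in> K then z j else 0) + z i * dminor B (W - {i}) (\<lambda>j. if j \<in> K then z j else 0)"
      unfolding z by (rule affine_familyD[OF affine_family_dminor[OF insert(5)] subset_refl i])
    also have "\<dots> = (\<Sum>T\<in>Pow K. (\<Prod>j\<in>T. z j) * pminor (W - T) B + z i * ((\<Prod>j\<in>T. z j) * pminor (W - {i} - T) B))"
      using insert(3)[OF K(2) insert(5)] insert(3)[OF K(1)] insert(5) by (simp add: sum.distrib sum_distrib_left)
    also have "\<dots> = (\<Sum>T\<in>Pow K. (\<Prod>j\<in>T. z j) * pminor (W - T) B + (\<Prod>j\<in>insert i T. z j) * pminor (W - insert i T) B)"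
    proof (rule sum.cong[OF refl])
      fix T assume T: "T \<in> Pow K"
      then have "finite T" "i \<notin> T" using insert(1,2) finite_subset by auto
      moreover have "W - {i} - T = W - insert i T" by auto
      ultimately show "(\<Prod>j\<in>T. z j) * pminor (W - T) B + z i * ((\<Prod>j\<in>T. z j) * pminor (W - {i} - T) B)
        = (\<Prod>j\<in>T. z j) * pminor (W - T) B + (\<Prod>j\<in>insert i T. z j) * pminor (W - insert i T) B"
        by (simp add: mult_ac)
    qed
    also have "\<dots> = (\<Sum>T\<in>Pow (insert i K). (\<Prod>j\<in>T. z j) * pminor (W - T) B)"
      by (rule sum_Pow_insert[OF insert(1,2), symmetric])
    finally show ?case .
  qed
  from this[OF fin subset_refl fin] have "dminor B W (\<lambda>i. if i \<in> W then z i else 0) = (\<Sum>T\<in>Pow W. (\<Prod>i\<in>T. z i) * pminor (W - T) B)" .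
  moreover have "dminor B W (\<lambda>i. if i \<in> W then z i else 0) = dminor B W z" by (rule dminor_cong) auto
  ultimately show ?thesis by simp
qed

text \<open>With diagonal variables Z and a zero corner its determinant is - v^T adj(Z - A) v, the
  negative of the derivative of det(Z - A + w v v^T) in w; hence the minus sign in
  \<open>mixed_num\<close>.\<close>

definition bordered :: "nat \<Rightarrow> (nat \<Rightarrow> nat \<Rightarrow> 'a) \<Rightarrow> (nat \<Rightarrow> 'a) \<Rightarrow> nat \<Rightarrow> nat \<Rightarrow> 'a::comm_ring_1" where
  "bordered o' A v i j = (if i = o' then (if j = o' then 0 else v j) else if j = o' then v i else - A i j)"

text \<open>The derivative in \<open>w\<close> of \<open>mixed_char\<close> with \<open>Z - A\<close> replaced by \<open>Z - A + w v v\<^sup>T\<close>, written with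
  bordered determinants: adding \<open>o'\<close> as an extra vertex of variable \<open>\<zeta>\<close> gives
  \<open>\<zeta> h - k\<close>, so stability of the bordered family shows \<open>Im (k / h) \<le> 0\<close>.\<close>

definition mixed_num :: "nat \<Rightarrow> (nat \<Rightarrow> nat \<Rightarrow> 'a) \<Rightarrow> (nat \<Rightarrow> 'a) \<Rightarrow> 'a::comm_ring_1 family" where
  "mixed_num o' A v V z = - (\<Sum>S\<in>Pow V. dminor (bordered o' A v) (insert o' S) (z(o' := 0)) * pminor (V - S) A)"

lemma (in comm_ring_hom) hom_mixed_num:
  "hom (mixed_num o' A v V z) = mixed_num o' (\<lambda>i j. hom (A i j)) (\<lambda>i. hom (v i)) V (\<lambda>i. hom (z i))"
proof -
  have 1: "(\<lambda>i j. hom (bordered o' A v i j)) = bordered o' (\<lambda>i j. hom (A i j)) (\<lambda>i. hom (v i))"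
    by (auto simp: bordered_def fun_eq_iff hom_distribs)
  have 2: "(\<lambda>i. hom ((z(o' := 0)) i)) = (\<lambda>i. hom (z i))(o' := 0)" by (auto simp: fun_eq_iff)
  show ?thesis unfolding mixed_num_def by (simp add: hom_distribs hom_dminor hom_pminor 1 2 del: fun_upd_apply)
qed

definition num_poly :: "nat \<Rightarrow> (nat \<Rightarrow> nat \<Rightarrow> real) \<Rightarrow> (nat \<Rightarrow> real) \<Rightarrow> nat set \<Rightarrow> real poly" where
  "num_poly o' A v V = mixed_num o' (\<lambda>i j. [:A i j:]) (\<lambda>i. [:v i:]) V (\<lambda>_. [:0, 1:])"

lemma poly_num_poly: "poly (num_poly o' A v V) x = mixed_num o' A v V (\<lambda>_. x)"
proof -
  have "comm_ring_hom (\<lambda>p. poly p x)" by unfold_locales auto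
  then show ?thesis unfolding num_poly_def by (subst comm_ring_hom.hom_mixed_num) simp_all
qed

lemma poly_cpoly_num_poly:
  "poly (cpoly (num_poly o' A v V)) x = mixed_num o' (cmat A) (\<lambda>i. complex_of_real (v i)) V (\<lambda>_. x)"
  unfolding num_poly_def
  by (subst comm_ring_hom.hom_mixed_num[OF comm_ring_hom_cpoly]) (simp add: of_real_hom.map_poly_pCons_hom)

text \<open>The border costs a factor \<open>x\<close>: degree \<open>card V\<close> would need all
  of \<open>V\<close> on the diagonal, leaving only the corner entry, which is 0.\<close>

lemma coeff_num_poly:
  assumes fin: "finite V" and o: "o' \<notin> V" and k: "k \<ge> card V"
  shows "coeff (num_poly o' A v V) k = 0"
proof -
  have c: "bordered o' (\<lambda>i j. [:A i j:]) (\<lambda>i. [:v i:]) = (\<lambda>i j. [:bordered o' A v i j:])"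
    by (auto simp: bordered_def fun_eq_iff)
  have z: "coeff (dminor (\<lambda>i j. [:bordered o' A v i j:]) (insert o' S) ((\<lambda>_. [:0, 1:])(o' := 0))) k = 0"
    if S: "S \<in> Pow V" for S
  proof -
    let ?z = "(\<lambda>_. [:0, 1:])(o' := 0) :: nat \<Rightarrow> real poly"
    have finS: "finite S" and oS: "o' \<notin> S" using S fin o finite_subset by auto
    have "coeff ((\<Prod>i\<in>T. ?z i) * pminor (insert o' S - T) (\<lambda>i j. [:bordered o' A v i j:])) k = 0"
      if T: "T \<in> Pow (insert o' S)" for T
    proof (cases "o' \<in> T")
      case True
      have "finite T" using T finS finite_subset by auto
      then have "(\<Prod>i\<in>T. ?z i) = 0" using True by (intro prod_zero) auto
      then show ?thesis by simp
    next
      case False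
      then have TS: "T \<subseteq> S" using T by auto
      have "(\<Prod>i\<in>T. ?z i) = (\<Prod>i\<in>T. [:0, 1:])" by (rule prod.cong) (use False in auto)
      also have "\<dots> = monom 1 (card T)" by (simp add: x_as_monom monom_power)
      finally have *: "(\<Prod>i\<in>T. ?z i) = monom 1 (card T)" .
      show ?thesis
      proof (cases "T = S")
        case True
        have "insert o' S - S = {o'}" using oS by auto
        moreover have "pminor {o'} (bordered o' A v) = 0"
          using pminor_row[of "{o'}" o' "bordered o' A v"] by (simp add: bordered_def)
        ultimately show ?thesis using True by (simp add: pminor_const)
      next
        case False
        then have "card T < card S" using TS finS by (intro psubset_card_mono) auto
        then have "card T < k" using card_mono[OF fin, of S] S k by auto
        then show ?thesis unfolding * pminor_const by (simp add: coeff_eq_0 degree_monom_eq)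
      qed
    qed
    then show ?thesis using finS by (subst dminor_expand) (simp_all add: coeff_sum del: fun_upd_apply)
  qed
  show ?thesis
    unfolding num_poly_def mixed_num_def c pminor_const
    by (simp add: coeff_sum z del: fun_upd_apply Pow_iff)
qed

lemma num_poly_im:
  assumes fin: "finite V" and o: "o' \<notin> V" and sym: "\<And>i j. A i j = A j i" and x: "Im x > 0"
  shows "Im (poly (cpoly (num_poly o' A v V)) x / poly (cpoly (avg_poly A [] V)) x) \<le> 0"
proof (rule ccontr)
  let ?A = "cmat A" and ?v = "\<lambda>i. complex_of_real (v i)"
  let ?B = "bordered o' ?A ?v"
  define k where "k = mixed_num o' ?A ?v V (\<lambda>_. x)"
  define h where "h = mixed_char ?A V (\<lambda>_. x)"
  have kh: "poly (cpoly (num_poly o' A v V)) x = k" "poly (cpoly (avg_poly A [] V)) x = h"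
    by (simp_all add: poly_cpoly_num_poly poly_cpoly_avg_poly k_def h_def)
  assume "\<not> ?thesis"
  then have \<zeta>: "Im (k / h) > 0" unfolding kh by simp
  define \<zeta> where "\<zeta> = k / h"
  have h0: "h \<noteq> 0" unfolding h_def
    by (rule stable_family_nonzero[OF stable_family_mixed_char[OF fin] subset_refl]) (use sym x in auto)
  have symB: "?B i j = cnj (?B j i)" for i j using sym[of i j] by (simp add: bordered_def)
  have finU: "finite (insert o' V)" using fin by simp
  \<comment> \<open>Every member contains \<open>o'\<close> with the fixed variable \<zeta>. As a
    family over \<open>V\<close> it can be convolved as before, with the extra vertex always on the
    side of Z - A.\<close>
  define M where "M W z = dminor ?B (insert o' W) (z(o' := \<zeta>))" for W z
  have aff: "affine_family V M"
    unfolding affine_family_def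
  proof (intro allI impI)
    fix W z i t assume W: "W \<subseteq> V" and i: "i \<in> V"
    have ne: "i \<noteq> o'" using i o by auto
    have upd: "(z(i := z i + t))(o' := \<zeta>) = (z(o' := \<zeta>))(i := (z(o' := \<zeta>)) i + t)"
      using ne by (auto simp: fun_eq_iff)
    have sub: "insert o' W \<subseteq> insert o' V" and rem: "insert o' W - {i} = insert o' (W - {i})" using W ne by auto
    show "M W (z(i := z i + t)) = M W z + (if i \<in> W then t * M (W - {i}) z else 0)"
    proof (cases "i \<in> W")
      case True
      then show ?thesis
        using affine_familyD[OF affine_family_dminor[OF finU, of ?B] sub, of i "z(o' := \<zeta>)" t]
        unfolding M_def upd rem by simp
    next
      case False
      then show ?thesis
        using affine_familyD'[OF affine_family_dminor[OF finU, of ?B] sub, of i "z(o' := \<zeta>)" t] i ne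
        unfolding M_def upd by simp
    qed
  qed
  have "stable_family V M"
    unfolding stable_family_def
  proof (intro conjI aff allI impI)
    fix W z assume W: "W \<subseteq> V" and z: "\<forall>i\<in>V. Im (z i) > 0"
    show "M W z \<noteq> 0" unfolding M_def
    proof (rule dminor_nonzero)
      show "finite (insert o' W)" using W fin finite_subset by auto
      show "Im ((z(o' := \<zeta>)) i) > 0" if "i \<in> insert o' W" for i
        using that W z \<zeta> by (auto simp: \<zeta>_def)
    qed (rule symB)
  qed
  then have "stable_family V (\<lambda>W z. conv M (dminor ?A) W z (\<lambda>_. 0))"
    by (rule stable_family_conv[OF _ stable_family_dminor fin]) (use fin sym in auto)
  then have nz: "conv M (dminor ?A) V (\<lambda>_. x) (\<lambda>_. 0) \<noteq> 0"
    by (rule stable_family_nonzero) (use x in auto)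
  have M: "M S (\<lambda>_. x) = dminor ?B (insert o' S) ((\<lambda>_. x)(o' := 0)) + \<zeta> * dminor (\<lambda>i j. - ?A i j) S (\<lambda>_. x)"
    if S: "S \<in> Pow V" for S
  proof -
    have oS: "o' \<notin> S" using S o by auto
    have "M S (\<lambda>_. x) = dminor ?B (insert o' S) (((\<lambda>_. x)(o' := 0))(o' := ((\<lambda>_. x)(o' := 0)) o' + \<zeta>))"
      by (simp add: M_def)
    also have "\<dots> = dminor ?B (insert o' S) ((\<lambda>_. x)(o' := 0)) + \<zeta> * dminor ?B (insert o' S - {o'}) ((\<lambda>_. x)(o' := 0))"
      by (rule affine_familyD[OF affine_family_dminor[OF finU]]) (use S in auto)
    also have "insert o' S - {o'} = S" using oS by auto
    also have "dminor ?B S ((\<lambda>_. x)(o' := 0)) = dminor (\<lambda>i j. - ?A i j) S (\<lambda>_. x)"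
      by (rule dminor_cong) (use oS in \<open>auto simp: bordered_def\<close>)
    finally show ?thesis .
  qed
  have "conv M (dminor ?A) V (\<lambda>_. x) (\<lambda>_. 0) = - k + \<zeta> * h"
    unfolding conv_def k_def h_def mixed_num_def mixed_char_def
    by (simp add: M distrib_right sum.distrib sum_distrib_left mult.assoc dminor_def[of ?A]
        del: Pow_iff fun_upd_apply cong: sum.cong)
  also have "\<dots> = 0" using h0 by (simp add: \<zeta>_def)
  finally show False using nz by simp
qed

lemma num_poly_partial_fractions:
  fixes A :: "nat \<Rightarrow> nat \<Rightarrow> real"
  assumes fin: "finite V" and o: "o' \<notin> V" and sym: "\<And>i j. A i j = A j i"
  shows "\<exists>w. (\<forall>l. w l \<ge> 0) \<and> (\<forall>x. mixed_char A V (\<lambda>_. x) \<noteq> 0 \<longrightarrow>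
     mixed_num o' A v V (\<lambda>_. x) = mixed_char A V (\<lambda>_. x) * (\<Sum>l | mixed_char A V (\<lambda>_. l) = 0. w l / (x - l)))"
proof -
  have h: "avg_poly A [] V \<noteq> 0" "degree (avg_poly A [] V) = card V"
    using monic_degD[OF monic_deg_avg_poly[OF fin]] by auto
  have "num_poly o' A v V = 0 \<or> degree (num_poly o' A v V) < degree (avg_poly A [] V)"
    unfolding h(2) using coeff_num_poly[OF fin o] by (metis leading_coeff_0_iff not_le)
  then show ?thesis
    using partial_fractions[OF upper_stable_avg_poly[OF fin] h(1) _ num_poly_im[OF fin o sym]] sym
    by (simp add: poly_avg_poly poly_num_poly)
qed

section \<open>Expansion of the Cauchy transform at infinity\<close>

lemma card_split: "finite V \<Longrightarrow> S \<subseteq> V \<Longrightarrow> card V = card S + card (V - S)"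
  by (simp add: card_Diff_subset card_mono finite_subset)

abbreviation eps_mat :: "(nat \<Rightarrow> nat \<Rightarrow> real) \<Rightarrow> nat \<Rightarrow> nat \<Rightarrow> real fps" where
  "eps_mat A \<equiv> \<lambda>i j. fps_X * fps_const (A i j)"

lemma pminor_smult: "finite S \<Longrightarrow> pminor S (\<lambda>i j. c * A i j) = c ^ card S * pminor S A"
  using pminor_scale[of S "\<lambda>_. c" A "\<lambda>_. 1"] by simp

lemma mixed_char_scale:
  fixes A :: "nat \<Rightarrow> nat \<Rightarrow> real"
  assumes fin: "finite V" and e: "e \<noteq> 0"
  shows "mixed_char (\<lambda>i j. e * A i j) V (\<lambda>_. 1) = e ^ card V * mixed_char A V (\<lambda>_. 1 / e)"
  unfolding mixed_char_def sum_distrib_left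
proof (rule sum.cong[OF refl])
  fix S assume S: "S \<in> Pow V"
  then have fS: "finite S" "finite (V - S)" and c: "card V = card S + card (V - S)"
    using fin finite_subset card_split[OF fin] by auto
  have "dminor (\<lambda>i j. - (e * A i j)) S (\<lambda>_. 1) = pminor S (\<lambda>i j. e * ((if i = j then 1 / e else 0) + - A i j))"
    unfolding dminor_def by (rule pminor_cong) (use e in \<open>auto simp: algebra_simps\<close>)
  then show "dminor (\<lambda>i j. - (e * A i j)) S (\<lambda>_. 1) * pminor (V - S) (\<lambda>i j. e * A i j)
     = e ^ card V * (dminor (\<lambda>i j. - A i j) S (\<lambda>_. 1 / e) * pminor (V - S) A)"
    unfolding c by (simp add: pminor_smult fS dminor_def power_add)
qed

lemma mixed_num_scale:
  fixes A :: "nat \<Rightarrow> nat \<Rightarrow> real"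
  assumes fin: "finite V" and e: "e \<noteq> 0" and o: "o' \<notin> V"
  shows "e * mixed_num o' (\<lambda>i j. e * A i j) v V (\<lambda>_. 1) = e ^ card V * mixed_num o' A v V (\<lambda>_. 1 / e)"
proof -
  have "e * (dminor (bordered o' (\<lambda>i j. e * A i j) v) (insert o' S) ((\<lambda>_. 1)(o' := 0)) * pminor (V - S) (\<lambda>i j. e * A i j))
     = e ^ card V * (dminor (bordered o' A v) (insert o' S) ((\<lambda>_. 1 / e)(o' := 0)) * pminor (V - S) A)"
    if S: "S \<in> Pow V" for S
  proof -
    have fS: "finite S" "finite (V - S)" and c: "card V = card S + card (V - S)" and oS: "o' \<notin> S"
      using S fin finite_subset o card_split[OF fin] by auto
    \<comment> \<open>Rows in \<open>S\<close> are multiplied by \<open>e\<close> and the column of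
      \<open>o'\<close> by \<open>1 / e\<close>, so the border \<open>v\<close> keeps its value. The
      factor \<open>1 / e\<close> reflects that the numerator has degree one less.\<close>
    define r where "r i = (if i = o' then 1 else e)" for i
    define q where "q i = (if i = o' then 1 / e else 1)" for i
    have "dminor (bordered o' (\<lambda>i j. e * A i j) v) (insert o' S) ((\<lambda>_. 1)(o' := 0))
      = pminor (insert o' S) (\<lambda>i j. r i * ((if i = j then ((\<lambda>_. 1 / e)(o' := 0)) i else 0) + bordered o' A v i j) * q j)"
      unfolding dminor_def by (rule pminor_cong) (use e in \<open>auto simp: r_def q_def bordered_def algebra_simps\<close>)
    also have "\<dots> = (\<Prod>i\<in>insert o' S. r i) * (\<Prod>i\<in>insert o' S. q i) * dminor (bordered o' A v) (insert o' S) ((\<lambda>_. 1 / e)(o' := 0))"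
      unfolding pminor_scale dminor_def ..
    also have "(\<Prod>i\<in>insert o' S. r i) = e ^ card S"
    proof -
      have "(\<Prod>i\<in>S. r i) = (\<Prod>i\<in>S. e)" by (rule prod.cong) (use oS in \<open>auto simp: r_def\<close>)
      then show ?thesis using fS oS by (simp add: r_def)
    qed
    also have "(\<Prod>i\<in>insert o' S. q i) = 1 / e"
    proof -
      have "(\<Prod>i\<in>S. q i) = (\<Prod>i\<in>S. 1)" by (rule prod.cong) (use oS in \<open>auto simp: q_def\<close>)
      then show ?thesis using fS oS by (simp add: q_def)
    qed
    finally have m: "dminor (bordered o' (\<lambda>i j. e * A i j) v) (insert o' S) ((\<lambda>_. 1)(o' := 0))
      = e ^ card S * (1 / e) * dminor (bordered o' A v) (insert o' S) ((\<lambda>_. 1 / e)(o' := 0))" .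
    show ?thesis unfolding c m pminor_smult[OF fS(2)] using e by (simp add: power_add del: fun_upd_apply)
  qed
  then show ?thesis
    unfolding mixed_num_def mult_minus_right sum_distrib_left by (intro arg_cong[of _ _ uminus] sum.cong refl)
qed

text \<open>Partial fractions hold away from the roots. With x = 1/e and cleared denominators they
  become an identity of polynomials in e valid at all but finitely many points, hence everywhere,
  and it can be read among power series, where 1/(1 - l e) is a geometric series.\<close>

lemma mixed_num_fps:
  fixes A :: "nat \<Rightarrow> nat \<Rightarrow> real"
  assumes fin: "finite V" and o: "o' \<notin> V" and sym: "\<And>i j. A i j = A j i"
  shows "\<exists>w. (\<forall>l. w l \<ge> 0) \<and>
    mixed_num o' (eps_mat A) (\<lambda>i. fps_const (v i)) V (\<lambda>_. 1)
    = mixed_char (eps_mat A) V (\<lambda>_. 1) * Abs_fps (\<lambda>n. \<Sum>l | mixed_char A V (\<lambda>_. l) = 0. w l * l ^ n)"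
proof -
  define L where "L = {l. mixed_char A V (\<lambda>_. l) = 0}"
  obtain w where w: "\<And>l. w l \<ge> 0" and eq: "\<And>x. mixed_char A V (\<lambda>_. x) \<noteq> 0 \<Longrightarrow>
     mixed_num o' A v V (\<lambda>_. x) = mixed_char A V (\<lambda>_. x) * (\<Sum>l\<in>L. w l / (x - l))"
    using num_poly_partial_fractions[of V o' A v, OF fin o sym] unfolding L_def by blast
  have L: "L = {x. poly (avg_poly A [] V) x = 0}" by (simp add: L_def poly_avg_poly)
  have finL: "finite L"
    unfolding L using monic_degD[OF monic_deg_avg_poly[OF fin]] by (intro poly_roots_finite) auto
  \<comment> \<open>The reversed polynomials in \<open>e\<close> of denominator and numerator;
    \<open>B\<close> is the product of all 1 - l e, and \<open>C l\<close> omits one factor.\<close>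
  define H where "H = mixed_char (\<lambda>i j. [:0, 1:] * [:A i j:]) V (\<lambda>_. 1)"
  define K where "K = mixed_num o' (\<lambda>i j. [:0, 1:] * [:A i j:]) (\<lambda>i. [:v i:]) V (\<lambda>_. 1)"
  have pe: "comm_ring_hom (\<lambda>p. poly p x)" for x :: real by unfold_locales auto
  have H: "poly H e = mixed_char (\<lambda>i j. e * A i j) V (\<lambda>_. 1)" for e
    unfolding H_def by (subst comm_ring_hom.hom_mixed_char[OF pe]) simp
  have K: "poly K e = mixed_num o' (\<lambda>i j. e * A i j) v V (\<lambda>_. 1)" for e
    unfolding K_def by (subst comm_ring_hom.hom_mixed_num[OF pe]) simp
  define B where "B = (\<Prod>l\<in>L. [:1, - l:])"
  define C where "C l = (\<Prod>m\<in>L - {l}. [:1, - m:])" for l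
  have BC: "B = [:1, - l:] * C l" if "l \<in> L" for l
    unfolding B_def C_def by (rule prod.remove[OF finL that])
  have B0: "B \<noteq> 0" unfolding B_def using finL by simp
  have H0: "H \<noteq> 0"
  proof
    assume "H = 0"
    then have "poly H 0 = 0" by simp
    moreover have "poly H 0 = 1"
    proof -
      have "poly H 0 = (\<Sum>S\<in>Pow V. if S = V then 1 else 0)"
        unfolding H mixed_char_def
      proof (rule sum.cong[OF refl])
        fix S assume S: "S \<in> Pow V"
        then have "finite S" "finite (V - S)" using fin finite_subset by auto
        then show "dminor (\<lambda>i j. - (0 * A i j)) S (\<lambda>_. 1) * pminor (V - S) (\<lambda>i j. 0 * A i j) = (if S = V then 1 else 0)"
          using S pminor_smult[of "V - S" 0 A] by (auto simp: dminor_def pminor_diag card_gt_0_iff)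
      qed
      then show ?thesis using fin by simp
    qed
    ultimately show False by simp
  qed
  define P where "P = K * B - H * (\<Sum>l\<in>L. smult (w l) (C l))"
  have "poly P e = 0" if e: "e \<noteq> 0" "poly H e \<noteq> 0" "poly B e \<noteq> 0" for e
  proof -
    have hx: "mixed_char A V (\<lambda>_. 1 / e) \<noteq> 0" using e(2) mixed_char_scale[OF fin e(1), of A] by (simp add: H)
    have "e * poly K e = e ^ card V * mixed_num o' A v V (\<lambda>_. 1 / e)"
      unfolding K by (rule mixed_num_scale[OF fin e(1) o])
    also have "\<dots> = poly H e * (\<Sum>l\<in>L. w l / (1 / e - l))"
      unfolding H mixed_char_scale[OF fin e(1)] eq[OF hx] by simp
    finally have *: "e * poly K e = poly H e * (\<Sum>l\<in>L. w l / (1 / e - l))" .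
    have **: "(\<Sum>l\<in>L. w l / (1 / e - l)) * poly B e = e * (\<Sum>l\<in>L. w l * poly (C l) e)"
      unfolding sum_distrib_right sum_distrib_left
    proof (rule sum.cong[OF refl])
      fix l assume l: "l \<in> L"
      have b: "poly B e = (1 - e * l) * poly (C l) e" unfolding BC[OF l] by (simp add: algebra_simps)
      then have "1 - e * l \<noteq> 0" using e(3) by auto
      moreover have "1 / e - l = (1 - e * l) / e" using e(1) by (simp add: field_simps)
      ultimately show "w l / (1 / e - l) * poly B e = e * (w l * poly (C l) e)" unfolding b by simp
    qed
    have "e * poly P e = (e * poly K e) * poly B e - poly H e * (e * (\<Sum>l\<in>L. w l * poly (C l) e))"
      by (simp add: P_def poly_sum algebra_simps)
    also have "\<dots> = 0"
      unfolding * ** [symmetric] by (simp add: mult.assoc)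
    finally show ?thesis using e(1) by simp
  qed
  then have sub: "UNIV - ({0} \<union> {x. poly H x = 0} \<union> {x. poly B x = 0}) \<subseteq> {x. poly P x = 0}" by auto
  have "P = 0"
  proof (rule ccontr)
    assume "P \<noteq> 0"
    then have "finite {x. poly P x = 0}" by (rule poly_roots_finite)
    then have "finite (UNIV - ({0} \<union> {x. poly H x = 0} \<union> {x. poly B x = 0}))"
      using sub finite_subset by blast
    moreover have "finite ({0} \<union> {x. poly H x = 0} \<union> {x. poly B x = 0})"
      using poly_roots_finite[OF H0] poly_roots_finite[OF B0] by simp
    ultimately have "finite (UNIV :: real set)" by (metis Diff_infinite_finite)
    then show False using infinite_UNIV_char_0 by blast
  qed
  then have KB: "K * B = H * (\<Sum>l\<in>L. smult (w l) (C l))" by (simp add: P_def)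
  interpret f: comm_ring_hom "fps_of_poly :: real poly \<Rightarrow> real fps"
    by unfold_locales (auto simp: fps_of_poly_add fps_of_poly_mult)
  let ?A = "eps_mat A"
  have fH: "fps_of_poly H = mixed_char ?A V (\<lambda>_. 1)"
    unfolding H_def by (subst f.hom_mixed_char) (simp add: fps_of_poly_mult fps_of_poly_pCons fps_of_poly_const mult.commute)
  have fK: "fps_of_poly K = mixed_num o' ?A (\<lambda>i. fps_const (v i)) V (\<lambda>_. 1)"
    unfolding K_def by (subst f.hom_mixed_num) (simp add: fps_of_poly_mult fps_of_poly_pCons fps_of_poly_const mult.commute)
  define g where "g l = Abs_fps (\<lambda>n. l ^ n :: real)" for l
  have g: "fps_of_poly [:1, - l:] * g l = 1" for l
  proof -
    have "fps_of_poly [:1, - l:] = 1 - fps_const l * fps_X"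
      by (simp add: fps_of_poly_pCons fps_of_poly_const flip: fps_const_neg)
    moreover have "(1 - fps_const l * fps_X) * g l = 1"
      by (rule fps_ext) (auto simp: g_def left_diff_distrib mult.assoc fps_X_mult_nth nat_neq_iff power_eq_if)
    ultimately show ?thesis by (simp only:)
  qed
  have "fps_of_poly B * fps_of_poly K = fps_of_poly H * (\<Sum>l\<in>L. fps_const (w l) * fps_of_poly (C l))"
    using arg_cong[OF KB, of fps_of_poly]
    by (simp add: fps_of_poly_mult fps_of_poly_sum fps_of_poly_smult mult.commute)
  also have "(\<Sum>l\<in>L. fps_const (w l) * fps_of_poly (C l)) = (\<Sum>l\<in>L. fps_of_poly B * (fps_const (w l) * g l))"
  proof (rule sum.cong[OF refl])
    fix l assume l: "l \<in> L"
    have "fps_of_poly B * (fps_const (w l) * g l) = (fps_of_poly [:1, - l:] * g l) * (fps_const (w l) * fps_of_poly (C l))"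
      unfolding BC[OF l] fps_of_poly_mult by (simp only: mult_ac)
    then show "fps_const (w l) * fps_of_poly (C l) = fps_of_poly B * (fps_const (w l) * g l)" unfolding g by (simp only: mult_1_left)
  qed
  also have "fps_of_poly H * \<dots> = fps_of_poly B * (fps_of_poly H * (\<Sum>l\<in>L. fps_const (w l) * g l))"
    by (simp add: sum_distrib_left mult_ac)
  finally have "fps_of_poly K = fps_of_poly H * (\<Sum>l\<in>L. fps_const (w l) * g l)"
    using B0 by simp
  moreover have "(\<Sum>l\<in>L. fps_const (w l) * g l) = Abs_fps (\<lambda>n. \<Sum>l\<in>L. w l * l ^ n)"
    by (rule fps_ext) (simp add: fps_sum_nth g_def)
  ultimately show ?thesis using w unfolding fH fK L_def by auto
qed

section \<open>Moments of the spectral measure\<close>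

definition csets :: "nat set \<Rightarrow> nat \<Rightarrow> nat set set" where
  "csets V m = {U. U \<subseteq> V \<and> card U = m}"

lemma finite_csets [simp]: "finite V \<Longrightarrow> finite (csets V m)"
  unfolding csets_def by (rule finite_subset[of _ "Pow V"]) auto

lemma csets_0: "finite V \<Longrightarrow> csets V 0 = {{}}"
  unfolding csets_def using finite_subset by fastforce

lemma csets_self: "finite U \<Longrightarrow> csets U (card U) = {U}"
  unfolding csets_def using card_subset_eq by blast

lemma fps_nth_graded_sum:
  fixes a :: "nat set \<Rightarrow> real"
  assumes fin: "finite V"
  shows "fps_nth (\<Sum>U\<in>Pow V. fps_X ^ card U * fps_const (a U) * F U) j
    = (\<Sum>m\<le>j. \<Sum>U\<in>csets V m. a U * fps_nth (F U) (j - m))" (is "?L = _")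
proof -
  have "?L
    = (\<Sum>U\<in>Pow V. if card U \<le> j then a U * fps_nth (F U) (j - card U) else 0)"
    by (simp add: fps_sum_nth mult.assoc fps_X_power_mult_nth not_le cong: if_cong) (rule sum.cong, auto)
  also have "\<dots> = (\<Sum>U\<in>{U\<in>Pow V. card U \<le> j}. a U * fps_nth (F U) (j - card U))"
    by (rule sum.inter_filter[symmetric]) (use fin in simp)
  also have "\<dots> = (\<Sum>m\<in>{..j}. \<Sum>U\<in>{U\<in>{U\<in>Pow V. card U \<le> j}. card U = m}. a U * fps_nth (F U) (j - card U))"
    by (rule sum.group[symmetric]) (use fin in auto)
  also have "\<dots> = (\<Sum>m\<le>j. \<Sum>U\<in>csets V m. a U * fps_nth (F U) (j - m))"
    by (intro sum.cong) (auto simp: csets_def)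
  finally show ?thesis .
qed

lemma sum_csets_2:
  fixes g :: "nat set \<Rightarrow> real"
  assumes "finite V"
  shows "2 * (\<Sum>U\<in>csets V 2. g U) = (\<Sum>i\<in>V. \<Sum>j\<in>V. if i \<noteq> j then g {i, j} else 0)"
  using assms
proof (induct rule: finite_induct)
  case empty
  have "csets {} 2 = {}" by (auto simp: csets_def)
  then show ?case by simp
next
  case (insert x F)
  have e: "csets (insert x F) 2 = csets F 2 \<union> (\<lambda>y. {x, y}) ` F"
  proof (rule equalityI; rule subsetI)
    fix U assume "U \<in> csets (insert x F) 2"
    then have U: "U \<subseteq> insert x F" "card U = 2" by (auto simp: csets_def)
    then obtain a b where ab: "U = {a, b}" "a \<noteq> b" by (meson card_2_iff)
    show "U \<in> csets F 2 \<union> (\<lambda>y. {x, y}) ` F"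
      using U ab by (cases "x \<in> U") (auto simp: csets_def insert_commute)
  qed (use insert in \<open>auto simp: csets_def card_insert_if\<close>)
  have inj: "inj_on (\<lambda>y. {x, y}) F" using insert by (auto simp: inj_on_def doubleton_eq_iff)
  have "(\<Sum>U\<in>csets (insert x F) 2. g U) = (\<Sum>U\<in>csets F 2. g U) + (\<Sum>y\<in>F. g {x, y})"
    unfolding e using insert by (subst sum.union_disjoint) (auto simp: csets_def sum.reindex[OF inj])
  moreover have "(\<Sum>j\<in>F. if x \<noteq> j then g {x, j} else 0) = (\<Sum>y\<in>F. g {x, y})"
    "(\<Sum>i\<in>F. if i \<noteq> x then g {i, x} else 0) = (\<Sum>y\<in>F. g {x, y})"
    using insert by (auto intro!: sum.cong simp: insert_commute)
  ultimately show ?case using insert by (simp add: sum.distrib)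
qed

fun walk_vec :: "(nat \<Rightarrow> nat \<Rightarrow> real) \<Rightarrow> nat set \<Rightarrow> (nat \<Rightarrow> real) \<Rightarrow> nat \<Rightarrow> nat \<Rightarrow> real" where
  "walk_vec A W b 0 k = b k"
| "walk_vec A W b (Suc l) k = (\<Sum>m\<in>W. A k m * walk_vec A W b l m)"

text \<open>The series b^T (I - X A[W])^(-1) b, with the resolvent written as its Neumann
  series.\<close>

definition walks :: "(nat \<Rightarrow> nat \<Rightarrow> real) \<Rightarrow> nat set \<Rightarrow> (nat \<Rightarrow> real) \<Rightarrow> real fps" where
  "walks A W b = Abs_fps (\<lambda>l. \<Sum>k\<in>W. b k * walk_vec A W b l k)"

text \<open>In the variable \<open>fps_X\<close> standing for \<open>1 / x\<close>.\<close>

definition rev_char :: "(nat \<Rightarrow> nat \<Rightarrow> real) \<Rightarrow> nat set \<Rightarrow> real fps" where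
  "rev_char A W = dminor (\<lambda>i j. - (fps_X * fps_const (A i j))) W (\<lambda>_. 1)"

text \<open>Supplies the solution that \<open>pminor_schur\<close> asks for: the Neumann sum
  telescopes when multiplied by I - X A.\<close>

lemma resolvent_fps:
  assumes "finite W" "j \<in> W"
  shows "(\<Sum>k\<in>W. ((if j = k then 1 else 0) + - (fps_X * fps_const (A j k))) * Abs_fps (\<lambda>l. walk_vec A W b l k))
    = fps_const (b j)"
proof (rule fps_ext)
  fix n
  let ?T = "\<lambda>k. ((if j = k then 1 else 0) + - (fps_X * fps_const (A j k))) * Abs_fps (\<lambda>l. walk_vec A W b l k)"
  have t: "fps_nth (?T k) n
    = (if j = k then walk_vec A W b n k else 0) - (if n = 0 then 0 else A j k * walk_vec A W b (n - 1) k)" for k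
    by (simp add: distrib_right mult.assoc left_diff_distrib)
  have "fps_nth (\<Sum>k\<in>W. ?T k) n
    = walk_vec A W b n j - (\<Sum>k\<in>W. if n = 0 then 0 else A j k * walk_vec A W b (n - 1) k)"
    unfolding fps_sum_nth t sum_subtractf using assms by (simp add: sum.delta)
  also have "\<dots> = fps_nth (fps_const (b j)) n" by (cases n) auto
  finally show "fps_nth (\<Sum>k\<in>W. ?T k) n
    = fps_nth (fps_const (b j)) n" .
qed

lemma walks_sum: "(\<Sum>k\<in>W. fps_const (b k) * Abs_fps (\<lambda>l. walk_vec A W b l k)) = walks A W b"
  by (rule fps_ext) (simp add: walks_def fps_sum_nth)

text \<open>The Schur complement at \<open>i\<close>: one factor \<open>fps_X\<close> for each of
  the two border entries, and between them a walk inside \<open>W\<close> from a neighbour of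
  \<open>i\<close> to a neighbour of \<open>i\<close>.\<close>

lemma rev_char_insert:
  assumes "finite W" "i \<notin> W" and sym: "\<And>i j. A i j = A j i" and dg: "A i i = 0"
  shows "rev_char A (insert i W) = (1 - fps_X\<^sup>2 * walks A W (A i)) * rev_char A W"
proof -
  let ?M = "\<lambda>a b. (if a = b then 1 else 0) + - (fps_X * fps_const (A a b))"
  let ?Y = "\<lambda>k. Abs_fps (\<lambda>l. walk_vec A W (A i) l k)"
  have ne: "i \<noteq> k" if "k \<in> W" for k using that assms(2) by auto
  have "(\<Sum>k\<in>W. ?M j k * (- (fps_X * ?Y k))) = ?M j i" if j: "j \<in> W" for j
  proof -
    have "(\<Sum>k\<in>W. ?M j k * (- (fps_X * ?Y k))) = - (fps_X * (\<Sum>k\<in>W. ?M j k * ?Y k))"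
      by (simp add: sum_distrib_left sum_negf mult_ac)
    also have "\<dots> = ?M j i" unfolding resolvent_fps[OF assms(1) j] using ne[OF j] sym by auto
    finally show ?thesis .
  qed
  then have "pminor (insert i W) ?M = (?M i i - (\<Sum>k\<in>W. ?M i k * (- (fps_X * ?Y k)))) * pminor W ?M"
    by (rule pminor_schur[OF assms(1,2)])
  moreover have "(\<Sum>k\<in>W. ?M i k * (- (fps_X * ?Y k))) = fps_X\<^sup>2 * walks A W (A i)"
    unfolding walks_sum[symmetric] sum_distrib_left
    by (rule sum.cong) (use ne in \<open>auto simp: power2_eq_square mult_ac\<close>)
  ultimately show ?thesis by (simp add: rev_char_def dminor_def dg)
qed

lemma pminor_bordered:
  assumes "finite S" "o' \<notin> S"
  shows "dminor (bordered o' (eps_mat A) (\<lambda>i. fps_const (v i))) (insert o' S) ((\<lambda>_. 1)(o' := 0))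
    = - (walks A S v * rev_char A S)"
proof -
  let ?z = "(\<lambda>_. 1)(o' := 0) :: nat \<Rightarrow> real fps"
  let ?M = "\<lambda>a b. (if a = b then ?z a else 0) + bordered o' (eps_mat A) (\<lambda>i. fps_const (v i)) a b"
  let ?N = "\<lambda>a b. (if a = b then 1 else 0) + - (fps_X * fps_const (A a b))"
  let ?Y = "\<lambda>k. Abs_fps (\<lambda>l. walk_vec A S v l k)"
  have ne: "k \<noteq> o'" if "k \<in> S" for k using that assms(2) by auto
  have MN: "?M a b = ?N a b" if "a \<in> S" "b \<in> S" for a b using ne[OF that(1)] ne[OF that(2)] by (simp add: bordered_def)
  have "(\<Sum>k\<in>S. ?M j k * ?Y k) = ?M j o'" if j: "j \<in> S" for j
  proof -
    have "(\<Sum>k\<in>S. ?M j k * ?Y k) = (\<Sum>k\<in>S. ?N j k * ?Y k)" by (rule sum.cong[OF refl]) (simp only: MN[OF j])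
    also have "\<dots> = ?M j o'" unfolding resolvent_fps[OF assms(1) j] using ne[OF j] by (simp add: bordered_def)
    finally show ?thesis .
  qed
  then have "pminor (insert o' S) ?M = (?M o' o' - (\<Sum>k\<in>S. ?M o' k * ?Y k)) * pminor S ?M"
    by (rule pminor_schur[OF assms])
  moreover have "(\<Sum>k\<in>S. ?M o' k * ?Y k) = walks A S v"
    unfolding walks_sum[symmetric] by (rule sum.cong) (use ne in \<open>auto simp: bordered_def\<close>)
  moreover have "pminor S ?M = rev_char A S" unfolding rev_char_def dminor_def by (rule pminor_cong) (rule MN)
  ultimately show ?thesis by (simp add: dminor_def bordered_def)
qed

lemma pminor_fps:
  fixes A :: "nat \<Rightarrow> nat \<Rightarrow> real"
  assumes "finite U"
  shows "pminor U (eps_mat A) = fps_X ^ card U * fps_const (pminor U A)"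
proof -
  interpret c: comm_ring_hom "fps_const :: real \<Rightarrow> real fps" by unfold_locales auto
  show ?thesis unfolding pminor_smult[OF \<open>finite U\<close>] c.hom_pminor ..
qed

text \<open>Summing over the complement \<open>U\<close> exposes the power \<open>card U\<close> of
  \<open>fps_X\<close>, so low coefficients involve only small \<open>U\<close>.\<close>

lemma mixed_char_graded:
  assumes fin: "finite V"
  shows "mixed_char (eps_mat A) V (\<lambda>_. 1)
    = (\<Sum>U\<in>Pow V. fps_X ^ card U * fps_const (pminor U A) * rev_char A (V - U))"
  unfolding mixed_char_def rev_char_def[symmetric]
  by (rule sum.reindex_bij_witness[of _ "\<lambda>S. V - S" "\<lambda>S. V - S"])
     (use fin in \<open>auto simp: double_diff pminor_fps mult_ac\<close>)

lemma mixed_num_graded: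
  assumes fin: "finite V" and o: "o' \<notin> V"
  shows "mixed_num o' (eps_mat A) (\<lambda>i. fps_const (v i)) V (\<lambda>_. 1)
    = (\<Sum>U\<in>Pow V. fps_X ^ card U * fps_const (pminor U A) * (walks A (V - U) v * rev_char A (V - U)))" (is "?L = _")
proof -
  have "?L
    = (\<Sum>S\<in>Pow V. (walks A S v * rev_char A S) * pminor (V - S) (eps_mat A))"
    unfolding mixed_num_def sum_negf[symmetric]
  proof (rule sum.cong[OF refl])
    fix S assume "S \<in> Pow V"
    then have S: "finite S" "o' \<notin> S" using fin o finite_subset by auto
    show "- (dminor (bordered o' (eps_mat A) (\<lambda>i. fps_const (v i))) (insert o' S) ((\<lambda>_. 1)(o' := 0))
        * pminor (V - S) (eps_mat A))
      = (walks A S v * rev_char A S) * pminor (V - S) (eps_mat A)"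
      unfolding pminor_bordered[OF S] by simp
  qed
  also have "\<dots> = (\<Sum>U\<in>Pow V. fps_X ^ card U * fps_const (pminor U A) * (walks A (V - U) v * rev_char A (V - U)))"
    by (rule sum.reindex_bij_witness[of _ "\<lambda>S. V - S" "\<lambda>S. V - S"])
       (use fin in \<open>auto simp: double_diff pminor_fps mult_ac\<close>)
  finally show ?thesis .
qed

lemma rev_char_nth:
  assumes fin: "finite W"
  shows "fps_nth (rev_char A W) j = (-1) ^ j * (\<Sum>U\<in>csets W j. pminor U A)"
proof -
  have "rev_char A W = (\<Sum>T\<in>Pow W. pminor (W - T) (\<lambda>i j. - (fps_X * fps_const (A i j))))"
    unfolding rev_char_def by (subst dminor_expand[OF fin]) simp
  also have "\<dots> = (\<Sum>U\<in>Pow W. pminor U (\<lambda>i j. fps_X * fps_const (- A i j)))"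
    by (rule sum.reindex_bij_witness[of _ "\<lambda>S. W - S" "\<lambda>S. W - S"])
       (auto simp: double_diff simp flip: fps_const_neg)
  also have "\<dots> = (\<Sum>U\<in>Pow W. fps_X ^ card U * fps_const ((-1) ^ card U * pminor U A) * 1)"
  proof (rule sum.cong[OF refl])
    fix U assume "U \<in> Pow W"
    then have "finite U" using fin finite_subset by auto
    then show "pminor U (\<lambda>i j. fps_X * fps_const (- A i j)) = fps_X ^ card U * fps_const ((-1) ^ card U * pminor U A) * 1"
      using pminor_smult[of U "-1" A] by (simp add: pminor_fps)
  qed
  finally have "fps_nth (rev_char A W) j = (\<Sum>m\<le>j. \<Sum>U\<in>csets W m. ((-1) ^ card U * pminor U A) * fps_nth 1 (j - m))"
    using fps_nth_graded_sum[OF fin, of "\<lambda>U. (-1) ^ card U * pminor U A" "\<lambda>_. 1" j] by simp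
  also have "\<dots> = (\<Sum>m\<le>j. if m = j then (-1) ^ j * (\<Sum>U\<in>csets W j. pminor U A) else 0)"
    by (rule sum.cong) (auto simp: sum_distrib_left csets_def)
  finally show ?thesis by simp
qed

lemma sum_4_terms: "(\<Sum>m\<le>(4::nat). f m) = f 0 + f 1 + f 2 + f 3 + (f 4 :: real)"
  "(\<Sum>m\<le>(3::nat). f m) = f 0 + f 1 + f 2 + f 3" "(\<Sum>m\<le>(2::nat). f m) = f 0 + f 1 + f 2"
  "(\<Sum>m\<le>(1::nat). f m) = f 0 + f 1"
  by (simp_all add: eval_nat_numeral)

lemma fps_mult_nths: fixes f g :: "real fps"
  shows "fps_nth (f * g) 1 = fps_nth f 0 * fps_nth g 1 + fps_nth f 1 * fps_nth g 0"
  "fps_nth (f * g) 2 = fps_nth f 0 * fps_nth g 2 + fps_nth f 1 * fps_nth g 1 + fps_nth f 2 * fps_nth g 0"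
  "fps_nth (f * g) 3 = fps_nth f 0 * fps_nth g 3 + fps_nth f 1 * fps_nth g 2 + fps_nth f 2 * fps_nth g 1 + fps_nth f 3 * fps_nth g 0"
  "fps_nth (f * g) 4 = fps_nth f 0 * fps_nth g 4 + fps_nth f 1 * fps_nth g 3 + fps_nth f 2 * fps_nth g 2
     + fps_nth f 3 * fps_nth g 1 + fps_nth f 4 * fps_nth g 0"
  by (simp_all add: fps_mult_nth atLeast0AtMost sum_4_terms)

lemma walks_nth_2:
  assumes sym: "\<And>i j. A i j = A j i"
  shows "fps_nth (walks A W b) 2 = (\<Sum>m\<in>W. (\<Sum>l\<in>W. A m l * b l)\<^sup>2)"
proof -
  have "fps_nth (walks A W b) 2 = (\<Sum>k\<in>W. \<Sum>m\<in>W. b k * (A k m * (\<Sum>l\<in>W. A m l * b l)))"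
    by (simp add: walks_def eval_nat_numeral sum_distrib_left)
  also have "\<dots> = (\<Sum>m\<in>W. \<Sum>k\<in>W. b k * (A k m * (\<Sum>l\<in>W. A m l * b l)))" by (rule sum.swap)
  also have "\<dots> = (\<Sum>m\<in>W. (\<Sum>l\<in>W. A m l * b l)\<^sup>2)"
  proof (rule sum.cong[OF refl])
    fix m
    have "(\<Sum>k\<in>W. b k * (A k m * (\<Sum>l\<in>W. A m l * b l))) = (\<Sum>k\<in>W. A m k * b k) * (\<Sum>l\<in>W. A m l * b l)"
      unfolding sum_distrib_right by (rule sum.cong) (auto simp: sym[of m] mult_ac)
    then show "(\<Sum>k\<in>W. b k * (A k m * (\<Sum>l\<in>W. A m l * b l))) = (\<Sum>l\<in>W. A m l * b l)\<^sup>2"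
      by (simp add: power2_eq_square)
  qed
  finally show ?thesis .
qed

section \<open>Second and fourth moments for triangle-free regular graphs\<close>

locale triangle_free_matrix =
  fixes A :: "nat \<Rightarrow> nat \<Rightarrow> real"
  assumes sym: "A i j = A j i" and dg: "A i i = 0" and tri: "A i j * A j k * A i k = 0"
begin

text \<open>Adding a vertex \<open>i\<close> changes the coefficient of order 3 through walks of
  length 1 between neighbours of \<open>i\<close>, which would close triangles.\<close>

lemma rev_char_low:
  assumes "finite W"
  shows "fps_nth (rev_char A W) 0 = 1 \<and> fps_nth (rev_char A W) 1 = 0 \<and>
    fps_nth (rev_char A W) 2 = - (\<Sum>i\<in>W. \<Sum>j\<in>W. (A i j)\<^sup>2) / 2 \<and> fps_nth (rev_char A W) 3 = 0"
  using assms
proof (induct rule: finite_induct)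
  case empty
  then show ?case by (simp add: rev_char_def dminor_def)
next
  case (insert i W)
  have D: "rev_char A (insert i W) = rev_char A W - fps_X\<^sup>2 * (walks A W (A i) * rev_char A W)"
    unfolding rev_char_insert[OF insert(1,2) sym dg] by (simp add: algebra_simps)
  have w0: "fps_nth (walks A W (A i)) 0 = (\<Sum>k\<in>W. (A i k)\<^sup>2)" by (simp add: walks_def power2_eq_square)
  have w1: "fps_nth (walks A W (A i)) 1 = 0"
  proof -
    have "A i k * (A k m * A i m) = 0" for k m using tri[of i k m] by simp
    then show ?thesis by (simp add: walks_def sum_distrib_left)
  qed
  have s: "(\<Sum>a\<in>W. (A a i)\<^sup>2) = (\<Sum>k\<in>W. (A i k)\<^sup>2)" by (simp add: sym[of i])
  show ?case
    using insert(3) unfolding D fps_sub_nth fps_X_power_mult_nth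
    by (simp add: fps_mult_nths fps_mult_nth_0 w0 w1[simplified] insert(1,2) sum.distrib dg s field_simps)
qed

text \<open>Converts the known low coefficients into minors of size 1, 2 and 3.\<close>

lemma rev_char_top: "finite U \<Longrightarrow> fps_nth (rev_char A U) (card U) = (-1) ^ card U * pminor U A"
  by (simp add: rev_char_nth csets_self)

lemma pminor_card_1: "card U = 1 \<Longrightarrow> pminor U A = 0"
  using rev_char_top[of U] rev_char_low[of U] card_ge_0_finite[of U] by simp

lemma pminor_card_3: "card U = 3 \<Longrightarrow> pminor U A = 0"
  using rev_char_top[of U] rev_char_low[of U] card_ge_0_finite[of U] by simp

lemma pminor_pair: "i \<noteq> j \<Longrightarrow> pminor {i, j} A = - (A i j)\<^sup>2"
  using rev_char_top[of "{i, j}"] rev_char_low[of "{i, j}"] by (simp add: dg sym[of j i] numeral_2_eq_2)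

end

locale regular_eigen = triangle_free_matrix A for A :: "nat \<Rightarrow> nat \<Rightarrow> real" +
  fixes V :: "nat set" and d lam :: real and v :: "nat \<Rightarrow> real"
  assumes fin: "finite V" and val: "A i j \<in> {-1, 0, 1}"
    and reg: "i \<in> V \<Longrightarrow> (\<Sum>j\<in>V. (A i j)\<^sup>2) = d"
    and eig: "i \<in> V \<Longrightarrow> (\<Sum>j\<in>V. A i j * v j) = lam * v i"
    and unit: "(\<Sum>i\<in>V. (v i)\<^sup>2) = 1"
begin

definition edges where "edges = (\<Sum>i\<in>V. \<Sum>j\<in>V. (A i j)\<^sup>2) / 2"

text \<open>By the zero diagonal, \<open>l = i\<close> contributes nothing, so for \<open>i\<close>
  in \<open>V\<close> the inner sum is the entry (m, i) of the square of the matrix on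
  \<open>V\<close>.\<close>

definition square_walks where "square_walks i = (\<Sum>m\<in>V - {i}. (\<Sum>l\<in>V - {i}. A m l * A i l)\<^sup>2)"

lemma val4: "(A i j)\<^sup>2 * (A i j)\<^sup>2 = (A i j)\<^sup>2"
  using val[of i j] by auto

text \<open>A minor on a pair is minus the squared entry, so only edges count. \<open>G\<close> may
  be any expression that agrees on edges and vanishes elsewhere, chosen so that its double sum is
  computable.\<close>

lemma pair_sum:
  assumes g: "\<And>i j. i \<in> V \<Longrightarrow> j \<in> V \<Longrightarrow> i \<noteq> j \<Longrightarrow> (A i j)\<^sup>2 * g {i, j} = G i j"
    and G: "\<And>i. i \<in> V \<Longrightarrow> G i i = 0"
  shows "(\<Sum>U\<in>csets V 2. pminor U A * g U) = - (\<Sum>i\<in>V. \<Sum>j\<in>V. G i j) / 2"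
proof -
  have "2 * (\<Sum>U\<in>csets V 2. pminor U A * g U) = (\<Sum>i\<in>V. \<Sum>j\<in>V. if i \<noteq> j then pminor {i, j} A * g {i, j} else 0)"
    by (rule sum_csets_2[OF fin])
  also have "\<dots> = (\<Sum>i\<in>V. \<Sum>j\<in>V. - G i j)"
    by (intro sum.cong refl) (use G in \<open>auto simp: pminor_pair g[symmetric]\<close>)
  finally show ?thesis by (simp add: sum_negf)
qed

lemma sum_A_vv:
  shows "(\<Sum>i\<in>V. \<Sum>j\<in>V. (A i j)\<^sup>2 * (v i)\<^sup>2) = d" "(\<Sum>i\<in>V. \<Sum>j\<in>V. (A i j)\<^sup>2 * (v j)\<^sup>2) = d"
    "(\<Sum>i\<in>V. \<Sum>j\<in>V. A i j * v i * v j) = lam"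
proof -
  show 1: "(\<Sum>i\<in>V. \<Sum>j\<in>V. (A i j)\<^sup>2 * (v i)\<^sup>2) = d"
    using unit by (simp add: sum_distrib_right[symmetric] reg sum_distrib_left[symmetric])
  show "(\<Sum>i\<in>V. \<Sum>j\<in>V. (A i j)\<^sup>2 * (v j)\<^sup>2) = d"
    by (subst sum.swap, subst 1[symmetric]) (simp add: sym)
  have "(\<Sum>i\<in>V. \<Sum>j\<in>V. A i j * v i * v j) = (\<Sum>i\<in>V. v i * (\<Sum>j\<in>V. A i j * v j))"
    by (simp add: sum_distrib_left mult_ac)
  also have "\<dots> = (\<Sum>i\<in>V. v i * (lam * v i))" by (rule sum.cong) (simp_all add: eig)
  also have "\<dots> = lam * (\<Sum>i\<in>V. (v i)\<^sup>2)"
    by (simp add: sum_distrib_left power2_eq_square mult_ac)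
  finally show "(\<Sum>i\<in>V. \<Sum>j\<in>V. A i j * v i * v j) = lam" using unit by simp
qed

lemma sum_remove_pair:
  assumes "i \<in> V" "j \<in> V" "i \<noteq> j"
  shows "(\<Sum>k\<in>V - {i, j}. f k) = (\<Sum>k\<in>V. f k) - f i - (f j :: real)"
proof -
  have "V - {i, j} = V - {i} - {j}" by auto
  then show ?thesis using assms fin by (simp add: sum_diff1)
qed

lemma pairs_weight: "(\<Sum>U\<in>csets V 2. pminor U A * (\<Sum>i\<in>U. (v i)\<^sup>2)) = - d" (is "?L = _")
proof -
  have "?L
    = - (\<Sum>i\<in>V. \<Sum>j\<in>V. (A i j)\<^sup>2 * (v i)\<^sup>2 + (A i j)\<^sup>2 * (v j)\<^sup>2) / 2"
    by (rule pair_sum) (auto simp: dg algebra_simps)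
  then show ?thesis by (simp add: sum.distrib sum_A_vv)
qed

text \<open>Deleting the ends of an edge spoils the eigenvector equation only by explicit terms
  \<open>q\<close>, whose squares can be summed over all of \<open>V\<close> and then corrected at
  \<open>i\<close> and \<open>j\<close>.\<close>

lemma pairs_walks: "(\<Sum>U\<in>csets V 2. pminor U A * fps_nth (walks A (V - U) v) 2)
  = - (edges * lam\<^sup>2 + d * (d - 1) - 3 * d * lam\<^sup>2 + 2 * lam\<^sup>2)" (is "?L = _")
proof -
  define G where "G i j = lam\<^sup>2 * (A i j)\<^sup>2 + (d - 1 - 3 * lam\<^sup>2) * ((A i j)\<^sup>2 * (v i)\<^sup>2 + (A i j)\<^sup>2 * (v j)\<^sup>2)
    + 4 * lam * (A i j * v i * v j)" for i j
  have "(A i j)\<^sup>2 * fps_nth (walks A (V - {i, j}) v) 2 = G i j" if ij: "i \<in> V" "j \<in> V" "i \<noteq> j" for i j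
  proof (cases "A i j = 0")
    case True
    then show ?thesis by (simp add: G_def)
  next
    case False
    then have A1: "(A i j)\<^sup>2 = 1" using val[of i j] by auto
    define q where "q m = lam * v m - A m i * v i - A m j * v j" for m
    have inner: "(\<Sum>l\<in>V - {i, j}. A m l * v l) = q m" if "m \<in> V" for m
      using sum_remove_pair[OF ij, of "\<lambda>l. A m l * v l"] eig[OF that] by (simp add: q_def)
    \<comment> \<open>The ends of an edge have no common neighbour.\<close>
    have cross: "A m i * A m j = 0" for m using tri[of m i j] False by simp
    have "(q m)\<^sup>2 = lam\<^sup>2 * (v m)\<^sup>2 + (v i)\<^sup>2 * (A i m)\<^sup>2 + (v j)\<^sup>2 * (A j m)\<^sup>2
      - 2 * lam * v i * (A i m * v m) - 2 * lam * v j * (A j m * v m)" for m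
    proof -
      have "(q m)\<^sup>2 = lam\<^sup>2 * (v m)\<^sup>2 + (v i)\<^sup>2 * (A m i)\<^sup>2 + (v j)\<^sup>2 * (A m j)\<^sup>2
        - 2 * lam * v i * (A m i * v m) - 2 * lam * v j * (A m j * v m) + 2 * v i * v j * (A m i * A m j)"
        by (simp add: q_def power2_eq_square algebra_simps)
      then show ?thesis using cross[of m] by (auto simp: sym[of m])
    qed
    then have "(\<Sum>m\<in>V. (q m)\<^sup>2) = lam\<^sup>2 * (\<Sum>m\<in>V. (v m)\<^sup>2) + (v i)\<^sup>2 * (\<Sum>m\<in>V. (A i m)\<^sup>2) + (v j)\<^sup>2 * (\<Sum>m\<in>V. (A j m)\<^sup>2)
      - 2 * lam * v i * (\<Sum>m\<in>V. A i m * v m) - 2 * lam * v j * (\<Sum>m\<in>V. A j m * v m)"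
      by (simp only: sum.distrib sum_subtractf sum_distrib_left)
    then have qV: "(\<Sum>m\<in>V. (q m)\<^sup>2) = lam\<^sup>2 + (d - 2 * lam\<^sup>2) * ((v i)\<^sup>2 + (v j)\<^sup>2)"
      unfolding unit reg[OF ij(1)] reg[OF ij(2)] eig[OF ij(1)] eig[OF ij(2)]
      by (simp add: power2_eq_square algebra_simps)
    have "fps_nth (walks A (V - {i, j}) v) 2 = (\<Sum>m\<in>V - {i, j}. (q m)\<^sup>2)"
      unfolding walks_nth_2[OF sym] by (rule sum.cong) (auto simp: inner)
    also have "\<dots> = (\<Sum>m\<in>V. (q m)\<^sup>2) - (q i)\<^sup>2 - (q j)\<^sup>2" by (rule sum_remove_pair[OF ij])
    also have "(q i)\<^sup>2 = lam\<^sup>2 * (v i)\<^sup>2 + (v j)\<^sup>2 - 2 * lam * (A i j * v i * v j)"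
      using A1 by (simp add: q_def dg power2_eq_square algebra_simps)
    also have "(q j)\<^sup>2 = lam\<^sup>2 * (v j)\<^sup>2 + (v i)\<^sup>2 - 2 * lam * (A i j * v i * v j)"
      using A1 by (simp add: q_def dg sym[of j i] power2_eq_square algebra_simps)
    finally show ?thesis unfolding qV G_def A1 by (simp add: algebra_simps)
  qed
  then have "?L = - (\<Sum>i\<in>V. \<Sum>j\<in>V. G i j) / 2"
    by (rule pair_sum) (auto simp: G_def dg)
  also have "(\<Sum>i\<in>V. \<Sum>j\<in>V. G i j) = lam\<^sup>2 * (2 * edges) + (d - 1 - 3 * lam\<^sup>2) * (d + d) + 4 * lam * lam"
    unfolding G_def by (simp only: sum.distrib sum_distrib_left[symmetric] sum_A_vv) (simp add: edges_def)
  finally show ?thesis by (simp add: power2_eq_square algebra_simps)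
qed

text \<open>\<open>edges - 2 * d + 1\<close> edges survive the deletion of the ends of an edge: each
  end meets \<open>d\<close> edges, and the edge itself is counted twice.\<close>

lemma pairs_edges_weight: "(\<Sum>U\<in>csets V 2. pminor U A * (fps_nth (rev_char A (V - U)) 2 * (\<Sum>i\<in>U. (v i)\<^sup>2))) = d * (edges - 2 * d + 1)" (is "?L = _")
proof -
  define G where "G i j = - (edges - 2 * d + 1) * ((A i j)\<^sup>2 * (v i)\<^sup>2 + (A i j)\<^sup>2 * (v j)\<^sup>2)" for i j
  have "(A i j)\<^sup>2 * (fps_nth (rev_char A (V - {i, j})) 2 * (\<Sum>k\<in>{i, j}. (v k)\<^sup>2)) = G i j"
    if ij: "i \<in> V" "j \<in> V" "i \<noteq> j" for i j
  proof (cases "A i j = 0")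
    case True
    then show ?thesis by (simp add: G_def)
  next
    case False
    then have A1: "(A i j)\<^sup>2 = 1" using val[of i j] by auto
    have r: "(\<Sum>l\<in>V - {i, j}. (A k l)\<^sup>2) = d - (A i k)\<^sup>2 - (A j k)\<^sup>2" if "k \<in> V" for k
      using sum_remove_pair[OF ij, of "\<lambda>l. (A k l)\<^sup>2"] reg[OF that] by (simp add: sym[of k])
    have "(\<Sum>k\<in>V - {i, j}. \<Sum>l\<in>V - {i, j}. (A k l)\<^sup>2) = (\<Sum>k\<in>V - {i, j}. d - (A i k)\<^sup>2 - (A j k)\<^sup>2)"
      by (rule sum.cong) (auto simp: r)
    also have "\<dots> = (\<Sum>k\<in>V. d - (A i k)\<^sup>2 - (A j k)\<^sup>2) - (d - (A i j)\<^sup>2) - (d - (A i j)\<^sup>2)"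
      by (subst sum_remove_pair[OF ij]) (simp add: dg sym[of j i])
    also have "(\<Sum>k\<in>V. d - (A i k)\<^sup>2 - (A j k)\<^sup>2) = 2 * edges - d - d"
      using ij by (simp add: sum_subtractf reg edges_def)
    finally have D2: "fps_nth (rev_char A (V - {i, j})) 2 = - (edges - 2 * d + 1)"
      using rev_char_low[of "V - {i, j}"] fin A1 by (simp add: field_simps)
    show ?thesis unfolding G_def A1 D2 using ij by (simp add: algebra_simps)
  qed
  then have "?L = - (\<Sum>i\<in>V. \<Sum>j\<in>V. G i j) / 2"
    by (rule pair_sum) (auto simp: G_def dg)
  also have "(\<Sum>i\<in>V. \<Sum>j\<in>V. G i j) = - (edges - 2 * d + 1) * (d + d)"
    unfolding G_def by (simp only: sum.distrib sum_distrib_left[symmetric] sum_A_vv)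
  finally show ?thesis by (simp add: algebra_simps)
qed

text \<open>Exchanging the sums reduces this to the 4-minors through a fixed \<open>i\<close>. They
  are the difference of the fourth coefficients of \<open>rev_char\<close> for \<open>V\<close> and
  \<open>V - {i}\<close>, which \<open>rev_char_insert\<close> expresses by walks.\<close>

lemma quadruples_weight: "(\<Sum>U\<in>csets V 4. pminor U A * (\<Sum>i\<in>U. (v i)\<^sup>2)) = d * (edges - d) - (\<Sum>i\<in>V. (v i)\<^sup>2 * square_walks i)" (is "?L = _")
proof -
  have inner: "(\<Sum>U\<in>csets V 4. if i \<in> U then pminor U A else 0) = d * (edges - d) - square_walks i" if i: "i \<in> V" for i
  proof -
    let ?W = "V - {i}"
    have fW: "finite ?W" "i \<notin> ?W" and V: "insert i ?W = V" using fin i by auto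
    have "(\<Sum>U\<in>csets V 4. if i \<in> U then pminor U A else 0)
        = (\<Sum>U\<in>csets V 4. pminor U A) - (\<Sum>U\<in>csets V 4. if i \<notin> U then pminor U A else 0)"
      unfolding sum_subtractf[symmetric] by (rule sum.cong) auto
    also have "(\<Sum>U\<in>csets V 4. if i \<notin> U then pminor U A else 0) = (\<Sum>U\<in>{U\<in>csets V 4. i \<notin> U}. pminor U A)"
      by (rule sum.inter_filter[symmetric]) (use fin in simp)
    also have "{U\<in>csets V 4. i \<notin> U} = csets ?W 4" by (auto simp: csets_def)
    also have "(\<Sum>U\<in>csets V 4. pminor U A) = fps_nth (rev_char A V) 4" by (simp add: rev_char_nth fin)
    also have "(\<Sum>U\<in>csets ?W 4. pminor U A) = fps_nth (rev_char A ?W) 4" by (simp add: rev_char_nth fin)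
    also have "fps_nth (rev_char A V) 4 = fps_nth (rev_char A ?W) 4 - fps_nth (walks A ?W (A i) * rev_char A ?W) 2"
      using rev_char_insert[OF fW sym dg] unfolding V
      by (simp add: left_diff_distrib mult.assoc fps_X_power_mult_nth)
    also have "fps_nth (walks A ?W (A i) * rev_char A ?W) 2
        = fps_nth (walks A ?W (A i)) 0 * fps_nth (rev_char A ?W) 2 + fps_nth (walks A ?W (A i)) 2"
      using rev_char_low[OF fW(1)] by (simp add: fps_mult_nths)
    also have "fps_nth (walks A ?W (A i)) 0 = d"
      using reg[OF i] fin i by (simp add: walks_def sum_diff1 dg power2_eq_square)
    also have "fps_nth (walks A ?W (A i)) 2 = square_walks i" unfolding square_walks_def by (rule walks_nth_2[OF sym])
    also have "fps_nth (rev_char A ?W) 2 = - (edges - d)"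
    proof -
      have "(\<Sum>l\<in>?W. (A k l)\<^sup>2) = d - (A i k)\<^sup>2" if "k \<in> V" for k
        using fin i reg[OF that] by (simp add: sum_diff1 sym[of k])
      then have "(\<Sum>k\<in>?W. \<Sum>l\<in>?W. (A k l)\<^sup>2) = (\<Sum>k\<in>?W. d - (A i k)\<^sup>2)" by (intro sum.cong) auto
      also have "\<dots> = (\<Sum>k\<in>V. d - (A i k)\<^sup>2) - d" using fin i by (simp add: sum_diff1 dg)
      also have "(\<Sum>k\<in>V. d - (A i k)\<^sup>2) = 2 * edges - d"
        using i by (simp add: sum_subtractf reg edges_def)
      finally show ?thesis using rev_char_low[OF fW(1)] by (simp add: field_simps)
    qed
    finally show ?thesis by (simp add: algebra_simps)
  qed
  have "?L = (\<Sum>U\<in>csets V 4. \<Sum>i\<in>V. (v i)\<^sup>2 * (if i \<in> U then pminor U A else 0))"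
  proof (rule sum.cong[OF refl])
    fix U assume "U \<in> csets V 4"
    then have U: "U \<subseteq> V" by (simp add: csets_def)
    have "(\<Sum>i\<in>V. (v i)\<^sup>2 * (if i \<in> U then pminor U A else 0)) = (\<Sum>i\<in>U. (v i)\<^sup>2 * pminor U A)"
      by (rule sum.mono_neutral_cong_right[OF fin U]) auto
    then show "pminor U A * (\<Sum>i\<in>U. (v i)\<^sup>2) = (\<Sum>i\<in>V. (v i)\<^sup>2 * (if i \<in> U then pminor U A else 0))"
      by (simp add: sum_distrib_left mult.commute)
  qed
  also have "\<dots> = (\<Sum>i\<in>V. (v i)\<^sup>2 * (\<Sum>U\<in>csets V 4. if i \<in> U then pminor U A else 0))"
    by (subst sum.swap) (simp add: sum_distrib_left)
  also have "\<dots> = (\<Sum>i\<in>V. (v i)\<^sup>2 * (d * (edges - d) - square_walks i))" by (rule sum.cong) (auto simp: inner)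
  also have "\<dots> = d * (edges - d) * (\<Sum>i\<in>V. (v i)\<^sup>2) - (\<Sum>i\<in>V. (v i)\<^sup>2 * square_walks i)"
    by (simp add: right_diff_distrib sum_subtractf sum_distrib_left mult.commute)
  finally show ?thesis by (simp add: unit)
qed

lemma walks_V: "fps_nth (walks A V v) l = lam ^ l"
proof -
  have "walk_vec A V v l k = lam ^ l * v k" if "k \<in> V" for k
    using that
  proof (induct l arbitrary: k)
    case (Suc l)
    then have "walk_vec A V v (Suc l) k = lam ^ l * (\<Sum>m\<in>V. A k m * v m)"
      by (simp add: sum_distrib_left mult_ac)
    then show ?case using eig[OF Suc(2)] by simp
  qed simp
  then have "fps_nth (walks A V v) l = lam ^ l * (\<Sum>k\<in>V. (v k)\<^sup>2)"
    by (simp add: walks_def sum_distrib_left power2_eq_square mult_ac)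
  then show ?thesis by (simp add: unit)
qed

lemma walks_0: "U \<subseteq> V \<Longrightarrow> fps_nth (walks A (V - U) v) 0 = 1 - (\<Sum>i\<in>U. (v i)\<^sup>2)"
  using sum_diff[OF fin, of U "\<lambda>i. (v i)\<^sup>2"] by (simp add: walks_def unit power2_eq_square[symmetric])

lemma moments:
  assumes o: "o' \<notin> V"
    and eq: "mixed_num o' (eps_mat A) (\<lambda>i. fps_const (v i)) V (\<lambda>_. 1)
      = mixed_char (eps_mat A) V (\<lambda>_. 1) * Abs_fps m"
  shows "m 2 = lam\<^sup>2 + d"
    "m 4 = lam ^ 4 + (3 * d - 2) * lam\<^sup>2 + 2 * d\<^sup>2 + (\<Sum>i\<in>V. (v i)\<^sup>2 * square_walks i)"
proof -
  let ?F = "\<lambda>U. walks A (V - U) v * rev_char A (V - U)"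
  define H where "H = mixed_char (eps_mat A) V (\<lambda>_. 1)"
  define K where "K = mixed_num o' (eps_mat A) (\<lambda>i. fps_const (v i)) V (\<lambda>_. 1)"
  have H: "fps_nth H j = (\<Sum>m\<le>j. \<Sum>U\<in>csets V m. pminor U A * fps_nth (rev_char A (V - U)) (j - m))" for j
    unfolding H_def mixed_char_graded[OF fin] by (rule fps_nth_graded_sum[OF fin])
  have K: "fps_nth K j = (\<Sum>m\<le>j. \<Sum>U\<in>csets V m. pminor U A * fps_nth (?F U) (j - m))" for j
    unfolding K_def mixed_num_graded[OF fin o] by (rule fps_nth_graded_sum[OF fin])
  have z1: "(\<Sum>U\<in>csets V 1. pminor U A * F U) = 0" for F
    by (rule sum.neutral) (use pminor_card_1 in \<open>auto simp: csets_def\<close>)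
  have z3: "(\<Sum>U\<in>csets V 3. pminor U A * F U) = 0" for F
    by (rule sum.neutral) (use pminor_card_3 in \<open>auto simp: csets_def\<close>)
  have low: "fps_nth (rev_char A (V - U)) 0 = 1" "fps_nth (rev_char A (V - U)) 1 = 0" "fps_nth (rev_char A (V - U)) 3 = 0" for U
    using rev_char_low[of "V - U"] fin by auto
  have D2: "fps_nth (rev_char A V) 2 = - edges" using rev_char_low[OF fin] by (simp add: edges_def)
  have c2: "(\<Sum>U\<in>csets V 2. pminor U A) = - edges" using rev_char_nth[OF fin, of A 2] D2 by simp
  \<comment> \<open>\<open>D4\<close>, and \<open>Y\<close> below, are never evaluated: they enter
    numerator and denominator with the same multiplicity and cancel in the fourth moment, as do all
    terms with \<open>edges\<close>.\<close>
  define D4 where "D4 = fps_nth (rev_char A V) 4"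
  have c4: "(\<Sum>U\<in>csets V 4. pminor U A) = D4" using rev_char_nth[OF fin, of A 4] by (simp add: D4_def)
  define Y where "Y = (\<Sum>U\<in>csets V 2. pminor U A * fps_nth (rev_char A (V - U)) 2)"
  have H0: "fps_nth H 0 = 1" using low(1)[of "{}"] by (simp add: H csets_0 fin)
  have H1: "fps_nth H 1 = 0"
    using low(2)[of "{}"] z1[of "\<lambda>U. fps_nth (rev_char A (V - U)) 0"] unfolding H sum_4_terms by (simp add: csets_0 fin)
  have H2: "fps_nth H 2 = - 2 * edges"
    using z1[of "\<lambda>U. fps_nth (rev_char A (V - U)) 1"] D2 c2 unfolding H sum_4_terms by (simp add: csets_0 fin low(1))
  have H3: "fps_nth H 3 = 0"
    using z1[of "\<lambda>U. fps_nth (rev_char A (V - U)) 2"] z3[of "\<lambda>U. fps_nth (rev_char A (V - U)) 0"] low(3)[of "{}"] low(2)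
    unfolding H sum_4_terms by (simp add: csets_0 fin)
  have H4: "fps_nth H 4 = D4 + Y + D4"
    using z1[of "\<lambda>U. fps_nth (rev_char A (V - U)) 3"] z3[of "\<lambda>U. fps_nth (rev_char A (V - U)) 1"] c4
    unfolding H sum_4_terms Y_def by (simp add: csets_0 fin low(1) D4_def)
  have V0: "fps_nth (rev_char A V) 0 = 1" "fps_nth (rev_char A V) 1 = 0" "fps_nth (rev_char A V) 3 = 0" using low[of "{}"] by auto
  have p0: "fps_nth (?F U) 0 = 1 - (\<Sum>i\<in>U. (v i)\<^sup>2)" if "U \<in> csets V k" for U k
    using that low(1) walks_0[of U] by (simp add: csets_def)
  have K0: "fps_nth K 0 = 1" using V0 walks_V[of 0] by (simp add: K csets_0 fin)
  have q2: "(\<Sum>U\<in>csets V 2. pminor U A * fps_nth (?F U) 0) = - edges + d"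
  proof -
    have "(\<Sum>U\<in>csets V 2. pminor U A * fps_nth (?F U) 0)
      = (\<Sum>U\<in>csets V 2. pminor U A - pminor U A * (\<Sum>i\<in>U. (v i)\<^sup>2))"
      by (rule sum.cong[OF refl], subst p0, assumption) (simp add: algebra_simps)
    then show ?thesis by (simp add: sum_subtractf c2 pairs_weight)
  qed
  have K2: "fps_nth K 2 = lam\<^sup>2 - edges + (- edges + d)"
    using z1[of "\<lambda>U. fps_nth (?F U) 1"] q2 unfolding K sum_4_terms
    by (simp add: csets_0 fin fps_mult_nths walks_V V0[simplified] D2)
  have q4: "(\<Sum>U\<in>csets V 2. pminor U A * fps_nth (?F U) 2)
    = - (edges * lam\<^sup>2 + d * (d - 1) - 3 * d * lam\<^sup>2 + 2 * lam\<^sup>2) + Y - d * (edges - 2 * d + 1)"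
  proof -
    have "(\<Sum>U\<in>csets V 2. pminor U A * fps_nth (?F U) 2)
      = (\<Sum>U\<in>csets V 2. pminor U A * fps_nth (walks A (V - U) v) 2 + pminor U A * fps_nth (rev_char A (V - U)) 2
         - pminor U A * (fps_nth (rev_char A (V - U)) 2 * (\<Sum>i\<in>U. (v i)\<^sup>2)))"
    proof (rule sum.cong[OF refl])
      fix U assume U: "U \<in> csets V 2"
      have "fps_nth (?F U) 2
        = fps_nth (walks A (V - U) v) 0 * fps_nth (rev_char A (V - U)) 2 + fps_nth (walks A (V - U) v) 2"
        unfolding fps_mult_nths low by simp
      also have "fps_nth (walks A (V - U) v) 0 = 1 - (\<Sum>i\<in>U. (v i)\<^sup>2)" using U walks_0 by (simp add: csets_def)
      finally have wD: "fps_nth (?F U) 2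
        = (1 - (\<Sum>i\<in>U. (v i)\<^sup>2)) * fps_nth (rev_char A (V - U)) 2 + fps_nth (walks A (V - U) v) 2" .
      show "pminor U A * fps_nth (?F U) 2
        = pminor U A * fps_nth (walks A (V - U) v) 2 + pminor U A * fps_nth (rev_char A (V - U)) 2
         - pminor U A * (fps_nth (rev_char A (V - U)) 2 * (\<Sum>i\<in>U. (v i)\<^sup>2))" unfolding wD by (simp add: algebra_simps)
    qed
    then show ?thesis by (simp add: sum.distrib sum_subtractf pairs_walks pairs_edges_weight Y_def)
  qed
  have r4: "(\<Sum>U\<in>csets V 4. pminor U A * fps_nth (?F U) 0)
    = D4 - (d * (edges - d) - (\<Sum>i\<in>V. (v i)\<^sup>2 * square_walks i))"
  proof -
    have "(\<Sum>U\<in>csets V 4. pminor U A * fps_nth (?F U) 0)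
      = (\<Sum>U\<in>csets V 4. pminor U A - pminor U A * (\<Sum>i\<in>U. (v i)\<^sup>2))"
      by (rule sum.cong[OF refl], subst p0, assumption) (simp add: algebra_simps)
    then show ?thesis by (simp only: sum_subtractf c4 quadruples_weight)
  qed
  have v4: "fps_nth (walks A V v * rev_char A V) 4 = lam ^ 4 - edges * lam\<^sup>2 + D4"
    unfolding fps_mult_nths V0 walks_V D2 D4_def[symmetric] by simp
  have K4: "fps_nth K 4 = lam ^ 4 - edges * lam\<^sup>2 + D4
    + (- (edges * lam\<^sup>2 + d * (d - 1) - 3 * d * lam\<^sup>2 + 2 * lam\<^sup>2) + Y - d * (edges - 2 * d + 1))
    + (D4 - (d * (edges - d) - (\<Sum>i\<in>V. (v i)\<^sup>2 * square_walks i)))"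
    using z1[of "\<lambda>U. fps_nth (?F U) 3"]
      z3[of "\<lambda>U. fps_nth (?F U) 1"] q4 r4 v4
    unfolding K sum_4_terms by (simp add: csets_0 fin)
  have eq: "K = H * Abs_fps m" using eq by (simp add: K_def H_def)
  have m0: "m 0 = 1" using arg_cong[OF eq, of "\<lambda>f. fps_nth f 0"] H0 K0 by simp
  have "fps_nth K 2 = m 2 + fps_nth H 2"
    unfolding eq fps_mult_nths H0 H1 by (simp add: m0)
  then show m2: "m 2 = lam\<^sup>2 + d" unfolding K2 H2 by simp
  have "fps_nth K 4 = m 4 + fps_nth H 2 * m 2 + fps_nth H 4"
    unfolding eq fps_mult_nths H0 H1 H3 by (simp add: m0)
  then show "m 4 = lam ^ 4 + (3 * d - 2) * lam\<^sup>2 + 2 * d\<^sup>2 + (\<Sum>i\<in>V. (v i)\<^sup>2 * square_walks i)"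
    unfolding K4 H2 H4 m2 by (simp add: power2_eq_square algebra_simps)
qed

text \<open>The two sides are the fourth moment and \<open>C\<close> times the second moment of the measure given by
  \<open>mixed_num_fps\<close>.\<close>

lemma moment_inequality:
  assumes roots: "\<And>l. mixed_char A V (\<lambda>_. l) = 0 \<Longrightarrow> l\<^sup>2 \<le> C"
  shows "lam ^ 4 + (3 * d - 2) * lam\<^sup>2 + 2 * d\<^sup>2 + (\<Sum>i\<in>V. (v i)\<^sup>2 * square_walks i) \<le> C * (lam\<^sup>2 + d)"
proof -
  obtain o' where o: "o' \<notin> V" using fin infinite_UNIV_nat ex_new_if_finite by blast
  obtain w where w: "\<And>l. w l \<ge> 0" and eq:
    "mixed_num o' (eps_mat A) (\<lambda>i. fps_const (v i)) V (\<lambda>_. 1)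
      = mixed_char (eps_mat A) V (\<lambda>_. 1) * Abs_fps (\<lambda>n. \<Sum>l | mixed_char A V (\<lambda>_. l) = 0. w l * l ^ n)"
    using mixed_num_fps[of V o' A v, OF fin o sym] by blast
  have "(\<Sum>l | mixed_char A V (\<lambda>_. l) = 0. w l * l ^ 4) \<le> (\<Sum>l | mixed_char A V (\<lambda>_. l) = 0. C * (w l * l\<^sup>2))"
  proof (rule sum_mono)
    fix l assume "l \<in> {l. mixed_char A V (\<lambda>_. l) = 0}"
    then have "l\<^sup>2 \<le> C" using roots by simp
    then have "(w l * l\<^sup>2) * l\<^sup>2 \<le> (w l * l\<^sup>2) * C" using w by (intro mult_left_mono) auto
    then show "w l * l ^ 4 \<le> C * (w l * l\<^sup>2)" by (simp add: eval_nat_numeral mult_ac)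
  qed
  then show ?thesis unfolding sum_distrib_left[symmetric] moments[OF o eq] .
qed

end

section \<open>Application to signed graphs\<close>

lemma bij_betw_pick:
  assumes "finite S"
  shows "bij_betw (pick S) {0..<card S} S"
proof -
  have sub: "S \<subseteq> pick S ` {0..<card S}"
  proof
    fix i assume i: "i \<in> S"
    then have "{a \<in> S. a < i} \<subset> S" by auto
    then have "card {a \<in> S. a < i} < card S" by (rule psubset_card_mono[OF assms])
    then show "i \<in> pick S ` {0..<card S}" using pick_card_in_set[OF i] by force
  qed
  have "card (pick S ` {0..<card S}) \<le> card S" using card_image_le[of "{0..<card S}" "pick S"] by simp
  then have eq: "S = pick S ` {0..<card S}" by (intro card_seteq sub) auto
  then have "inj_on (pick S) {0..<card S}" by (intro eq_card_imp_inj_on) auto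
  then show ?thesis using eq by (simp add: bij_betw_def)
qed

lemma char_poly_submatrix:
  fixes A :: "nat \<Rightarrow> nat \<Rightarrow> 'a::field"
  assumes S: "S \<subseteq> {0..<n}"
  shows "char_poly (submatrix (mat n n (\<lambda>(i, j). A i j)) S S) = dminor (\<lambda>i j. - [:A i j:]) S (\<lambda>_. [:0, 1:])"
proof -
  have fin: "finite S" using S finite_subset by blast
  note b = bij_betw_pick[OF fin]
  have c: "{i. i < n \<and> i \<in> S} = S" using S by auto
  have "submatrix (mat n n (\<lambda>(i, j). A i j)) S S = mat (card S) (card S) (\<lambda>(a, b). A (pick S a) (pick S b))"
    unfolding submatrix_def
  proof (simp add: c, rule eq_matI; simp)
    fix a b assume "a < card S" "b < card S"
    then have "pick S a \<in> S" "pick S b \<in> S" using b by (auto simp: bij_betw_def)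
    then have "pick S a < n" "pick S b < n" using S by auto
    then show "mat n n (\<lambda>(i, j). A i j) $$ (pick S a, pick S b) = A (pick S a) (pick S b)" by simp
  qed
  then show ?thesis using dminor_char_poly[OF b, of A] by simp
qed

lemma sum_ordered_partitions_2:
  "(\<Sum>Ss\<in>ordered_partitions n 2. f (Ss ! 0) (Ss ! 1)) = (\<Sum>S\<in>Pow {0..<n}. f S ({0..<n} - S))"
proof (rule sum.reindex_bij_witness[of _ "\<lambda>S. [S, {0..<n} - S]" "\<lambda>Ss. Ss ! 0"])
  fix Ss assume "Ss \<in> ordered_partitions n 2"
  then have Ss: "length Ss = 2" "\<Union> (set Ss) = {0..<n}" "Ss ! 0 \<inter> Ss ! 1 = {}"
    unfolding ordered_partitions_def by auto
  obtain S T where ST: "Ss = [S, T]" using Ss(1) by (auto simp: numeral_2_eq_2 length_Suc_conv)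
  have "T = {0..<n} - S" "S \<subseteq> {0..<n}" using Ss(2,3) unfolding ST by auto
  then show "[Ss ! 0, {0..<n} - Ss ! 0] = Ss" "Ss ! 0 \<in> Pow {0..<n}"
    "f (Ss ! 0) ({0..<n} - Ss ! 0) = f (Ss ! 0) (Ss ! 1)" unfolding ST by auto
next
  fix S assume "S \<in> Pow {0..<n}"
  then show "[S, {0..<n} - S] \<in> ordered_partitions n 2"
    unfolding ordered_partitions_def by (auto simp: less_Suc_eq numeral_2_eq_2)
qed auto

lemma conv_cong:
  assumes "\<And>S. S \<subseteq> V \<Longrightarrow> M S x = M S x'" "\<And>S. S \<subseteq> V \<Longrightarrow> N S y = N S y'"
  shows "conv M N V x y = conv M N V x' y'"
  unfolding conv_def by (rule sum.cong) (use assms in auto)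

lemma mixed_char_conv_sum:
  fixes A :: "nat \<Rightarrow> nat \<Rightarrow> 'a::comm_ring_1"
  assumes fin: "finite V"
  shows "conv (dminor (\<lambda>i j. - A i j)) (dminor A) V (\<lambda>_. x) (\<lambda>_. y) = mixed_char A V (\<lambda>_. x + y)" (is "?L = _")
proof -
  have aff: "affine_family V (dminor (\<lambda>i j. - A i j))" "affine_family V (dminor A)"
    by (rule affine_family_dminor[OF fin])+
  have "?L
    = conv (dminor (\<lambda>i j. - A i j)) (dminor A) V (\<lambda>i. if i \<in> V then x + y else x) (\<lambda>i. if i \<in> V then 0 else y)"
    by (rule conv_shift[OF aff fin subset_refl subset_refl, symmetric])
  also have "\<dots> = mixed_char A V (\<lambda>_. x + y)"
    unfolding mixed_char_conv by (rule conv_cong; rule dminor_cong) auto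
  finally show ?thesis .
qed

text \<open>Changing the sign of \<open>x\<close> exchanges the roles of \<open>A\<close> and
  \<open>- A\<close>, at the cost of one sign per index; commuting the convolution and shifting
  \<open>x\<close> back to the other side restores the original.\<close>

lemma mixed_char_parity:
  fixes A :: "nat \<Rightarrow> nat \<Rightarrow> 'a::comm_ring_1"
  assumes fin: "finite V"
  shows "mixed_char A V (\<lambda>_. - x) = (-1) ^ card V * mixed_char A V (\<lambda>_. x)"
proof -
  let ?m = "dminor (\<lambda>i j. - A i j)"
  have neg: "dminor (\<lambda>i j. - B i j) S (\<lambda>_. - x) = (-1) ^ card S * dminor B S (\<lambda>_. x)"
    if "S \<subseteq> V" for S x and B :: "nat \<Rightarrow> nat \<Rightarrow> 'a"
  proof -
    have "dminor (\<lambda>i j. - B i j) S (\<lambda>_. - x) = pminor S (\<lambda>i j. (-1) * ((if i = j then x else 0) + B i j))"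
      unfolding dminor_def by (rule pminor_cong) auto
    also have "\<dots> = (-1) ^ card S * dminor B S (\<lambda>_. x)"
      unfolding dminor_def by (rule pminor_smult[OF finite_subset[OF that fin]])
    finally show ?thesis .
  qed
  have "mixed_char A V (\<lambda>_. - x) = (\<Sum>S\<in>Pow V. (-1) ^ card V * (dminor A S (\<lambda>_. x) * ?m (V - S) (\<lambda>_. 0)))"
    unfolding mixed_char_conv conv_def
  proof (rule sum.cong[OF refl])
    fix S assume S: "S \<in> Pow V"
    have "?m S (\<lambda>_. - x) = (-1) ^ card S * dminor A S (\<lambda>_. x)" using neg[of S A x] S by auto
    moreover have "dminor A (V - S) (\<lambda>_. 0) = (-1) ^ card (V - S) * ?m (V - S) (\<lambda>_. 0)"
      using neg[of "V - S" "\<lambda>i j. - A i j" 0] by auto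
    moreover have "card V = card S + card (V - S)" using card_split[OF fin] S by auto
    ultimately show "?m S (\<lambda>_. - x) * dminor A (V - S) (\<lambda>_. 0)
      = (-1) ^ card V * (dminor A S (\<lambda>_. x) * ?m (V - S) (\<lambda>_. 0))"
      by (simp add: power_add mult_ac)
  qed
  also have "\<dots> = (-1) ^ card V * conv (dminor A) ?m V (\<lambda>_. x) (\<lambda>_. 0)"
    by (simp add: conv_def sum_distrib_left)
  also have "conv (dminor A) ?m V (\<lambda>_. x) (\<lambda>_. 0) = conv ?m (dminor A) V (\<lambda>_. 0) (\<lambda>_. x)"
    by (rule conv_commute[OF fin])
  also have "\<dots> = mixed_char A V (\<lambda>_. x)" using mixed_char_conv_sum[OF fin, of A 0 x] by simp
  finally show ?thesis .
qed

text \<open>Both characteristic polynomials are evaluated at \<open>x\<close>; since only the sum of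
  the arguments of the convolution matters, this is the argument \<open>2 * x\<close> on one side
  and 0 on the other.\<close>

lemma poly_mixed_det_poly:
  fixes A :: "nat \<Rightarrow> nat \<Rightarrow> real" and n :: nat
  defines "M \<equiv> mat n n (\<lambda>(i, j). A i j)"
  shows "poly (mixed_det_poly n [M, - M]) x = mixed_char A {0..<n} (\<lambda>_. 2 * x) / 2 ^ n"
proof -
  have neg: "- M = mat n n (\<lambda>(i, j). - A i j)" unfolding M_def by (rule eq_matI) auto
  have pe: "comm_ring_hom (\<lambda>p. poly p x)" for x :: real by unfold_locales auto
  have ev: "poly (char_poly (submatrix (mat n n (\<lambda>(i, j). B i j)) S S)) x = dminor (\<lambda>i j. - B i j) S (\<lambda>_. x)"
    if "S \<subseteq> {0..<n}" for S and B :: "nat \<Rightarrow> nat \<Rightarrow> real"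
    unfolding char_poly_submatrix[OF that] by (subst comm_ring_hom.hom_dminor[OF pe]) simp
  have "mixed_det_poly n [M, - M] = smult (1 / 2 ^ n)
     (\<Sum>Ss\<in>ordered_partitions n 2. char_poly (submatrix M (Ss ! 0) (Ss ! 0)) * char_poly (submatrix (- M) (Ss ! 1) (Ss ! 1)))"
    unfolding mixed_det_poly_def by (simp add: numeral_2_eq_2 lessThan_Suc mult.commute)
  also have "\<dots> = smult (1 / 2 ^ n)
     (\<Sum>S\<in>Pow {0..<n}. char_poly (submatrix M S S) * char_poly (submatrix (- M) ({0..<n} - S) ({0..<n} - S)))"
    unfolding sum_ordered_partitions_2[of "\<lambda>S T. char_poly (submatrix M S S) * char_poly (submatrix (- M) T T)"] ..
  finally have "poly (mixed_det_poly n [M, - M]) x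
    = (\<Sum>S\<in>Pow {0..<n}. dminor (\<lambda>i j. - A i j) S (\<lambda>_. x) * dminor A ({0..<n} - S) (\<lambda>_. x)) / 2 ^ n"
    by (simp add: poly_sum neg, simp add: M_def ev)
  also have "\<dots> = mixed_char A {0..<n} (\<lambda>_. 2 * x) / 2 ^ n"
    using mixed_char_conv_sum[of "{0..<n}" A x x] by (simp add: conv_def)
  finally show ?thesis .
qed

lemma roots_bounded:
  fixes A :: "nat \<Rightarrow> nat \<Rightarrow> real"
  assumes fin: "finite V" and up: "\<And>l. mixed_char A V (\<lambda>_. l) = 0 \<Longrightarrow> l \<le> 2 * y" and l: "mixed_char A V (\<lambda>_. l) = 0"
  shows "l\<^sup>2 \<le> 4 * y\<^sup>2"
proof -
  have "mixed_char A V (\<lambda>_. - l) = 0" using mixed_char_parity[OF fin, of A l] l by simp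
  then have "\<bar>l\<bar> \<le> 2 * y" using up[of l] up[of "- l"] l by auto
  then have "\<bar>l\<bar>\<^sup>2 \<le> (2 * y)\<^sup>2" by (intro power_mono) auto
  then show ?thesis by (simp add: power_mult_distrib)
qed

lemma root_le_largest_root:
  fixes A :: "nat \<Rightarrow> nat \<Rightarrow> real"
  assumes l: "mixed_char A {0..<n} (\<lambda>_. l) = 0"
  shows "l \<le> 2 * largest_root (mat n n (\<lambda>(i, j). A i j))"
proof -
  let ?M = "mat n n (\<lambda>(i, j). A i j)"
  have R: "{x. poly (mixed_det_poly (dim_row ?M) [?M, - ?M]) x = 0} = (\<lambda>x. x / 2) ` {x. poly (avg_poly A [] {0..<n}) x = 0}"
  proof (rule equalityI; rule subsetI)
    fix x assume "x \<in> {x. poly (mixed_det_poly (dim_row ?M) [?M, - ?M]) x = 0}"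
    then have "2 * x \<in> {x. poly (avg_poly A [] {0..<n}) x = 0}" by (simp add: poly_mixed_det_poly poly_avg_poly)
    then show "x \<in> (\<lambda>x. x / 2) ` {x. poly (avg_poly A [] {0..<n}) x = 0}" by (rule image_eqI[rotated]) simp
  qed (auto simp: poly_mixed_det_poly poly_avg_poly)
  \<comment> \<open>Ensures that the root set is finite, so that \<open>Max\<close> in
    \<open>largest_root\<close> is a genuine maximum.\<close>
  have "avg_poly A [] {0..<n} \<noteq> 0" using monic_degD[OF monic_deg_avg_poly] by blast
  then have "finite {x. poly (avg_poly A [] {0..<n}) x = 0}" by (rule poly_roots_finite)
  then have "l / 2 \<le> largest_root ?M"
    unfolding largest_root_def R using l by (intro Max_ge) (auto simp: poly_avg_poly)
  then show ?thesis by simp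
qed

text \<open>The spectral radius is attained at a complex eigenvalue. The characteristic polynomial
  of a symmetric matrix has only real roots by \<open>dminor_nonzero\<close>, so the eigenvalue is
  real and has a real eigenvector, here normalized.\<close>

lemma rho_eigenvector:
  fixes A :: "nat \<Rightarrow> nat \<Rightarrow> real"
  assumes n: "n \<ge> 1" and sym: "\<And>i j. A i j = A j i"
  obtains lam v where "\<bar>lam\<bar> = rho (mat n n (\<lambda>(i, j). A i j))" "(\<Sum>i\<in>{0..<n}. (v i)\<^sup>2) = 1"
    "\<And>i. i \<in> {0..<n} \<Longrightarrow> (\<Sum>j\<in>{0..<n}. A i j * v j) = lam * v i"
proof -
  let ?M = "mat n n (\<lambda>(i, j). A i j)"
  have M: "?M \<in> carrier_mat n n" and cM: "map_mat complex_of_real ?M \<in> carrier_mat n n" by auto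
  obtain a where a: "a \<in> spectrum (map_mat complex_of_real ?M)" "rho ?M = cmod a"
    using spectral_radius_mem_max(1)[OF cM] n unfolding rho_def by auto
  have cp: "char_poly ?M = dminor (\<lambda>i j. - [:A i j:]) {0..<n} (\<lambda>_. [:0, 1:])"
    using dminor_char_poly[of id n "{0..<n}" A] by simp
  have "poly (char_poly (map_mat complex_of_real ?M)) a = 0"
    using a(1) spectrum_root_char_poly[OF cM] by auto
  then have root: "poly (cpoly (char_poly ?M)) a = 0" by (simp add: of_real_hom.char_poly_hom[OF M])
  have "upper_stable (char_poly ?M)"
    unfolding upper_stable_def cp comm_ring_hom.hom_dminor[OF comm_ring_hom_cpoly]
    by (intro allI impI dminor_nonzero) (use sym in \<open>auto simp: of_real_hom.map_poly_pCons_hom\<close>)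
  note r = upper_stable_real[OF this root]
  have "eigenvalue ?M (Re a)" using eigenvalue_root_char_poly[OF M] r(2) by blast
  then obtain u where u: "u \<in> carrier_vec n" "u \<noteq> 0\<^sub>v n" "?M *\<^sub>v u = Re a \<cdot>\<^sub>v u"
    unfolding eigenvalue_def eigenvector_def by auto
  define N where "N = (\<Sum>i\<in>{0..<n}. (u $ i)\<^sup>2)"
  obtain k where k: "k < n" "u $ k \<noteq> 0" using u(1,2) by (metis carrier_vecD eq_vecI index_zero_vec)
  have N: "N > 0" unfolding N_def by (rule sum_pos2[of _ k]) (use k in auto)
  define v where "v i = u $ i / sqrt N" for i
  show ?thesis
  proof (rule that[of "Re a" v])
    have "cmod a = cmod (complex_of_real (Re a))" using r(1) by simp
    then show "\<bar>Re a\<bar> = rho ?M" using a(2) by simp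
    show "(\<Sum>i\<in>{0..<n}. (v i)\<^sup>2) = 1"
      using N by (simp add: v_def power_divide sum_divide_distrib[symmetric] N_def[symmetric])
    fix i assume i: "i \<in> {0..<n}"
    have "(\<Sum>j\<in>{0..<n}. A i j * u $ j) = (?M *\<^sub>v u) $ i"
      using i u(1) by (auto simp: scalar_prod_def)
    also have "\<dots> = Re a * u $ i" unfolding u(3) using i u(1) by simp
    finally have "(\<Sum>j\<in>{0..<n}. A i j * u $ j) = Re a * u $ i" .
    then show "(\<Sum>j\<in>{0..<n}. A i j * v j) = Re a * v i"
      by (simp add: v_def sum_divide_distrib[symmetric])
  qed
qed

definition adj :: "nat set set \<Rightarrow> (nat set \<Rightarrow> real) \<Rightarrow> nat \<Rightarrow> nat \<Rightarrow> real" where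
  "adj E \<sigma> i j = (if {i, j} \<in> E then \<sigma> {i, j} else 0)"

lemma signed_adj_mat_adj: "signed_adj_mat n E \<sigma> = mat n n (\<lambda>(i, j). adj E \<sigma> i j)"
  by (simp add: signed_adj_mat_def adj_def)

lemma adj_sym: "adj E \<sigma> i j = adj E \<sigma> j i"
  by (simp add: adj_def insert_commute)

lemma simple_graphD:
  assumes "simple_graph n E" "{i, j} \<in> E"
  shows "i \<noteq> j" "i < n" "j < n"
proof -
  have "{i, j} \<subseteq> {0..<n}" "card {i, j} = 2" using assms unfolding simple_graph_def by blast+
  then show "i \<noteq> j" "i < n" "j < n" by (auto split: if_splits)
qed

lemma regular_eigen_adj:
  assumes g: "simple_graph n E" and reg: "regular_graph n E d" and tf: "triangle_free E" and s: "edge_signing E \<sigma>"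
    and unit: "(\<Sum>i\<in>{0..<n}. (v i)\<^sup>2) = 1"
    and eig: "\<And>i. i \<in> {0..<n} \<Longrightarrow> (\<Sum>j\<in>{0..<n}. adj E \<sigma> i j * v j) = lam * v i"
  shows "regular_eigen (adj E \<sigma>) {0..<n} (real d) lam v"
proof
  have loop: "{i, i} \<notin> E" for i using simple_graphD(1)[OF g, of i i] by blast
  then show "adj E \<sigma> i i = 0" for i by (simp add: adj_def)
  show "adj E \<sigma> i j = adj E \<sigma> j i" for i j by (rule adj_sym)
  show "adj E \<sigma> i j * adj E \<sigma> j k * adj E \<sigma> i k = 0" for i j k
    using tf unfolding triangle_free_def adj_def by auto
  have val: "adj E \<sigma> i j \<in> {-1, 0, 1}" for i j
    using s unfolding edge_signing_def adj_def by auto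
  then show "adj E \<sigma> i j \<in> {-1, 0, 1}" for i j .
  show "(\<Sum>j\<in>{0..<n}. (adj E \<sigma> i j)\<^sup>2) = real d" if "i \<in> {0..<n}" for i
  proof -
    have "(\<Sum>j\<in>{0..<n}. (adj E \<sigma> i j)\<^sup>2) = (\<Sum>j\<in>{0..<n}. if {j, i} \<in> E then 1 else 0)"
      using s by (intro sum.cong) (auto simp: adj_def edge_signing_def insert_commute)
    also have "\<dots> = real (card {u \<in> {0..<n}. {u, i} \<in> E})"
      by (simp add: sum.inter_filter[symmetric])
    finally show ?thesis using reg that by (simp add: regular_graph_def)
  qed
qed (use unit eig in auto)

lemma quadratic_bound:
  fixes t :: real
  assumes "t\<^sup>2 - p * t \<le> q"
  shows "t \<le> (p + sqrt (p\<^sup>2 + 4 * q)) / 2"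
proof -
  have "(2 * t - p)\<^sup>2 \<le> p\<^sup>2 + 4 * q" using assms by (simp add: power2_eq_square algebra_simps)
  then have "\<bar>2 * t - p\<bar> \<le> sqrt (p\<^sup>2 + 4 * q)" using real_sqrt_le_mono by fastforce
  then show ?thesis by simp
qed

lemma bound_triangle_free_less: "d \<ge> 2 \<Longrightarrow> bound_triangle_free d < 6 * (real d - 1)"
proof -
  assume d: "d \<ge> 2"
  \<comment> \<open>The bound 7d - 6 is what completes 5d - 6 to 12(d - 1).\<close>
  have "49 * (real d)\<^sup>2 - 92 * real d + 36 < (7 * real d - 6)\<^sup>2"
    using d by (simp add: power2_eq_square algebra_simps)
  then have "sqrt (49 * (real d)\<^sup>2 - 92 * real d + 36) < 7 * real d - 6"
    using d by (intro real_less_lsqrt) auto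
  then show ?thesis by (simp add: bound_triangle_free_def)
qed

lemma bound_girth_five_less: "d \<ge> 2 \<Longrightarrow> bound_girth_five d < (5 + 3 * sqrt 5) / 2 * (real d - 1)"
proof -
  assume d: "d \<ge> 2"
  \<comment> \<open>Chosen so that 5d - 6 + \<open>?r\<close> equals (5 + 3 sqrt 5)(d - 1). The
    radicand is 45(d - 1)^2 + 2d - 9, which the cross term of the square of \<open>?r\<close>
    beats.\<close>
  let ?r = "3 * sqrt 5 * (real d - 1) + 1"
  have s5: "sqrt 5 > 1" by simp
  have "sqrt 5 * (real d - 1) \<ge> 1 * (real d - 1)" using d s5 by (intro mult_right_mono) auto
  moreover have "?r\<^sup>2 = 45 * (real d - 1)\<^sup>2 + 6 * (sqrt 5 * (real d - 1)) + 1"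
    by (simp add: power2_sum power_mult_distrib)
  ultimately have "45 * (real d)\<^sup>2 - 88 * real d + 36 < ?r\<^sup>2"
    using d by (simp add: power2_eq_square algebra_simps)
  then have "sqrt (45 * (real d)\<^sup>2 - 88 * real d + 36) < ?r"
    using d by (intro real_less_lsqrt) auto
  then have "5 * real d - 6 + sqrt (45 * (real d)\<^sup>2 - 88 * real d + 36) < 5 * real d - 6 + ?r" by simp
  also have "\<dots> = (5 + 3 * sqrt 5) * (real d - 1)" by (simp add: algebra_simps)
  finally show ?thesis by (simp add: bound_girth_five_def)
qed

lemma girth_cycle_length:
  assumes "girth E \<ge> 5" "c \<in> cycles E"
  shows "length c \<ge> 5"
proof -
  have "girth E \<le> enat (length c)" unfolding girth_def by (rule INF_lower[OF assms(2)])
  then have "5 \<le> enat (length c)" using assms(1) by (rule order_trans[rotated])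
  then show ?thesis by (simp add: numeral_eq_enat)
qed

lemma girth_triangle_free:
  assumes g: "simple_graph n E" and "girth E \<ge> 5"
  shows "triangle_free E"
  unfolding triangle_free_def
proof
  assume "\<exists>x y z. {x, y} \<in> E \<and> {y, z} \<in> E \<and> {x, z} \<in> E"
  then obtain x y z where e: "{x, y} \<in> E" "{y, z} \<in> E" "{x, z} \<in> E" by blast
  have "[x, y, z] \<in> cycles E"
    using e simple_graphD(1)[OF g] unfolding cycles_def
    by (auto simp: less_Suc_eq nth_Cons' insert_commute)
  from girth_cycle_length[OF assms(2) this] show False by simp
qed

lemma girth_no_square:
  assumes g: "simple_graph n E" and "girth E \<ge> 5"
    and e: "{i, l} \<in> E" "{l, m} \<in> E" "{m, k} \<in> E" "{k, i} \<in> E" and "i \<noteq> m"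
  shows "l = k"
proof (rule ccontr)
  assume "l \<noteq> k"
  have "[i, l, m, k] \<in> cycles E"
    using e \<open>l \<noteq> k\<close> \<open>i \<noteq> m\<close> simple_graphD(1)[OF g] unfolding cycles_def
    by (auto simp: less_Suc_eq nth_Cons' insert_commute)
  from girth_cycle_length[OF assms(2) this] show False by simp
qed

lemma square_sum_orthogonal:
  fixes f :: "nat \<Rightarrow> real"
  assumes "finite W" "\<And>k l. k \<in> W \<Longrightarrow> l \<in> W \<Longrightarrow> k \<noteq> l \<Longrightarrow> f k * f l = 0"
  shows "(\<Sum>l\<in>W. f l)\<^sup>2 = (\<Sum>l\<in>W. (f l)\<^sup>2)"
proof -
  have "(\<Sum>l\<in>W. f l)\<^sup>2 = (\<Sum>k\<in>W. \<Sum>l\<in>W. f k * f l)" by (simp add: power2_eq_square sum_product)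
  also have "\<dots> = (\<Sum>k\<in>W. \<Sum>l\<in>W. if k = l then (f k)\<^sup>2 else 0)"
    by (intro sum.cong refl) (use assms(2) in \<open>auto simp: power2_eq_square\<close>)
  finally show ?thesis using assms(1) by (simp add: sum.delta)
qed

text \<open>Without 4-cycles, two distinct vertices have at most one common neighbour, so no cross
  terms arise and the sum counts walks of two steps from \<open>i\<close> that do not return:
  \<open>d\<close> first steps, \<open>d - 1\<close> second ones.\<close>

lemma (in regular_eigen) square_walks_no_squares:
  assumes i: "i \<in> V"
    and sq: "\<And>m k l. m \<noteq> i \<Longrightarrow> k \<noteq> l \<Longrightarrow> (A m k * A i k) * (A m l * A i l) = 0"
  shows "square_walks i = d * (d - 1)"
proof -
  have "square_walks i = (\<Sum>m\<in>V - {i}. \<Sum>l\<in>V - {i}. (A m l * A i l)\<^sup>2)"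
    unfolding square_walks_def using fin sq by (intro sum.cong square_sum_orthogonal) auto
  also have "\<dots> = (\<Sum>l\<in>V - {i}. \<Sum>m\<in>V - {i}. (A m l * A i l)\<^sup>2)" by (rule sum.swap)
  also have "\<dots> = (\<Sum>l\<in>V - {i}. (d - 1) * (A i l)\<^sup>2)"
  proof (rule sum.cong[OF refl])
    fix l assume l: "l \<in> V - {i}"
    have "(\<Sum>m\<in>V - {i}. (A m l * A i l)\<^sup>2) = (\<Sum>m\<in>V - {i}. (A l m)\<^sup>2) * (A i l)\<^sup>2"
      by (simp add: sum_distrib_right power_mult_distrib sym[of l])
    also have "(\<Sum>m\<in>V - {i}. (A l m)\<^sup>2) = d - (A i l)\<^sup>2"
      using reg[of l] l i fin by (simp add: sum_diff1 sym[of l])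
    finally show "(\<Sum>m\<in>V - {i}. (A m l * A i l)\<^sup>2) = (d - 1) * (A i l)\<^sup>2"
      using val4[of i l] by (simp add: algebra_simps)
  qed
  also have "\<dots> = (d - 1) * d"
    using reg[OF i] i fin by (simp add: sum_distrib_left[symmetric] sum_diff1 dg)
  finally show ?thesis by simp
qed

lemma rho_bounds:
  assumes d: "d \<ge> 2" and n: "n \<ge> 1" and g: "simple_graph n E" and reg: "regular_graph n E d" and s: "edge_signing E \<sigma>"
    and roots: "\<And>l. mixed_char (adj E \<sigma>) {0..<n} (\<lambda>_. l) = 0 \<Longrightarrow> l \<le> 2 * sqrt (2 * (real d - 1))"
  shows "triangle_free E \<Longrightarrow> (rho (signed_adj_mat n E \<sigma>))\<^sup>2 \<le> bound_triangle_free d"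
    and "girth E \<ge> 5 \<Longrightarrow> (rho (signed_adj_mat n E \<sigma>))\<^sup>2 \<le> bound_girth_five d"
proof -
  let ?V = "{0..<n}"
  obtain lam v where lam: "\<bar>lam\<bar> = rho (signed_adj_mat n E \<sigma>)" and unit: "(\<Sum>i\<in>?V. (v i)\<^sup>2) = 1"
    and eig: "\<And>i. i \<in> ?V \<Longrightarrow> (\<Sum>j\<in>?V. adj E \<sigma> i j * v j) = lam * v i"
    unfolding signed_adj_mat_adj by (rule rho_eigenvector[of n "adj E \<sigma>", OF n adj_sym]) blast
  define t where "t = lam\<^sup>2"
  have t: "(rho (signed_adj_mat n E \<sigma>))\<^sup>2 = t" unfolding t_def lam[symmetric] by simp
  have C: "l\<^sup>2 \<le> 8 * (real d - 1)" if "mixed_char (adj E \<sigma>) ?V (\<lambda>_. l) = 0" for l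
    using roots_bounded[OF _ roots that] d by simp
  \<comment> \<open>\<open>X\<close> is the only place where the two cases differ: 0 without
    triangles, d(d - 1) for girth at least five.\<close>
  have main: "t\<^sup>2 + (3 * real d - 2) * t + 2 * (real d)\<^sup>2 + X \<le> 8 * (real d - 1) * (t + real d)"
    if tf: "triangle_free E" and X: "X \<le> (\<Sum>i\<in>?V. (v i)\<^sup>2 * regular_eigen.square_walks (adj E \<sigma>) ?V i)" for X
  proof -
    interpret regular_eigen "adj E \<sigma>" ?V "real d" lam v by (rule regular_eigen_adj[OF g reg tf s unit eig])
    have "lam ^ 4 = t\<^sup>2" by (simp add: t_def flip: power_mult)
    then show ?thesis using moment_inequality[OF C] X by (simp add: t_def)
  qed
  show "(rho (signed_adj_mat n E \<sigma>))\<^sup>2 \<le> bound_triangle_free d" if tf: "triangle_free E"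
  proof -
    interpret regular_eigen "adj E \<sigma>" ?V "real d" lam v by (rule regular_eigen_adj[OF g reg tf s unit eig])
    have "0 \<le> (\<Sum>i\<in>?V. (v i)\<^sup>2 * square_walks i)" by (intro sum_nonneg mult_nonneg_nonneg) (auto simp: square_walks_def sum_nonneg)
    from main[OF tf this] have q: "t\<^sup>2 - (5 * real d - 6) * t \<le> 6 * (real d)\<^sup>2 - 8 * real d"
      by (simp add: power2_eq_square algebra_simps)
    have eq: "(5 * real d - 6)\<^sup>2 + 4 * (6 * (real d)\<^sup>2 - 8 * real d) = 49 * (real d)\<^sup>2 - 92 * real d + 36"
      by (simp add: power2_eq_square algebra_simps)
    show ?thesis using quadratic_bound[OF q] unfolding t bound_triangle_free_def eq .
  qed
  show "(rho (signed_adj_mat n E \<sigma>))\<^sup>2 \<le> bound_girth_five d" if g5: "girth E \<ge> 5"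
  proof -
    have tf: "triangle_free E" by (rule girth_triangle_free[OF g g5])
    interpret regular_eigen "adj E \<sigma>" ?V "real d" lam v by (rule regular_eigen_adj[OF g reg tf s unit eig])
    have "square_walks i = real d * (real d - 1)" if "i \<in> ?V" for i
    proof (rule square_walks_no_squares[OF that])
      fix m k l :: nat assume mi: "m \<noteq> i" and kl: "k \<noteq> l"
      show "(adj E \<sigma> m k * adj E \<sigma> i k) * (adj E \<sigma> m l * adj E \<sigma> i l) = 0"
        using girth_no_square[OF g g5, of i k m l] mi kl by (auto simp: adj_def insert_commute)
    qed
    then have "(\<Sum>i\<in>?V. (v i)\<^sup>2 * square_walks i) = (\<Sum>i\<in>?V. (v i)\<^sup>2) * (real d * (real d - 1))"
      by (simp add: sum_distrib_right)
    then have "real d * (real d - 1) \<le> (\<Sum>i\<in>?V. (v i)\<^sup>2 * square_walks i)" by (simp add: unit[simplified])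
    from main[OF tf this] have q: "t\<^sup>2 - (5 * real d - 6) * t \<le> 5 * (real d)\<^sup>2 - 7 * real d"
      by (simp add: power2_eq_square algebra_simps)
    have eq: "(5 * real d - 6)\<^sup>2 + 4 * (5 * (real d)\<^sup>2 - 7 * real d) = 45 * (real d)\<^sup>2 - 88 * real d + 36"
      by (simp add: power2_eq_square algebra_simps)
    show ?thesis using quadratic_bound[OF q] unfolding t bound_girth_five_def eq .
  qed
qed

lemma exists_edge_signing:
  assumes d: "d \<ge> 2" and g: "simple_graph n E" and reg: "regular_graph n E d"
  obtains \<sigma> where "edge_signing E \<sigma>"
    "\<And>l. mixed_char (adj E \<sigma>) {0..<n} (\<lambda>_. l) = 0 \<Longrightarrow> l \<le> 2 * sqrt (2 * (real d - 1))"
proof -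
  let ?V = "{0..<n}" and ?y = "sqrt (2 * (real d - 1))"
  define P where "P = {(a, b). a < b \<and> {a, b} \<in> E}"
  have "P \<subseteq> ?V \<times> ?V" using simple_graphD[OF g] by (auto simp: P_def)
  then have "finite P" using finite_subset by blast
  then obtain es where es: "set es = P" "distinct es" using finite_distinct_list by blast
  have deg: "length (nbrs_in es i ?V) \<le> d" if i: "i \<in> ?V" for i
  proof -
    let ?Q = "\<lambda>(a, b). (a = i \<and> b \<in> ?V) \<or> (b = i \<and> a \<in> ?V)" and ?o = "\<lambda>(a, b). if a = i then b else a"
    have "length (nbrs_in es i ?V) = card {p \<in> P. ?Q p}"
      unfolding nbrs_in_def length_map es(1)[symmetric] set_filter[symmetric]
      by (rule distinct_card[symmetric]) (simp add: es)
    also have "\<dots> \<le> card {u \<in> ?V. {u, i} \<in> E}"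
    proof (rule card_inj_on_le[of ?o])
      show "inj_on ?o {p \<in> P. ?Q p}" by (auto simp: inj_on_def P_def split: if_splits)
      show "?o ` {p \<in> P. ?Q p} \<subseteq> {u \<in> ?V. {u, i} \<in> E}" by (auto simp: P_def insert_commute)
    qed simp
    finally show ?thesis using reg i by (simp add: regular_graph_def)
  qed
  have y: "?y > 0" "?y\<^sup>2 = 2 * (real d - 1)" using d by auto
  have ok: "\<forall>(i, j)\<in>set es. i < j \<and> i \<in> ?V \<and> j \<in> ?V"
    using simple_graphD[OF g] by (auto simp: es P_def)
  obtain \<tau> where sym: "\<And>i j. \<tau> i j = \<tau> j i"
    and val: "\<And>i j. if (i, j) \<in> set es \<or> (j, i) \<in> set es then \<tau> i j \<in> {-1, 1} else \<tau> i j = 0"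
    and pos: "\<And>x. x > 2 * ?y \<Longrightarrow> poly (avg_poly \<tau> [] ?V) x > 0"
    using exists_good_signing[OF d y es(2) ok _ deg] by auto
  have edge: "(i, j) \<in> set es \<or> (j, i) \<in> set es \<longleftrightarrow> {i, j} \<in> E" for i j
    using simple_graphD(1)[OF g, of i j] by (auto simp: es P_def insert_commute linorder_neq_iff)
  \<comment> \<open>A signing takes edges as sets, so the symmetric \<tau> is evaluated at the two
    ends in increasing order.\<close>
  define \<sigma> where "\<sigma> e = \<tau> (Min e) (Max e)" for e
  have \<sigma>: "\<sigma> {i, j} = \<tau> i j" for i j
    using sym[of i j] by (cases "i \<le> j") (auto simp: \<sigma>_def min_def max_def)
  have adj: "adj E \<sigma> = \<tau>"
    using val edge by (intro ext) (auto simp: adj_def \<sigma> split: if_splits)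
  have "edge_signing E \<sigma>"
    unfolding edge_signing_def
  proof
    fix e assume e: "e \<in> E"
    then have "card e = 2" using g by (auto simp: simple_graph_def)
    then obtain i j where "e = {i, j}" by (meson card_2_iff)
    then show "\<sigma> e \<in> {-1, 1}" using val[of i j] edge[of i j] e \<sigma> by auto
  qed
  moreover have "l \<le> 2 * ?y" if "mixed_char (adj E \<sigma>) ?V (\<lambda>_. l) = 0" for l
    using pos[of l] that by (force simp: adj poly_avg_poly)
  ultimately show ?thesis by (rule that)
qed

theorem corollary1p4:
  fixes d n :: nat and E :: "nat set set"
  assumes "d \<ge> 2" and "n \<ge> 1"
    and "simple_graph n E" and "regular_graph n E d"
  shows "(triangle_free E \<longrightarrow>
          (\<forall>\<sigma> A. edge_signing E \<sigma> \<and> A = signed_adj_mat n E \<sigma>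
             \<and> largest_root A \<le> sqrt (2 * (real d - 1))
             \<longrightarrow> rho A ^ 2 \<le> bound_triangle_free d \<and> bound_triangle_free d < 6 * (real d - 1)))
       \<and> (girth E \<ge> 5 \<longrightarrow>
          (\<forall>\<sigma> A. edge_signing E \<sigma> \<and> A = signed_adj_mat n E \<sigma>
             \<and> largest_root A \<le> sqrt (2 * (real d - 1))
             \<longrightarrow> rho A ^ 2 \<le> bound_girth_five d
               \<and> bound_girth_five d < (5 + 3 * sqrt 5) / 2 * (real d - 1)))
       \<and> (triangle_free E \<longrightarrow>
          (\<exists>\<sigma>. edge_signing E \<sigma> \<and> rho (signed_adj_mat n E \<sigma>) ^ 2 \<le> bound_triangle_free d
             \<and> bound_triangle_free d < 6 * (real d - 1)))
       \<and> (girth E \<ge> 5 \<longrightarrow>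
          (\<exists>\<sigma>. edge_signing E \<sigma> \<and> rho (signed_adj_mat n E \<sigma>) ^ 2 \<le> bound_girth_five d
             \<and> bound_girth_five d < (5 + 3 * sqrt 5) / 2 * (real d - 1)))"
proof -
  have roots: "l \<le> 2 * sqrt (2 * (real d - 1))"
    if "largest_root (signed_adj_mat n E \<sigma>) \<le> sqrt (2 * (real d - 1))" "mixed_char (adj E \<sigma>) {0..<n} (\<lambda>_. l) = 0" for \<sigma> l
    using root_le_largest_root[OF that(2)] that(1) unfolding signed_adj_mat_adj by linarith
  have given: "(triangle_free E \<longrightarrow> (rho A)\<^sup>2 \<le> bound_triangle_free d) \<and> (girth E \<ge> 5 \<longrightarrow> (rho A)\<^sup>2 \<le> bound_girth_five d)"
    if "edge_signing E \<sigma> \<and> A = signed_adj_mat n E \<sigma> \<and> largest_root A \<le> sqrt (2 * (real d - 1))" for \<sigma> A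
  proof -
    have s: "edge_signing E \<sigma>" and A: "A = signed_adj_mat n E \<sigma>"
      and l: "largest_root (signed_adj_mat n E \<sigma>) \<le> sqrt (2 * (real d - 1))" using that by auto
    show ?thesis unfolding A using rho_bounds[OF assms s roots[OF l]] by blast
  qed
  \<comment> \<open>One signing serves both existence claims, because its root bound uses only
    regularity.\<close>
  obtain \<sigma> where s: "edge_signing E \<sigma>"
    and r: "\<And>l. mixed_char (adj E \<sigma>) {0..<n} (\<lambda>_. l) = 0 \<Longrightarrow> l \<le> 2 * sqrt (2 * (real d - 1))"
    by (rule exists_edge_signing[OF assms(1,3,4)]) blast
  have exist: "\<exists>\<sigma>. edge_signing E \<sigma> \<and> (triangle_free E \<longrightarrow> (rho (signed_adj_mat n E \<sigma>))\<^sup>2 \<le> bound_triangle_free d)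
      \<and> (girth E \<ge> 5 \<longrightarrow> (rho (signed_adj_mat n E \<sigma>))\<^sup>2 \<le> bound_girth_five d)"
    using rho_bounds[OF assms s r] s by blast
  note less = bound_triangle_free_less[OF assms(1)] bound_girth_five_less[OF assms(1)]
  show ?thesis
    by (intro conjI impI allI; (rule less | use given in blast | use exist less in blast))
qed

end
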